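(* Let $\mathfrak A=\overline{\bigcup_{n\in\mathbb N}\mathfrak A_n}^{\|\cdot\|_{\mathfrak A}}$ be a unital C*-algebra, where each $\mathfrak A_n$ is a unital C*-subalgebra of $\mathfrak A$ (containing $1_{\mathfrak A}$) and $\mathfrak A_n\subseteq\mathfrak A_{n+1}$. For each $n$ let $\mathsf L_n$ be a Lip-norm on $\mathfrak{sa}(\mathfrak A_n)$, so that $(\mathfrak{sa}(\mathfrak A_n),\mathsf L_n)$ is a quantum metric order unit space, and assume $\mathsf L_{n+1}(a)\le\mathsf L_n(a)$ for all $a\in\mathfrak{sa}(\mathfrak A_n)$. Let $(\beta(n))_{n\in\mathbb N}$ be positive reals with $\sum_n\beta(n)<\infty$, and assume that for each $n$ the evident bridge $\gamma_n$ from $\mathfrak A_n$ to $\mathfrak A_{n+1}$ has length $\lambda(\gamma_n|\mathsf L_n,\mathsf L_{n+1})\le\beta(n)$. Let $(\mathfrak F_{\mathfrak A},S_{\mathfrak A})$ and the maps $\psi^{(n)}:\mathfrak{sa}(\mathfrak A_n)\to\mathfrak F_{\mathfrak A}$ be as defined in the context. Then: 1. there exists an order unit isomorphism $\psi:\mathfrak{sa}(\mathfrak A)\to\mathfrak F_{\mathfrak A}$ whose restriction to $\mathfrak{sa}(\mathfrak A_n)$ is $\psi^{(n)}$ for all $n\in\mathbb N$; 2. setting $\mathsf L^\beta_{\mathfrak A}=S_{\mathfrak A}\circ\psi$, the pair $(\mathfrak{sa}(\mathfrak A),\mathsf L^\beta_{\mathfrak A})$ is a quantum metric order unit space such that $\bigcup_{n\in\mathbb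 N}\mathrm{dom}(\mathsf L_n)\subseteq\mathrm{dom}(\mathsf L^\beta_{\mathfrak A})$ and, for each $n\in\mathbb N$, $$\mathrm{dist}_q\big((\mathfrak{sa}(\mathfrak A_n),\mathsf L_n),(\mathfrak{sa}(\mathfrak A),\mathsf L^\beta_{\mathfrak A})\big)\le 4\sum_{j=n}^\infty\beta(j),$$ and therefore $\lim_{n\to\infty}\mathrm{dist}_q\big((\mathfrak{sa}(\mathfrak A_n),\mathsf L_n),(\mathfrak{sa}(\mathfrak A),\mathsf L^\beta_{\mathfrak A})\big)=0$.
   Context: **Order unit spaces and $\mathrm{dist}_q$.** An order unit space $\mathfrak A$ is an ordered real vector space with a distinguished $1_{\mathfrak A}$ such that for each $a$ there is $\lambda>0$ with $-\lambda 1_{\mathfrak A}\le a\le\lambda 1_{\mathfrak A}$, and which is Archimedean ($a\le\lambda 1_{\mathfrak A}$ for all $\lambda>0$ implies $a\le 0$). Its norm is $\|a\|=\inf\{\lambda>0:-\lambda 1_{\mathfrak A}\le a\le\lambda 1_{\mathfrak A}\}$. Its state space $\mathscr S(\mathfrak A)$ is the set of positive linear functionals $\mathfrak A\to\mathbb R$ taking value $1$ at $1_{\mathfrak A}$. The self-adjoint part $\mathfrak{sa}(\mathfrak A)$ of a unital C*-algebra is a complete order unit space. An order unit isomorphism is a unital linear bijection that is positive with positive inverse. A quantum metric order unit space $(\mathfrak A,\mathsf L)$ is a norm-complete order unit space with a seminorm $\mathsf L$ (a Lip-norm) defined on a norm-dense subspace $\mathrm{dom}(\mathsf L)$ (convention: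 $\mathsf L=\infty$ outside) such that: (1) $\{a:\mathsf L(a)=0\}=\mathbb R1_{\mathfrak A}$; (2) $\mathsf{mk}_{\mathsf L}(\varphi,\psi)=\sup\{|\varphi(a)-\psi(a)|:\mathsf L(a)\le 1\}$ is a metric inducing the weak* topology on $\mathscr S(\mathfrak A)$; (3) $\{a:\mathsf L(a)\le 1\}$ is norm-closed. For two such spaces $(\mathfrak A_1,\mathsf L_1),(\mathfrak A_2,\mathsf L_2)$, a Lip-norm $\mathsf L$ on $\mathfrak A_1\oplus\mathfrak A_2$ (coordinatewise order, unit $(1,1)$) is admissible if its quotient seminorm on $\mathfrak A_j$ (infimum of $\mathsf L$ over the other coordinate) is $\mathsf L_j$ for $j=1,2$. $\mathrm{dist}_q((\mathfrak A_1,\mathsf L_1),(\mathfrak A_2,\mathsf L_2))$ is the infimum over admissible $\mathsf L$ of the Hausdorff distance, for $\mathsf{mk}_{\mathsf L}$, between $\mathscr S(\mathfrak A_1)$ and $\mathscr S(\mathfrak A_2)$, both viewed in $\mathscr S(\mathfrak A_1\oplus\mathfrak A_2)$ via the coordinate projections. **Bridge length.** The evident bridge is $\gamma_n=(\mathfrak A_{n+1},1_{\mathfrak A},\iota_n,\mathrm{id}_{\mathfrak A_{n+1}})$ with $\iota_n$ the inclusion, and $\lambda(\gamma_n|\mathsf L_n,\mathsf L_{n+1})$ is the maximum of $\sup_{a\in\mathfrak{sa}(\mathfrak A_n),\,\mathsf L_n(a)\le1}\inf_{b\in\mathfrak{sa}(\mathfrak A_{n+1}),\,\mathsf L_{n+1}(b)\le1}\|a-b\|$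 and $\sup_{b\in\mathfrak{sa}(\mathfrak A_{n+1}),\,\mathsf L_{n+1}(b)\le1}\inf_{a\in\mathfrak{sa}(\mathfrak A_n),\,\mathsf L_n(a)\le1}\|a-b\|$. **The space $(\mathfrak F_{\mathfrak A},S_{\mathfrak A})$.** Let $\mathfrak D_n=\mathfrak{sa}(\mathfrak A_n)\oplus\mathfrak{sa}(\mathfrak A_{n+1})$ (max norm) and $\mathsf L^n(a,b)=\max\{\mathsf L_n(a),\mathsf L_{n+1}(b),\|a-b\|/(2\beta(n))\}$. Let $\mathfrak B$ be the space of bounded sequences $d=((a^n_n,a^n_{n+1}))_{n}\in\prod_n\mathfrak D_n$ with sup norm and coordinatewise order, $\mathfrak K=\{d\in\mathfrak B:a^n_{n+1}=a^{n+1}_{n+1}\ \forall n\}$, $S_0(d)=\sup_n\mathsf L^n(a_n^n,a_{n+1}^n)$, $\mathfrak L=\{d\in\mathfrak K:S_0(d)<\infty\}$, $\mathfrak E$ the norm closure of $\mathfrak L$ in $\mathfrak B$, $\mathfrak J=\{d\in\mathfrak E:\lim_n\|(a^n_n,a^n_{n+1})\|=0\}$. Then $\mathfrak F_{\mathfrak A}=\mathfrak E/\mathfrak J$ with quotient map $q$ and the quotient order ($f\ge0$ iff $f=q(d)$ for some $d\in\mathfrak E$ with $d\ge0$), order unit $q(1)$, and $S_{\mathfrak A}(f)=\inf\{S_0(d):d\in\mathfrak E,\ q(d)=f\}$; $(\mathfrak F_{\mathfrak A},S_{\mathfrak A})$ is a quantum metric order unit space. **The maps $\psi^{(n)}$.**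 $\psi_0(a)=((a,a))_{k\in\mathbb N}$, and for $n\ge1$, $\psi_n(a)=((0,0),\dots,(0,0),(0,a),(a,a),(a,a),\dots)$ with $(0,a)\in\mathfrak D_{n-1}$ in position $n-1$; these take values in $\mathfrak E$, and $\psi^{(n)}=q\circ\psi_n$. *)

theory Defs
  imports "HOL-Analysis.Analysis"
begin

section \<open>Unital C*-algebras and their unital C*-subalgebras\<close>

text \<open>
  The class is built on \<^class>\<open>monoid_mult\<close> rather than \<^class>\<open>ring_1\<close>, so that
  the zero algebra is not excluded.
\<close>

class unital_cstar_algebra = real_normed_algebra + banach + monoid_mult +
  fixes scaleC :: "complex \<Rightarrow> 'a \<Rightarrow> 'a"  (infixr "*\<^sub>C" 75)
    and star :: "'a \<Rightarrow> 'a"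
  assumes scaleC_add_right: "c *\<^sub>C (x + y) = c *\<^sub>C x + c *\<^sub>C y"
    and scaleC_add_left: "(c + d) *\<^sub>C x = c *\<^sub>C x + d *\<^sub>C x"
    and scaleC_scaleC: "c *\<^sub>C d *\<^sub>C x = (c * d) *\<^sub>C x"
    and scaleR_scaleC: "r *\<^sub>R x = complex_of_real r *\<^sub>C x"
    and mult_scaleC_left: "(c *\<^sub>C x) * y = c *\<^sub>C (x * y)"
    and mult_scaleC_right: "x * (c *\<^sub>C y) = c *\<^sub>C (x * y)"
    and norm_scaleC: "norm (c *\<^sub>C x) = cmod c * norm x"
    and star_star: "star (star x) = x"
    and star_add: "star (x + y) = star x + star y"
    and star_scaleC: "star (c *\<^sub>C x) = cnj c *\<^sub>C star x"
    and star_mult: "star (x * y) = star y * star x"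
    and cstar_identity: "norm (star x * x) = (norm x)\<^sup>2"

definition cstar_subalgebra :: "'a::unital_cstar_algebra set \<Rightarrow> bool" where
  "cstar_subalgebra B \<longleftrightarrow>
     1 \<in> B \<and> closed B \<and>
     (\<forall>x\<in>B. \<forall>y\<in>B. x + y \<in> B \<and> x * y \<in> B) \<and>
     (\<forall>c. \<forall>x\<in>B. c *\<^sub>C x \<in> B) \<and>
     (\<forall>x\<in>B. star x \<in> B)"

definition sa :: "'a::unital_cstar_algebra set \<Rightarrow> 'a set" where
  "sa B = {x \<in> B. star x = x}"


section \<open>Order unit spaces\<close>

record 'v ous =
  carrier :: "'v set"
  add :: "'v \<Rightarrow> 'v \<Rightarrow> 'v"
  zero :: 'v
  scale :: "real \<Rightarrow> 'v \<Rightarrow> 'v"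
  le :: "'v \<Rightarrow> 'v \<Rightarrow> bool"
  unit :: 'v

definition diff :: "'v ous \<Rightarrow> 'v \<Rightarrow> 'v \<Rightarrow> 'v" where
  "diff V x y = add V x (scale V (- 1) y)"

locale order_unit_space =
  fixes V :: "'v ous"
  assumes add_closed: "x \<in> carrier V \<Longrightarrow> y \<in> carrier V \<Longrightarrow> add V x y \<in> carrier V"
    and zero_closed: "zero V \<in> carrier V"
    and scale_closed: "x \<in> carrier V \<Longrightarrow> scale V c x \<in> carrier V"
    and add_assoc: "x \<in> carrier V \<Longrightarrow> y \<in> carrier V \<Longrightarrow> z \<in> carrier V \<Longrightarrow>
      add V (add V x y) z = add V x (add V y z)"
    and add_commute: "x \<in> carrier V \<Longrightarrow> y \<in> carrier V \<Longrightarrow> add V x y = add V y x"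
    and add_zero: "x \<in> carrier V \<Longrightarrow> add V x (zero V) = x"
    and add_inverse: "x \<in> carrier V \<Longrightarrow> \<exists>y\<in>carrier V. add V x y = zero V"
    and scale_add_right: "x \<in> carrier V \<Longrightarrow> y \<in> carrier V \<Longrightarrow>
      scale V c (add V x y) = add V (scale V c x) (scale V c y)"
    and scale_add_left: "x \<in> carrier V \<Longrightarrow>
      scale V (c + d) x = add V (scale V c x) (scale V d x)"
    and scale_scale: "x \<in> carrier V \<Longrightarrow> scale V c (scale V d x) = scale V (c * d) x"
    and scale_one: "x \<in> carrier V \<Longrightarrow> scale V 1 x = x"
    and le_refl: "x \<in> carrier V \<Longrightarrow> le V x x"
    and le_antisym: "x \<in> carrier V \<Longrightarrow> y \<in> carrier V \<Longrightarrow> le V x y \<Longrightarrow> le V y x \<Longrightarrow> x = y"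
    and le_trans: "x \<in> carrier V \<Longrightarrow> y \<in> carrier V \<Longrightarrow> z \<in> carrier V \<Longrightarrow>
      le V x y \<Longrightarrow> le V y z \<Longrightarrow> le V x z"
    and le_add: "x \<in> carrier V \<Longrightarrow> y \<in> carrier V \<Longrightarrow> z \<in> carrier V \<Longrightarrow>
      le V x y \<Longrightarrow> le V (add V x z) (add V y z)"
    and le_scale: "x \<in> carrier V \<Longrightarrow> y \<in> carrier V \<Longrightarrow> 0 \<le> c \<Longrightarrow>
      le V x y \<Longrightarrow> le V (scale V c x) (scale V c y)"
    and unit_closed: "unit V \<in> carrier V"
    and order_unit: "x \<in> carrier V \<Longrightarrow>
      \<exists>t>0. le V (scale V (- t) (unit V)) x \<and> le V x (scale V t (unit V))"
    and archimedean: "x \<in> carrier V \<Longrightarrow> (\<And>t. 0 < t \<Longrightarrow> le V x (scale V t (unit V))) \<Longrightarrow>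
      le V x (zero V)"

definition ous_norm :: "'v ous \<Rightarrow> 'v \<Rightarrow> real" where
  "ous_norm V x =
     Inf {t. 0 < t \<and> le V (scale V (- t) (unit V)) x \<and> le V x (scale V t (unit V))}"

text \<open>
  The value \<open>0\<close> off the carrier only serves the locale \<^locale>\<open>Metric_space\<close>, which asks for
  symmetry and nonnegativity of a metric on the whole type.
\<close>

definition ous_dist :: "'v ous \<Rightarrow> 'v \<Rightarrow> 'v \<Rightarrow> real" where
  "ous_dist V x y =
     (if x \<in> carrier V \<and> y \<in> carrier V then ous_norm V (diff V x y) else 0)"

abbreviation norm_topology :: "'v ous \<Rightarrow> 'v topology" where
  "norm_topology V \<equiv> Metric_space.mtopology (carrier V) (ous_dist V)"

text \<open>
  Functionals are extensional on the carrier, so that states are determined by their values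
  on the space.
\<close>

definition states :: "'v ous \<Rightarrow> ('v \<Rightarrow> real) set" where
  "states V = {\<phi> \<in> extensional (carrier V).
     (\<forall>x\<in>carrier V. \<forall>y\<in>carrier V. \<phi> (add V x y) = \<phi> x + \<phi> y) \<and>
     (\<forall>c. \<forall>x\<in>carrier V. \<phi> (scale V c x) = c * \<phi> x) \<and>
     (\<forall>x\<in>carrier V. le V (zero V) x \<longrightarrow> 0 \<le> \<phi> x) \<and>
     \<phi> (unit V) = 1}"

definition weak_star_topology :: "'v ous \<Rightarrow> ('v \<Rightarrow> real) topology" where
  "weak_star_topology V =
     subtopology (product_topology (\<lambda>_. euclideanreal) (carrier V)) (states V)"

definition order_unit_iso :: "'v ous \<Rightarrow> 'w ous \<Rightarrow> ('v \<Rightarrow> 'w) \<Rightarrow> bool" where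
  "order_unit_iso V W f \<longleftrightarrow>
     bij_betw f (carrier V) (carrier W) \<and>
     (\<forall>x\<in>carrier V. \<forall>y\<in>carrier V. f (add V x y) = add W (f x) (f y)) \<and>
     (\<forall>c. \<forall>x\<in>carrier V. f (scale V c x) = scale W c (f x)) \<and>
     f (unit V) = unit W \<and>
     (\<forall>x\<in>carrier V. le V (zero V) x \<longrightarrow> le W (zero W) (f x)) \<and>
     (\<forall>y\<in>carrier W. le W (zero W) y \<longrightarrow> le V (zero V) (inv_into (carrier V) f y))"

text \<open>
  The order of \<^term>\<open>sa B\<close> is that of the C*-algebra \<open>B\<close> itself: the witness \<open>b\<close> ranges over \<open>B\<close>.
\<close>

definition sa_ous :: "'a::unital_cstar_algebra set \<Rightarrow> 'a ous" where
  "sa_ous B = \<lparr>carrier = sa B, add = (+), zero = 0, scale = (*\<^sub>R),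
     le = (\<lambda>x y. \<exists>b\<in>B. y - x = star b * b), unit = 1\<rparr>"

definition ous_sum :: "'v ous \<Rightarrow> 'w ous \<Rightarrow> ('v \<times> 'w) ous" where
  "ous_sum V W = \<lparr>carrier = carrier V \<times> carrier W,
     add = (\<lambda>x y. (add V (fst x) (fst y), add W (snd x) (snd y))),
     zero = (zero V, zero W),
     scale = (\<lambda>c x. (scale V c (fst x), scale W c (snd x))),
     le = (\<lambda>x y. le V (fst x) (fst y) \<and> le W (snd x) (snd y)),
     unit = (unit V, unit W)\<rparr>"

definition coset :: "'v ous \<Rightarrow> 'v set \<Rightarrow> 'v \<Rightarrow> 'v set" where
  "coset V J x = {add V x j | j. j \<in> J}"

definition ous_quotient_add :: "'v ous \<Rightarrow> 'v set \<Rightarrow> 'v set \<Rightarrow> 'v set \<Rightarrow> 'v set" where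
  "ous_quotient_add V J X Y = (\<Union>x\<in>X. \<Union>y\<in>Y. coset V J (add V x y))"

text \<open>
  In the quotient, \<open>X \<le> Y\<close> means that \<open>Y - X\<close> is the class of a positive element.
\<close>

definition ous_quotient :: "'v ous \<Rightarrow> 'v set \<Rightarrow> 'v set ous" where
  "ous_quotient V J = \<lparr>carrier = coset V J ` carrier V,
     add = ous_quotient_add V J,
     zero = coset V J (zero V),
     scale = (\<lambda>c X. \<Union>x\<in>X. coset V J (scale V c x)),
     le = (\<lambda>X Y. \<exists>d\<in>carrier V. le V (zero V) d \<and> Y = ous_quotient_add V J X (coset V J d)),
     unit = coset V J (unit V)\<rparr>"


section \<open>Lip-norms and the distance between quantum metric order unit spaces\<close>

text \<open>
  A Lip-norm is a function into \<^typ>\<open>ennreal\<close>, equal to \<^term>\<open>\<infinity>\<close> at the points of the carrier outside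
  its domain; its values off the carrier are never used. Since \<open>0 * \<infinity> = 0\<close> in \<^typ>\<open>ennreal\<close>,
  homogeneity on the whole carrier is consistent with this convention.
\<close>

definition dom_of :: "'v ous \<Rightarrow> ('v \<Rightarrow> ennreal) \<Rightarrow> 'v set" where
  "dom_of V L = {x \<in> carrier V. L x < \<infinity>}"

definition lip_ball :: "'v ous \<Rightarrow> ('v \<Rightarrow> ennreal) \<Rightarrow> 'v set" where
  "lip_ball V L = {x \<in> carrier V. L x \<le> 1}"

definition mk :: "'v ous \<Rightarrow> ('v \<Rightarrow> ennreal) \<Rightarrow> ('v \<Rightarrow> real) \<Rightarrow> ('v \<Rightarrow> real) \<Rightarrow> ennreal" where
  "mk V L \<phi> \<psi> = (SUP x\<in>lip_ball V L. ennreal \<bar>\<phi> x - \<psi> x\<bar>)"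

definition quantum_metric_ous :: "'v ous \<Rightarrow> ('v \<Rightarrow> ennreal) \<Rightarrow> bool" where
  "quantum_metric_ous V L \<longleftrightarrow>
     order_unit_space V \<and>
     Metric_space.mcomplete (carrier V) (ous_dist V) \<and>
     (\<forall>x\<in>carrier V. \<forall>y\<in>carrier V. L (add V x y) \<le> L x + L y) \<and>
     (\<forall>c. \<forall>x\<in>carrier V. L (scale V c x) = ennreal \<bar>c\<bar> * L x) \<and>
     norm_topology V closure_of dom_of V L = carrier V \<and>
     {x \<in> carrier V. L x = 0} = range (\<lambda>c. scale V c (unit V)) \<and>
     (\<forall>\<phi>\<in>states V. \<forall>\<psi>\<in>states V. mk V L \<phi> \<psi> < \<infinity>) \<and>
     Metric_space (states V) (\<lambda>\<phi> \<psi>. enn2real (mk V L \<phi> \<psi>)) \<and>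
     Metric_space.mtopology (states V) (\<lambda>\<phi> \<psi>. enn2real (mk V L \<phi> \<psi>)) = weak_star_topology V \<and>
     closedin (norm_topology V) (lip_ball V L)"

definition hausdorff_distance :: "('x \<Rightarrow> 'x \<Rightarrow> ennreal) \<Rightarrow> 'x set \<Rightarrow> 'x set \<Rightarrow> ennreal" where
  "hausdorff_distance d S T =
     max (SUP x\<in>S. INF y\<in>T. d x y) (SUP y\<in>T. INF x\<in>S. d x y)"

definition admissible ::
  "'v ous \<Rightarrow> ('v \<Rightarrow> ennreal) \<Rightarrow> 'w ous \<Rightarrow> ('w \<Rightarrow> ennreal) \<Rightarrow> ('v \<times> 'w \<Rightarrow> ennreal) \<Rightarrow> bool" where
  "admissible V L\<^sub>V W L\<^sub>W L \<longleftrightarrow>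
     quantum_metric_ous (ous_sum V W) L \<and>
     (\<forall>x\<in>carrier V. (INF y\<in>carrier W. L (x, y)) = L\<^sub>V x) \<and>
     (\<forall>y\<in>carrier W. (INF x\<in>carrier V. L (x, y)) = L\<^sub>W y)"

definition states_fst :: "'v ous \<Rightarrow> 'w ous \<Rightarrow> ('v \<times> 'w \<Rightarrow> real) set" where
  "states_fst V W = (\<lambda>\<phi>. restrict (\<phi> \<circ> fst) (carrier (ous_sum V W))) ` states V"

definition states_snd :: "'v ous \<Rightarrow> 'w ous \<Rightarrow> ('v \<times> 'w \<Rightarrow> real) set" where
  "states_snd V W = (\<lambda>\<phi>. restrict (\<phi> \<circ> snd) (carrier (ous_sum V W))) ` states W"

definition dist_q ::
  "'v ous \<Rightarrow> ('v \<Rightarrow> ennreal) \<Rightarrow> 'w ous \<Rightarrow> ('w \<Rightarrow> ennreal) \<Rightarrow> ennreal" where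
  "dist_q V L\<^sub>V W L\<^sub>W =
     (INF L\<in>{L. admissible V L\<^sub>V W L\<^sub>W L}.
        hausdorff_distance (mk (ous_sum V W) L) (states_fst V W) (states_snd V W))"


section \<open>The evident bridge\<close>

text \<open>
  The bridge from \<open>B\<close> to \<open>C\<close> has pivot \<open>1\<close> and, as its two maps, the inclusion of \<open>B\<close> into \<open>C\<close> and
  the identity of \<open>C\<close>. With pivot \<open>1\<close> the height vanishes and the length is the reach.
\<close>

definition evident_bridge_length ::
  "'a::unital_cstar_algebra set \<Rightarrow> ('a \<Rightarrow> ennreal) \<Rightarrow> 'a set \<Rightarrow> ('a \<Rightarrow> ennreal) \<Rightarrow> ennreal" where
  "evident_bridge_length B L\<^sub>B C L\<^sub>C =
     max (SUP a\<in>lip_ball (sa_ous B) L\<^sub>B. INF b\<in>lip_ball (sa_ous C) L\<^sub>C. ennreal (norm (a - b)))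
         (SUP b\<in>lip_ball (sa_ous C) L\<^sub>C. INF a\<in>lip_ball (sa_ous B) L\<^sub>B. ennreal (norm (a - b)))"


section \<open>The limit space\<close>

definition max_norm :: "'a::real_normed_vector \<times> 'a \<Rightarrow> real" where
  "max_norm p = max (norm (fst p)) (norm (snd p))"

definition D_space :: "(nat \<Rightarrow> 'a::unital_cstar_algebra set) \<Rightarrow> nat \<Rightarrow> ('a \<times> 'a) ous" where
  "D_space A n = ous_sum (sa_ous (A n)) (sa_ous (A (Suc n)))"

definition D_lip ::
  "(nat \<Rightarrow> 'a::unital_cstar_algebra \<Rightarrow> ennreal) \<Rightarrow> (nat \<Rightarrow> real) \<Rightarrow> nat \<Rightarrow> 'a \<times> 'a \<Rightarrow> ennreal" where
  "D_lip L \<beta> n p =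
     max (max (L n (fst p)) (L (Suc n) (snd p)))
         (ennreal (norm (fst p - snd p) / (2 * \<beta> n)))"

definition B_set :: "(nat \<Rightarrow> 'a::unital_cstar_algebra set) \<Rightarrow> (nat \<Rightarrow> 'a \<times> 'a) set" where
  "B_set A = {d. (\<forall>n. d n \<in> carrier (D_space A n)) \<and> bdd_above (range (\<lambda>n. max_norm (d n)))}"

definition B_norm :: "(nat \<Rightarrow> 'a::unital_cstar_algebra \<times> 'a) \<Rightarrow> real" where
  "B_norm d = (SUP n. max_norm (d n))"

definition K_set :: "(nat \<Rightarrow> 'a::unital_cstar_algebra set) \<Rightarrow> (nat \<Rightarrow> 'a \<times> 'a) set" where
  "K_set A = {d \<in> B_set A. \<forall>n. snd (d n) = fst (d (Suc n))}"

definition S0 ::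
  "(nat \<Rightarrow> 'a::unital_cstar_algebra \<Rightarrow> ennreal) \<Rightarrow> (nat \<Rightarrow> real) \<Rightarrow> (nat \<Rightarrow> 'a \<times> 'a) \<Rightarrow> ennreal" where
  "S0 L \<beta> d = (SUP n. D_lip L \<beta> n (d n))"

definition L_set ::
  "(nat \<Rightarrow> 'a::unital_cstar_algebra set) \<Rightarrow> (nat \<Rightarrow> 'a \<Rightarrow> ennreal) \<Rightarrow> (nat \<Rightarrow> real) \<Rightarrow>
    (nat \<Rightarrow> 'a \<times> 'a) set" where
  "L_set A L \<beta> = {d \<in> K_set A. S0 L \<beta> d < \<infinity>}"

definition E_set ::
  "(nat \<Rightarrow> 'a::unital_cstar_algebra set) \<Rightarrow> (nat \<Rightarrow> 'a \<Rightarrow> ennreal) \<Rightarrow> (nat \<Rightarrow> real) \<Rightarrow>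
    (nat \<Rightarrow> 'a \<times> 'a) set" where
  "E_set A L \<beta> = {d \<in> B_set A. \<forall>\<epsilon>>0. \<exists>e\<in>L_set A L \<beta>. B_norm (\<lambda>n. d n - e n) < \<epsilon>}"

definition J_set ::
  "(nat \<Rightarrow> 'a::unital_cstar_algebra set) \<Rightarrow> (nat \<Rightarrow> 'a \<Rightarrow> ennreal) \<Rightarrow> (nat \<Rightarrow> real) \<Rightarrow>
    (nat \<Rightarrow> 'a \<times> 'a) set" where
  "J_set A L \<beta> = {d \<in> E_set A L \<beta>. (\<lambda>n. max_norm (d n)) \<longlonglongrightarrow> 0}"

definition E_space ::
  "(nat \<Rightarrow> 'a::unital_cstar_algebra set) \<Rightarrow> (nat \<Rightarrow> 'a \<Rightarrow> ennreal) \<Rightarrow> (nat \<Rightarrow> real) \<Rightarrow>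
    (nat \<Rightarrow> 'a \<times> 'a) ous" where
  "E_space A L \<beta> = \<lparr>carrier = E_set A L \<beta>,
     add = (\<lambda>d e n. add (D_space A n) (d n) (e n)),
     zero = (\<lambda>n. zero (D_space A n)),
     scale = (\<lambda>c d n. scale (D_space A n) c (d n)),
     le = (\<lambda>d e. \<forall>n. le (D_space A n) (d n) (e n)),
     unit = (\<lambda>n. unit (D_space A n))\<rparr>"

definition F_quot ::
  "(nat \<Rightarrow> 'a::unital_cstar_algebra set) \<Rightarrow> (nat \<Rightarrow> 'a \<Rightarrow> ennreal) \<Rightarrow> (nat \<Rightarrow> real) \<Rightarrow>
    (nat \<Rightarrow> 'a \<times> 'a) \<Rightarrow> (nat \<Rightarrow> 'a \<times> 'a) set" where
  "F_quot A L \<beta> = coset (E_space A L \<beta>) (J_set A L \<beta>)"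

definition F_space ::
  "(nat \<Rightarrow> 'a::unital_cstar_algebra set) \<Rightarrow> (nat \<Rightarrow> 'a \<Rightarrow> ennreal) \<Rightarrow> (nat \<Rightarrow> real) \<Rightarrow>
    (nat \<Rightarrow> 'a \<times> 'a) set ous" where
  "F_space A L \<beta> = ous_quotient (E_space A L \<beta>) (J_set A L \<beta>)"

definition F_lip ::
  "(nat \<Rightarrow> 'a::unital_cstar_algebra set) \<Rightarrow> (nat \<Rightarrow> 'a \<Rightarrow> ennreal) \<Rightarrow> (nat \<Rightarrow> real) \<Rightarrow>
    (nat \<Rightarrow> 'a \<times> 'a) set \<Rightarrow> ennreal" where
  "F_lip A L \<beta> f = (INF d\<in>{d \<in> E_set A L \<beta>. F_quot A L \<beta> d = f}. S0 L \<beta> d)"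

definition psi_seq :: "nat \<Rightarrow> 'a::unital_cstar_algebra \<Rightarrow> nat \<Rightarrow> 'a \<times> 'a" where
  "psi_seq n a = (\<lambda>k. if n \<le> k then (a, a) else if Suc k = n then (0, a) else (0, 0))"

definition psi ::
  "(nat \<Rightarrow> 'a::unital_cstar_algebra set) \<Rightarrow> (nat \<Rightarrow> 'a \<Rightarrow> ennreal) \<Rightarrow> (nat \<Rightarrow> real) \<Rightarrow>
    nat \<Rightarrow> 'a \<Rightarrow> (nat \<Rightarrow> 'a \<times> 'a) set" where
  "psi A L \<beta> n a = F_quot A L \<beta> (psi_seq n a)"

end

theory Submission
  imports Defs
begin

text \<open>
  An element of \<open>\<KK>\<close> is the sequence of consecutive pairs of a single sequence \<open>x\<close> with \<open>x n\<close> in \<open>sa (A n)\<close>, called a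
  selection. If \<open>S\<^sub>0\<close> is finite on it, then \<open>norm (x n - x (n + 1))\<close> is at most a multiple of \<open>\<beta> n\<close>, so \<open>x\<close> converges because
  \<open>\<beta>\<close> is summable. Uniform approximation preserves convergence, and conversely every convergent selection is a uniform limit of
  selections with finite \<open>S\<^sub>0\<close>, namely eventually constant ones with entries in the domains of the Lip-norms. Hence \<open>\<EE>\<close>
  consists of the convergent selections, \<open>\<JJ>\<close> of the null ones (\<open>E_set_eq\<close>, \<open>J_set_eq\<close>), and the quotient is the space of limits,
  which by density is all of \<open>sa UNIV\<close>. The isomorphism sends \<open>a\<close> to the class of all selections with limit \<open>a\<close>. It is
  positive because a positive \<open>a\<close> is a square \<open>h\<^sup>2\<close>, and squaring a selection that converges to \<open>h\<close> gives a positive selection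
  that converges to \<open>a\<close>; its inverse is positive because limits of positive elements are positive (\<open>order_unit_iso_fiber\<close>).

  In this picture the new seminorm satisfies \<open>limit_lip a \<le> c\<close> when, up to an arbitrarily small loss, \<open>a\<close> is the limit of a path \<open>x\<close>
  with \<open>L n (x n) \<le> c\<close> and \<open>norm (x n - x (n + 1)) \<le> 2 c \<beta> n\<close>. Such a path stays within \<open>c * tail n\<close> of its limit after time \<open>n\<close>, where
  \<open>tail n\<close> is twice the \<open>n\<close>-th tail of the series of \<open>\<beta>\<close>. To see that this is a Lip-norm, Rieffel's criterion is used in both
  directions: a seminorm metrises the weak* topology of the state space exactly when its unit ball is compact modulo scalars
  (\<open>lip_ball_compact_mod_scalars\<close>, \<open>quantum_metric_ous_of_compact\<close>). For each \<open>L n\<close> it yields compactness; by Tychonoff's theorem the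
  set of bounded paths of constant \<open>1\<close> is compact; the limit map is continuous on it, being a uniform limit of coordinates; so
  the unit ball of the limit is compact modulo scalars (\<open>limit_lip_ball_compact\<close>).

  For the distance, the bridges allow every element of the Lip-ball of \<open>A n\<close> to be completed to a path of constant \<open>1\<close>
  (\<open>lip_path_through\<close>). Thus the Lip-balls of \<open>A n\<close> and of the limit are within \<open>tail n\<close> of each other, which says that
  the maximum of \<open>L n x\<close>, \<open>limit_lip a\<close> and \<open>norm (x - a) / tail n\<close> is admissible (\<open>joint_lip_admissible\<close>). For this Lip-norm a state of
  the whole algebra and its restriction to \<open>A n\<close> have distance at most \<open>tail n\<close>, and every state of \<open>A n\<close> is such a
  restriction by the Hahn-Banach theorem (\<open>state_extension\<close>), so the Hausdorff distance of the state spaces is at most \<open>tail n\<close>.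

  All this needs the order of \<open>sa B\<close>, whose positive elements are the \<open>b\<^sup>* b\<close>, to be that of an order unit space with the C*-norm as
  its norm. The key facts are that \<open>b\<^sup>* b\<close> is positive in a norm sense and that positive elements have positive square roots in the closed
  subalgebra they generate (\<open>positive_star_mult_self\<close>, \<open>order_unit_space_sa\<close>, \<open>ous_norm_sa\<close>). Both are derived from the
  binomial series of the square root.
\<close>

section \<open>Square roots by the binomial series\<close>

text \<open>
  The Taylor coefficients at \<open>0\<close> of \<open>t \<mapsto> sqrt (1 - t)\<close>.
\<close>

definition sqrt_coeff :: "nat \<Rightarrow> real" where
  "sqrt_coeff k = ((1/2) gchoose k) * (- 1) ^ k"

lemma sqrt_coeff_0 [simp]: "sqrt_coeff 0 = 1"
  by (simp add: sqrt_coeff_def)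

text \<open>
  All coefficients but the first are negative, and their partial sums have a closed form that stays
  nonnegative. This gives absolute summability up to the boundary of the unit disc, so that
  the series can be evaluated at every element of norm at most \<open>1\<close>, and it bounds the total mass of the higher
  coefficients by \<open>1\<close>, which is what makes the roots positive.
\<close>

lemma sum_sqrt_coeff_nonneg: "0 \<le> (\<Sum>k\<le>m. sqrt_coeff k)"
proof -
  have "(\<Sum>k\<le>m. sqrt_coeff k) = (- 1) ^ m * ((- 1/2) gchoose m)"
    unfolding sqrt_coeff_def by (subst gbinomial_sum_lower_neg) simp
  also have "\<dots> = pochhammer (1/2) m / fact m"
    by (simp add: gbinomial_pochhammer flip: power_mult_distrib mult.assoc)
  finally show ?thesis
    by (simp add: pochhammer_nonneg)
qed

lemma sqrt_coeff_Suc_nonpos: "sqrt_coeff (Suc k) \<le> 0"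
proof -
  have "sqrt_coeff (Suc k) = - (1 / 2 / real (Suc k)) * (((- 1/2) gchoose k) * (- 1) ^ k)"
    using gbinomial_absorption[of k "1/2 :: real"]
    by (simp add: sqrt_coeff_def field_simps)
  also have "((- 1/2) gchoose k) * (- 1) ^ k = (\<Sum>k\<le>k. sqrt_coeff k)"
    unfolding sqrt_coeff_def by (subst gbinomial_sum_lower_neg) simp
  finally show ?thesis
    using sum_sqrt_coeff_nonneg[of k] by (simp add: mult_nonneg_nonneg)
qed

lemma sum_abs_sqrt_coeff_Suc_le: "(\<Sum>k<n. \<bar>sqrt_coeff (Suc k)\<bar>) \<le> 1"
proof -
  have "(\<Sum>k<n. \<bar>sqrt_coeff (Suc k)\<bar>) = - (\<Sum>k<n. sqrt_coeff (Suc k))"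
    using sqrt_coeff_Suc_nonpos by (simp add: sum_negf abs_of_nonpos)
  also have "\<dots> = 1 - (\<Sum>k\<le>n. sqrt_coeff k)"
    by (simp add: sum.atMost_shift)
  finally show ?thesis
    using sum_sqrt_coeff_nonneg[of n] by simp
qed

lemma summable_abs_sqrt_coeff_Suc: "summable (\<lambda>k. \<bar>sqrt_coeff (Suc k)\<bar>)"
  by (rule summableI_nonneg_bounded[where x = 1]) (auto simp: sum_abs_sqrt_coeff_Suc_le)

lemma suminf_abs_sqrt_coeff_Suc_le: "(\<Sum>k. \<bar>sqrt_coeff (Suc k)\<bar>) \<le> 1"
  by (rule suminf_le_const[OF summable_abs_sqrt_coeff_Suc]) (rule sum_abs_sqrt_coeff_Suc_le)

text \<open>
  Vandermonde's identity for the exponent \<open>1/2 + 1/2\<close>: the square of the series is \<open>1 - t\<close>.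
\<close>

lemma sum_sqrt_coeff_convolution:
  "(\<Sum>i\<le>k. sqrt_coeff i * sqrt_coeff (k - i)) = (if k = 0 then 1 else if k = 1 then - 1 else 0)"
proof -
  have "(\<Sum>i\<le>k. sqrt_coeff i * sqrt_coeff (k - i))
      = (- 1) ^ k * (\<Sum>i\<in>{0..k}. ((1/2 :: real) gchoose i) * ((1/2) gchoose (k - i)))"
    unfolding sum_distrib_left sqrt_coeff_def atMost_atLeast0
    by (rule sum.cong) (auto simp: power_add[symmetric] simp del: power_add)
  also have "\<dots> = (- 1) ^ k * ((1 :: real) gchoose k)"
    by (simp add: gbinomial_Vandermonde)
  also have "(1 :: real) gchoose k = of_nat (1 choose k)"
    using binomial_gbinomial[of 1 k, where 'a = real] by simp
  finally show ?thesis
    by (cases k; cases "k - 1") (auto simp: binomial_eq_0)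
qed


lemma star_zero [simp]: "star (0::'a::unital_cstar_algebra) = 0"
  using star_add[of "0::'a" 0] by simp

lemma star_minus: "star (- x) = - star (x::'a::unital_cstar_algebra)"
  using star_add[of x "- x"] by (simp add: eq_neg_iff_add_eq_0 add.commute)

lemma star_diff: "star (x - y) = star x - star (y::'a::unital_cstar_algebra)"
  using star_add[of x "- y"] by (simp add: star_minus)

lemma star_one [simp]: "star (1::'a::unital_cstar_algebra) = 1"
proof -
  have "star (star (1::'a) * 1) = star 1 * star (star 1)"
    by (rule star_mult)
  then show ?thesis
    by (simp add: star_star)
qed

lemma star_scaleR: "star (r *\<^sub>R x) = r *\<^sub>R star (x::'a::unital_cstar_algebra)"
  by (simp add: scaleR_scaleC star_scaleC)

lemma norm_star [simp]: "norm (star x) = norm (x::'a::unital_cstar_algebra)"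
proof -
  have le: "norm y \<le> norm (star y)" for y :: 'a
  proof (cases "norm y = 0")
    case False
    have "(norm y)\<^sup>2 \<le> norm (star y) * norm y"
      unfolding cstar_identity[symmetric] by (rule norm_mult_ineq)
    with False show ?thesis
      by (simp add: power2_eq_square)
  qed auto
  from le[of x] le[of "star x"] show ?thesis
    by (simp add: star_star)
qed

lemma bounded_linear_star: "bounded_linear (star :: 'a::unital_cstar_algebra \<Rightarrow> 'a)"
  by (rule bounded_linear_intro[where K = 1]) (simp_all add: star_add star_scaleR)

lemma norm_square_self_adjoint:
  "star x = x \<Longrightarrow> norm (x * x) = (norm (x::'a::unital_cstar_algebra))\<^sup>2"
  using cstar_identity[of x] by simp

lemma square_eq_0_self_adjoint:
  "star x = x \<Longrightarrow> x * x = 0 \<Longrightarrow> x = (0::'a::unital_cstar_algebra)"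
  using norm_square_self_adjoint[of x] by simp

text \<open>
  In the zero algebra the unit has norm \<open>0\<close>, hence an inequality.
\<close>

lemma norm_one_le: "norm (1::'a::unital_cstar_algebra) \<le> 1"
proof -
  have "norm (1::'a) = (norm (1::'a))\<^sup>2"
    using cstar_identity[of "1::'a"] by simp
  then show ?thesis
    by (metis norm_ge_zero order.refl mult_cancel_left2 power2_eq_square zero_le_one)
qed

lemma norm_scaleR_one_le: "0 \<le> t \<Longrightarrow> norm (t *\<^sub>R (1::'a::unital_cstar_algebra)) \<le> t"
  using mult_left_mono[OF norm_one_le, of t] by simp

lemma norm_power_le: "norm (x ^ k) \<le> norm (x::'a::unital_cstar_algebra) ^ k"
proof (induction k)
  case (Suc k)
  have "norm (x ^ Suc k) \<le> norm x * norm (x ^ k)"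
    by (simp add: norm_mult_ineq)
  also have "\<dots> \<le> norm x * norm x ^ k"
    by (intro mult_left_mono Suc) auto
  finally show ?case by simp
qed (simp add: norm_one_le)

definition sqrt_series :: "'a::unital_cstar_algebra \<Rightarrow> 'a" where
  "sqrt_series x = (\<Sum>k. sqrt_coeff k *\<^sub>R x ^ k)"

lemma norm_sqrt_series_term_le:
  assumes "norm (x::'a::unital_cstar_algebra) \<le> 1"
  shows "norm (sqrt_coeff k *\<^sub>R x ^ k) \<le> \<bar>sqrt_coeff k\<bar>"
proof -
  have "norm (x ^ k) \<le> 1"
    using norm_power_le[of x k] power_le_one[OF norm_ge_zero assms, of k] by linarith
  then show ?thesis
    by (simp add: mult_left_le)
qed

lemma summable_norm_sqrt_series:
  assumes "norm (x::'a::unital_cstar_algebra) \<le> 1"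
  shows "summable (\<lambda>k. norm (sqrt_coeff k *\<^sub>R x ^ k))"
proof -
  have "summable (\<lambda>k. \<bar>sqrt_coeff k\<bar>)"
    using summable_abs_sqrt_coeff_Suc summable_Suc_iff by blast
  then show ?thesis
    by (rule summable_comparison_test'[where N = 0])
      (use norm_sqrt_series_term_le[OF assms] in auto)
qed

lemma summable_sqrt_series:
  "norm (x::'a::unital_cstar_algebra) \<le> 1 \<Longrightarrow> summable (\<lambda>k. sqrt_coeff k *\<^sub>R x ^ k)"
  by (rule summable_norm_cancel[OF summable_norm_sqrt_series])

lemma sqrt_series_squared:
  assumes "norm (x::'a::unital_cstar_algebra) \<le> 1"
  shows "sqrt_series x * sqrt_series x = 1 - x"
proof -
  have "sqrt_series x * sqrt_series x
      = (\<Sum>k. \<Sum>i\<le>k. (sqrt_coeff i *\<^sub>R x ^ i) * (sqrt_coeff (k - i) *\<^sub>R x ^ (k - i)))"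
    unfolding sqrt_series_def by (rule Cauchy_product) (rule summable_norm_sqrt_series[OF assms])+
  also have "(\<lambda>k. \<Sum>i\<le>k. (sqrt_coeff i *\<^sub>R x ^ i) * (sqrt_coeff (k - i) *\<^sub>R x ^ (k - i)))
      = (\<lambda>k. (\<Sum>i\<le>k. sqrt_coeff i * sqrt_coeff (k - i)) *\<^sub>R x ^ k)"
    unfolding scaleR_sum_left
    by (intro ext sum.cong) (auto simp: power_add[symmetric] mult.commute)
  also have "\<dots> = (\<lambda>k. if k = 0 then 1 else if k = 1 then - x else 0)"
    unfolding sum_sqrt_coeff_convolution by auto
  also have "(\<Sum>k. if k = 0 then 1 else if k = 1 then - x else 0)
      = (\<Sum>k\<in>{0, 1::nat}. if k = 0 then 1 else if k = 1 then - x else 0)"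
    by (rule suminf_finite) auto
  finally show ?thesis by simp
qed

text \<open>
  The distance from the root to \<open>1\<close> is at most the mass of the higher coefficients. By the definition of
  positivity below this says that the root is itself positive.
\<close>

lemma norm_one_minus_sqrt_series_le:
  assumes "norm (x::'a::unital_cstar_algebra) \<le> 1"
  shows "norm (1 - sqrt_series x) \<le> 1"
proof -
  let ?f = "\<lambda>k. sqrt_coeff (Suc k) *\<^sub>R x ^ Suc k"
  have s: "summable (\<lambda>k. norm (?f k))"
    using summable_norm_sqrt_series[OF assms]
      summable_Suc_iff[of "\<lambda>k. norm (sqrt_coeff k *\<^sub>R x ^ k)"] by simp
  have "sqrt_series x - 1 = suminf ?f"
    unfolding sqrt_series_def suminf_split_head[OF summable_sqrt_series[OF assms]] by simp
  then have "norm (1 - sqrt_series x) = norm (suminf ?f)"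
    by (metis norm_minus_commute)
  also have "\<dots> \<le> (\<Sum>k. norm (?f k))"
    by (rule summable_norm[OF s])
  also have "\<dots> \<le> (\<Sum>k. \<bar>sqrt_coeff (Suc k)\<bar>)"
    by (intro suminf_le norm_sqrt_series_term_le assms s summable_abs_sqrt_coeff_Suc)
  also note suminf_abs_sqrt_coeff_Suc_le
  finally show ?thesis .
qed

text \<open>
  Stated for two elements rather than one: with \<open>y = x\<close> it says that the root commutes with whatever
  commutes with \<open>x\<close>, and the general case carries a relation \<open>c\<^sup>* q\<^sup>2 = p\<^sup>2 c\<^sup>*\<close> over to the roots in the proof that \<open>b\<^sup>* b\<close> is
  positive.
\<close>

lemma sqrt_series_intertwine:
  assumes "norm (x::'a::unital_cstar_algebra) \<le> 1" "norm y \<le> 1" "z * x = y * z"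
  shows "z * sqrt_series x = sqrt_series y * z"
proof -
  have pow: "z * x ^ k = y ^ k * z" for k
  proof (induction k)
    case (Suc k)
    have "z * x ^ Suc k = y * (z * x ^ k)"
      by (simp add: assms(3) mult.assoc[symmetric])
    then show ?case
      by (simp add: Suc mult.assoc)
  qed simp
  have "z * sqrt_series x = (\<Sum>k. z * (sqrt_coeff k *\<^sub>R x ^ k))"
    unfolding sqrt_series_def
    by (rule bounded_linear.suminf[OF bounded_linear_mult_right summable_sqrt_series])
      (rule assms)
  also have "\<dots> = (\<Sum>k. (sqrt_coeff k *\<^sub>R y ^ k) * z)"
    by (simp add: pow)
  also have "\<dots> = sqrt_series y * z"
    unfolding sqrt_series_def
    by (rule bounded_linear.suminf[OF bounded_linear_mult_left summable_sqrt_series, symmetric])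
      (rule assms)
  finally show ?thesis .
qed

lemma star_sqrt_series:
  assumes "norm (x::'a::unital_cstar_algebra) \<le> 1" "star x = x"
  shows "star (sqrt_series x) = sqrt_series x"
proof -
  have "star (x ^ k) = x ^ k" for k
    by (induction k) (simp_all add: star_mult assms(2) power_commutes)
  then show ?thesis
    unfolding sqrt_series_def
    by (subst bounded_linear.suminf[OF bounded_linear_star summable_sqrt_series])
      (use assms in \<open>simp_all add: star_scaleR\<close>)
qed

lemma cstar_subalgebraD:
  assumes "cstar_subalgebra B"
  shows "1 \<in> B" "0 \<in> B" "closed B" "x \<in> B \<Longrightarrow> y \<in> B \<Longrightarrow> x + y \<in> B"
    "x \<in> B \<Longrightarrow> y \<in> B \<Longrightarrow> x * y \<in> B" "x \<in> B \<Longrightarrow> c *\<^sub>C x \<in> B" "x \<in> B \<Longrightarrow> star x \<in> B"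
    "x \<in> B \<Longrightarrow> r *\<^sub>R x \<in> B" "x \<in> B \<Longrightarrow> - x \<in> B" "x \<in> B \<Longrightarrow> y \<in> B \<Longrightarrow> x - y \<in> B"
proof -
  note B = assms[unfolded cstar_subalgebra_def]
  show "1 \<in> B" "closed B" "x \<in> B \<Longrightarrow> y \<in> B \<Longrightarrow> x + y \<in> B"
    "x \<in> B \<Longrightarrow> y \<in> B \<Longrightarrow> x * y \<in> B" "x \<in> B \<Longrightarrow> c *\<^sub>C x \<in> B" "x \<in> B \<Longrightarrow> star x \<in> B"
    using B by auto
  have sc: "r *\<^sub>R x \<in> B" if "x \<in> B" for r x
    using B that by (simp add: scaleR_scaleC)
  then show "x \<in> B \<Longrightarrow> r *\<^sub>R x \<in> B" .
  show "0 \<in> B"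
    using sc[of 1 0] B by simp
  have mi: "- x \<in> B" if "x \<in> B" for x
    using sc[of x "- 1"] that by simp
  then show "x \<in> B \<Longrightarrow> - x \<in> B" .
  show "x - y \<in> B" if "x \<in> B" "y \<in> B"
    using mi[of y] B that by (metis add_uminus_conv_diff)
qed

lemma cstar_subalgebra_UNIV: "cstar_subalgebra UNIV"
  by (simp add: cstar_subalgebra_def)

lemma sqrt_series_in_subalgebra:
  assumes "cstar_subalgebra B" "x \<in> B" "norm x \<le> 1"
  shows "sqrt_series x \<in> B"
proof -
  note B = cstar_subalgebraD[OF assms(1)]
  have pow: "x ^ k \<in> B" for k
    by (induction k) (simp_all add: B assms)
  have part: "(\<Sum>k<n. sqrt_coeff k *\<^sub>R x ^ k) \<in> B" for n
    by (induction n) (simp_all add: B pow)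
  show ?thesis
    unfolding sqrt_series_def
    by (rule closed_sequentially[OF B(3) part summable_LIMSEQ[OF summable_sqrt_series[OF assms(3)]]])
qed

section \<open>The positive cone of a unital C*-algebra\<close>

text \<open>
  For commuting self-adjoint elements, \<open>u = x + \<i> m\<close> satisfies \<open>u\<^sup>* u = x\<^sup>2 + m\<^sup>2\<close>, and \<open>x\<close> is the real part
  of \<open>u\<close>. Both directions of the comparison between norm and order (\<open>norm_minus_square_le\<close> and
  \<open>norm_le_of_positive_bounds\<close>) apply it to elements whose squares add up to a scalar.
\<close>

lemma norm_le_of_sum_squares:
  fixes x m :: "'a::unital_cstar_algebra"
  assumes "star x = x" "star m = m" "x * m = m * x"
  shows "(norm x)\<^sup>2 \<le> norm (x * x + m * m)"
proof -
  define u where "u = x + \<i> *\<^sub>C m"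
  have su: "star u = x + cnj \<i> *\<^sub>C m"
    by (simp add: u_def star_add star_scaleC assms)
  have ii: "\<i> *\<^sub>C cnj \<i> *\<^sub>C y = y" for y :: 'a
    using scaleR_scaleC[of 1, symmetric] by (simp_all add: scaleC_scaleC)
  have cancel: "\<i> *\<^sub>C y + cnj \<i> *\<^sub>C y = 0" for y :: 'a
    using scaleC_add_left[of \<i> "cnj \<i>" y] scaleR_scaleC[of 0 y] by simp
  have "star u * u = x * x + (\<i> *\<^sub>C (x * m) + cnj \<i> *\<^sub>C (m * x)) + \<i> *\<^sub>C cnj \<i> *\<^sub>C (m * m)"
    unfolding su by (simp add: u_def algebra_simps mult_scaleC_left mult_scaleC_right scaleC_add_right)
  also have "\<dots> = x * x + m * m"
    by (simp only: assms(3) cancel ii) simp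
  finally have nu: "(norm u)\<^sup>2 = norm (x * x + m * m)"
    by (simp flip: cstar_identity)
  have "u + star u = (x + x) + (\<i> *\<^sub>C m + cnj \<i> *\<^sub>C m)"
    unfolding su by (simp add: u_def)
  then have "2 *\<^sub>R x = u + star u"
    by (simp only: cancel scaleR_2 add_0_right)
  then have "2 * norm x = norm (u + star u)"
    by (metis abs_numeral norm_scaleR)
  also have "\<dots> \<le> norm u + norm u"
    using norm_triangle_ineq[of u "star u"] by simp
  finally have "norm x \<le> norm u"
    by simp
  then have "(norm x)\<^sup>2 \<le> (norm u)\<^sup>2"
    by (intro power_mono) auto
  then show ?thesis
    by (simp add: nu)
qed

text \<open>
  Positivity expressed through the norm alone, so that closure under sums is immediate.
  The lemmas of this section identify these elements with the squares of self-adjoint elements and with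
  the elements \<open>b\<^sup>* b\<close>.
\<close>

definition positive :: "'a::unital_cstar_algebra \<Rightarrow> bool" where
  "positive y \<longleftrightarrow> star y = y \<and> (\<exists>s>0. norm (s *\<^sub>R 1 - y) \<le> s)"

lemma positiveI: "star y = y \<Longrightarrow> 0 < s \<Longrightarrow> norm (s *\<^sub>R 1 - y) \<le> s \<Longrightarrow> positive y"
  by (auto simp: positive_def)

lemma positive_star: "positive y \<Longrightarrow> star y = y"
  by (simp add: positive_def)

text \<open>
  The square root of \<open>y\<close>, computed from the series at \<open>1 - y / s\<close>. The parameter \<open>s\<close> is kept explicit
  because intertwining relates the roots of two elements when both series use the same \<open>s\<close>.
\<close>

definition root_at :: "real \<Rightarrow> 'a::unital_cstar_algebra \<Rightarrow> 'a" where
  "root_at s y = sqrt s *\<^sub>R sqrt_series (1 - (1 / s) *\<^sub>R y)"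

lemma norm_one_minus_scaled_le:
  assumes "0 < s" "norm (s *\<^sub>R 1 - y) \<le> s"
  shows "norm (1 - (1 / s) *\<^sub>R (y::'a::unital_cstar_algebra)) \<le> 1"
proof -
  have "1 - (1 / s) *\<^sub>R y = (1 / s) *\<^sub>R (s *\<^sub>R 1 - y)"
    using assms(1) by (simp add: scaleR_right_diff_distrib)
  then have "norm (1 - (1 / s) *\<^sub>R y) = (1 / s) * norm (s *\<^sub>R 1 - y)"
    using assms(1) by simp
  also have "\<dots> \<le> 1"
    using assms by (simp add: divide_le_eq)
  finally show ?thesis .
qed

context
  fixes s :: real and y :: "'a::unital_cstar_algebra"
  assumes s: "0 < s" "norm (s *\<^sub>R 1 - y) \<le> s"
begin

lemma root_at_squared: "root_at s y * root_at s y = y"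
proof -
  have "root_at s y * root_at s y = s *\<^sub>R (1 - (1 - (1 / s) *\<^sub>R y))"
    using s(1)
    by (simp add: root_at_def sqrt_series_squared[OF norm_one_minus_scaled_le[OF s]])
  then show ?thesis
    using s(1) by simp
qed

lemma root_at_intertwine:
  assumes "norm (s *\<^sub>R 1 - y') \<le> s" "z * y = y' * z"
  shows "z * root_at s y = root_at s y' * z"
proof -
  have "z * (1 - (1 / s) *\<^sub>R y) = (1 - (1 / s) *\<^sub>R y') * z"
    by (simp add: algebra_simps assms(2))
  then show ?thesis
    unfolding root_at_def
    using sqrt_series_intertwine[OF norm_one_minus_scaled_le[OF s] norm_one_minus_scaled_le[OF s(1) assms(1)]]
    by simp
qed

lemma root_at_commute: "z * y = y * z \<Longrightarrow> z * root_at s y = root_at s y * z"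
  using root_at_intertwine[OF s(2)] by blast

lemma root_at_in_subalgebra: "cstar_subalgebra B \<Longrightarrow> y \<in> B \<Longrightarrow> root_at s y \<in> B"
  unfolding root_at_def
  by (intro cstar_subalgebraD sqrt_series_in_subalgebra norm_one_minus_scaled_le[OF s])

lemma star_root_at: "star y = y \<Longrightarrow> star (root_at s y) = root_at s y"
  unfolding root_at_def star_scaleR
  by (subst star_sqrt_series[OF norm_one_minus_scaled_le[OF s]]) (simp_all add: star_diff star_scaleR)

lemma positive_root_at:
  assumes "star y = y"
  shows "positive (root_at s y)"
proof (rule positiveI)
  show "star (root_at s y) = root_at s y"
    by (rule star_root_at[OF assms])
  show "0 < sqrt s"
    using s(1) by simp
  have "sqrt s *\<^sub>R 1 - root_at s y = sqrt s *\<^sub>R (1 - sqrt_series (1 - (1 / s) *\<^sub>R y))"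
    by (simp add: root_at_def scaleR_right_diff_distrib)
  then show "norm (sqrt s *\<^sub>R 1 - root_at s y) \<le> sqrt s"
    using norm_one_minus_sqrt_series_le[OF norm_one_minus_scaled_le[OF s]] s(1)
    by (simp add: mult_left_le)
qed

end

text \<open>
  After scaling, \<open>b\<close> is the cosine of an angle whose sine is the series root of \<open>1 - b\<^sup>2\<close>; that root has norm at
  most \<open>1\<close>, and so has its square \<open>1 - b\<^sup>2\<close>.
\<close>

lemma norm_minus_square_le:
  fixes b :: "'a::unital_cstar_algebra"
  assumes b: "star b = b" and s: "0 < s" "(norm b)\<^sup>2 \<le> s"
  shows "norm (s *\<^sub>R 1 - b * b) \<le> s"
proof -
  define x where "x = (1 / s) *\<^sub>R (b * b)"
  have x: "norm x \<le> 1" "star x = x"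
    using s b norm_square_self_adjoint[OF b] by (simp_all add: x_def star_scaleR star_mult)
  let ?c = "sqrt_series x" and ?b = "(1 / sqrt s) *\<^sub>R b"
  have sc: "star ?c = ?c"
    by (rule star_sqrt_series[OF x])
  have "?b * x = x * ?b"
    by (simp add: x_def mult.assoc)
  then have comm: "?c * ?b = ?b * ?c"
    using sqrt_series_intertwine[OF x(1) x(1)] by metis
  have "?b * ?b = x"
    using s(1) by (simp add: x_def)
  moreover have "?c * ?c = 1 - x"
    by (rule sqrt_series_squared[OF x(1)])
  ultimately have "(norm ?c)\<^sup>2 \<le> norm (1 :: 'a)"
    using norm_le_of_sum_squares[OF sc _ comm] by (simp add: star_scaleR b)
  then have "norm (1 - x) \<le> 1"
    using norm_square_self_adjoint[OF sc] \<open>?c * ?c = 1 - x\<close> norm_one_le[where 'a = 'a] by simp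
  moreover have "s *\<^sub>R 1 - b * b = s *\<^sub>R (1 - x)"
    using s(1) by (simp add: x_def scaleR_right_diff_distrib)
  ultimately show ?thesis
    using s(1) by (simp add: mult_left_le)
qed

lemma positive_square: "star b = b \<Longrightarrow> positive (b * b)"
  by (rule positiveI[where s = "(norm b)\<^sup>2 + 1"])
    (auto intro!: norm_minus_square_le simp: star_mult add_nonneg_pos)

text \<open>
  The witness \<open>s\<close> in the definition of positivity may be any bound of the norm. This uniformity is what makes
  the cone closed.
\<close>

lemma positive_norm_minus_le:
  assumes "positive y" "0 < s" "norm y \<le> s"
  shows "norm (s *\<^sub>R 1 - y) \<le> s"
proof -
  obtain t where t: "star y = y" "0 < t" "norm (t *\<^sub>R 1 - y) \<le> t"
    using assms(1) by (auto simp: positive_def)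
  let ?b = "root_at t y"
  have b: "star ?b = ?b" "?b * ?b = y"
    using star_root_at[OF t(2,3,1)] root_at_squared[OF t(2,3)] by auto
  then have "(norm ?b)\<^sup>2 = norm y"
    using norm_square_self_adjoint by metis
  then show ?thesis
    using norm_minus_square_le[OF b(1) assms(2)] b(2) assms(3) by simp
qed

lemma positive_add:
  assumes "positive x" "positive y"
  shows "positive (x + y)"
proof -
  obtain s t where st: "0 < s" "norm (s *\<^sub>R 1 - x) \<le> s" "0 < t" "norm (t *\<^sub>R 1 - y) \<le> t"
    using assms by (auto simp: positive_def)
  have "(s + t) *\<^sub>R 1 - (x + y) = (s *\<^sub>R 1 - x) + (t *\<^sub>R 1 - y)"
    by (simp add: algebra_simps)
  then have "norm ((s + t) *\<^sub>R 1 - (x + y)) \<le> norm (s *\<^sub>R 1 - x) + norm (t *\<^sub>R 1 - y)"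
    by (metis norm_triangle_ineq)
  with st have "norm ((s + t) *\<^sub>R 1 - (x + y)) \<le> s + t" "0 < s + t"
    by linarith+
  then show ?thesis
    using assms by (intro positiveI[of _ "s + t"]) (simp_all add: star_add positive_star)
qed

lemma positive_0: "positive 0"
  using positive_square[of 0] by simp

lemma positive_1: "positive 1"
  using positive_square[of 1] by simp

lemma positive_scaleR:
  assumes "positive x" "0 \<le> c"
  shows "positive (c *\<^sub>R x)"
proof (cases "c = 0")
  case False
  obtain s where s: "0 < s" "norm (s *\<^sub>R 1 - x) \<le> s"
    using assms by (auto simp: positive_def)
  have "(c * s) *\<^sub>R 1 - c *\<^sub>R x = c *\<^sub>R (s *\<^sub>R 1 - x)"
    by (simp add: algebra_simps)
  then show ?thesis
    using assms False s
    by (intro positiveI[of _ "c * s"]) (auto simp: star_scaleR positive_star)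
qed (simp add: positive_0)

lemma positive_scaleR_one: "0 \<le> t \<Longrightarrow> positive (t *\<^sub>R 1)"
  by (intro positive_scaleR positive_1)

lemma positive_lim:
  assumes f: "f \<longlonglongrightarrow> y" and pos: "\<And>n. positive (f n)"
  shows "positive y"
proof (rule positiveI)
  let ?s = "norm y + 1"
  show "0 < ?s"
    by (simp add: add_nonneg_pos)
  have "(\<lambda>n. star (f n)) \<longlonglongrightarrow> star y"
    by (rule bounded_linear.tendsto[OF bounded_linear_star f])
  then show "star y = y"
    using f pos by (simp add: positive_star LIMSEQ_unique)
  have "\<forall>\<^sub>F n in sequentially. norm (f n) < ?s"
    by (rule order_tendstoD(2)[OF tendsto_norm[OF f]]) simp
  then have "\<forall>\<^sub>F n in sequentially. norm (?s *\<^sub>R 1 - f n) \<le> ?s"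
    by eventually_elim (auto intro!: positive_norm_minus_le pos add_nonneg_pos)
  then show "norm (?s *\<^sub>R 1 - y) \<le> ?s"
    by (rule tendsto_upperbound[rotated]) (auto intro!: tendsto_intros f)
qed

lemma positive_norm_minus_self:
  assumes "star x = x" "norm x \<le> t"
  shows "positive (t *\<^sub>R 1 - x)"
proof (cases "0 < t")
  case True
  then show ?thesis
    using assms by (intro positiveI[of _ t]) (auto simp: star_diff star_scaleR)
next
  case False
  then have "t = 0" and "norm x = 0"
    using assms(2) norm_ge_zero[of x] by linarith+
  then have "t = 0" "x = 0"
    by auto
  then show ?thesis
    by (simp add: positive_0)
qed

text \<open>
  The roots \<open>h\<close> and \<open>k\<close> of \<open>t + x\<close> and \<open>t - x\<close> are power series in \<open>x\<close>, hence commute, and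
  \<open>x\<^sup>2 + (h k)\<^sup>2 = t\<^sup>2\<close>.
\<close>

lemma norm_le_of_positive_bounds:
  assumes t: "0 \<le> t" and lo: "positive (t *\<^sub>R 1 + x)" and up: "positive (t *\<^sub>R 1 - x)"
  shows "norm x \<le> t"
proof -
  obtain r where r: "0 < r" "norm (r *\<^sub>R 1 - (t *\<^sub>R 1 + x)) \<le> r"
    using lo by (auto simp: positive_def)
  obtain s where s: "0 < s" "norm (s *\<^sub>R 1 - (t *\<^sub>R 1 - x)) \<le> s"
    using up by (auto simp: positive_def)
  define h where "h = root_at r (t *\<^sub>R 1 + x)"
  define k where "k = root_at s (t *\<^sub>R 1 - x)"
  have "star (t *\<^sub>R 1 + x) = t *\<^sub>R 1 + x"
    by (rule positive_star[OF lo])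
  then have x: "star x = x"
    by (simp add: star_add star_scaleR)
  have hh: "h * h = t *\<^sub>R 1 + x" and kk: "k * k = t *\<^sub>R 1 - x"
    unfolding h_def k_def by (rule root_at_squared[OF r] root_at_squared[OF s])+
  have sh: "star h = h" and sk: "star k = k"
    unfolding h_def k_def
    by (rule star_root_at[OF r positive_star[OF lo]] star_root_at[OF s positive_star[OF up]])+
  have xh: "x * h = h * x"
    unfolding h_def by (rule root_at_commute[OF r]) (simp add: algebra_simps)
  have xk: "x * k = k * x"
    unfolding k_def by (rule root_at_commute[OF s]) (simp add: algebra_simps)
  have hk: "h * k = k * h"
    unfolding k_def by (rule root_at_commute[OF s]) (simp add: algebra_simps xh)
  define m where "m = h * k"
  have "star m = m"
    by (simp add: m_def star_mult sh sk hk)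
  moreover have "x * m = m * x"
    by (simp add: m_def mult.assoc xk[symmetric]) (simp add: mult.assoc[symmetric] xh)
  moreover have "x * x + m * m = (t\<^sup>2) *\<^sub>R 1"
  proof -
    have "m * m = (h * h) * (k * k)"
      unfolding m_def by (metis hk mult.assoc)
    then show ?thesis
      by (simp add: hh kk algebra_simps power2_eq_square)
  qed
  ultimately have "(norm x)\<^sup>2 \<le> norm ((t\<^sup>2) *\<^sub>R (1 :: 'a))"
    using norm_le_of_sum_squares[OF x] by metis
  also have "\<dots> \<le> t\<^sup>2"
    by (rule norm_scaleR_one_le) simp
  finally show ?thesis
    using t by (rule power2_le_imp_le)
qed

lemma positive_antisym:
  assumes "positive x" "positive (- x)"
  shows "x = 0"
  using norm_le_of_positive_bounds[of 0 x] assms by simp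

lemma positive_conjugate:
  assumes "positive q" "star d = d" "d * q = q * d"
  shows "positive (d * q * d)"
proof -
  obtain s where s: "0 < s" "norm (s *\<^sub>R 1 - q) \<le> s"
    using assms(1) by (auto simp: positive_def)
  define g where "g = root_at s q"
  have g: "g * g = q" "star g = g" "d * g = g * d"
    unfolding g_def
    using root_at_squared[OF s] star_root_at[OF s] root_at_commute[OF s assms(3)] assms(1)
    by (auto simp: positive_star)
  have "d * q * d = (g * d) * (g * d)"
    by (metis g(1,3) mult.assoc)
  moreover have "star (g * d) = g * d"
    by (simp add: star_mult g assms)
  ultimately show ?thesis
    using positive_square by metis
qed

text \<open>
  With \<open>d = q - r\<close> the two positive elements \<open>d q d\<close> and \<open>d r d\<close> add up to \<open>d (q\<^sup>2 - r\<^sup>2) = 0\<close>, so both vanish,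
  and their difference is \<open>d\<^sup>3\<close>.
\<close>

lemma positive_square_unique:
  assumes q: "positive q" and r: "positive r" and sq: "q * q = r * r" and comm: "q * r = r * q"
  shows "q = r"
proof -
  define d where "d = q - r"
  have d: "star d = d" "d * q = q * d" "d * r = r * d"
    using q r comm by (auto simp: d_def star_diff positive_star algebra_simps)
  have "d * (q + r) = 0"
    by (simp add: d_def algebra_simps sq comm)
  then have sum0: "d * q * d + d * r * d = 0"
    by (metis distrib_left distrib_right mult_zero_left)
  have pq: "positive (d * q * d)" and pr: "positive (d * r * d)"
    by (rule positive_conjugate[OF q d(1,2)] positive_conjugate[OF r d(1,3)])+
  have "- (d * q * d) = d * r * d"
    using sum0 by (simp add: eq_neg_iff_add_eq_0 minus_equation_iff add.commute neg_eq_iff_add_eq_0)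
  then have "d * q * d = 0"
    using positive_antisym[OF pq] pr by simp
  with sum0 have "d * (q - r) * d = 0"
    by (simp add: algebra_simps)
  then have "d * d * d = 0"
    by (simp add: d_def)
  then have "(d * d) * (d * d) = 0"
    by (metis mult.assoc mult_zero_left)
  then have "d * d = 0"
    by (rule square_eq_0_self_adjoint[rotated]) (simp add: star_mult d)
  then show ?thesis
    using square_eq_0_self_adjoint[OF d(1)] by (simp add: d_def)
qed


text \<open>
  The theorem of Fukamiya and Kaplansky. Let \<open>y = b\<^sup>* b\<close>, let \<open>w\<close> be its absolute value and let \<open>v = w - y\<close> be twice its
  negative part. For \<open>c = b v\<close> one finds \<open>c\<^sup>* c = - p\<close> with \<open>p\<close> positive, whence \<open>q = c c\<^sup>*\<close> is positive, being \<open>p\<close>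
  plus squares. Since \<open>c\<^sup>* q = - p c\<^sup>*\<close>, the squares satisfy \<open>c\<^sup>* q\<^sup>2 = p\<^sup>2 c\<^sup>*\<close>, and taking roots of
  \<open>q\<^sup>2\<close> and \<open>p\<^sup>2\<close> gives \<open>c\<^sup>* q = p c\<^sup>*\<close>. Hence \<open>p c\<^sup>* = 0\<close>, then \<open>p = 0\<close>, \<open>c = 0\<close> and \<open>v = 0\<close>.
\<close>

lemma positive_star_mult_self: "positive (star b * (b::'a::unital_cstar_algebra))"
proof -
  define y where "y = star b * b"
  have y: "star y = y"
    by (simp add: y_def star_mult star_star)
  define s where "s = (norm y)\<^sup>2 + 1"
  have s: "0 < s" "norm (s *\<^sub>R 1 - y * y) \<le> s"
    unfolding s_def by (auto intro!: norm_minus_square_le y add_nonneg_pos)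
  define w where "w = root_at s (y * y)"
  have w: "w * w = y * y" "star w = w" "positive w" "y * w = w * y"
    unfolding w_def
    using root_at_squared[OF s] star_root_at[OF s] positive_root_at[OF s] root_at_commute[OF s, of y]
    by (auto simp: y star_mult mult.assoc)
  define v where "v = w - y"
  have v: "star v = v" "v * w = w * v" "v * y = y * v"
    by (auto simp: v_def star_diff w y algebra_simps)
  have vyv: "v * y * v = - (v * w * v)"
  proof -
    have "v * (y + w) = 0"
      by (simp add: v_def algebra_simps w)
    then have "v * y * v + v * w * v = 0"
      by (metis distrib_left distrib_right mult_zero_left)
    then show ?thesis
      by (simp add: eq_neg_iff_add_eq_0)
  qed
  define p where "p = v * w * v"
  have p: "positive p"
    unfolding p_def by (rule positive_conjugate[OF w(3) v(1,2)])
  define c where "c = b * v"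
  have cc: "star c * c = - p"
    unfolding p_def vyv[symmetric] by (simp add: c_def star_mult v y_def mult.assoc)
  define q where "q = c * star c"
  have q: "positive q"
  proof -
    define h where "h = (1/2) *\<^sub>R (c + star c)"
    define k where "k = \<i> *\<^sub>C ((1/2) *\<^sub>R (star c - c))"
    have h: "star h = h"
      by (simp add: h_def star_scaleR star_add star_star add.commute)
    have neg: "(- d) *\<^sub>C z = - (d *\<^sub>C z)" for d and z :: 'a
      using scaleC_add_left[of d "- d" z] scaleR_scaleC[of 0 z] by (simp add: eq_neg_iff_add_eq_0 add.commute)
    have negR: "d *\<^sub>C (- z) = - (d *\<^sub>C z)" for d and z :: 'a
    proof -
      have "d *\<^sub>C (0 :: 'a) = 0"
        using scaleC_add_right[of d "0 :: 'a" 0] by simp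
      then show ?thesis
        using scaleC_add_right[of d "- z" z] by (simp add: eq_neg_iff_add_eq_0)
    qed
    have k: "star k = k"
    proof -
      have "star k = - (\<i> *\<^sub>C ((1/2) *\<^sub>R (c - star c)))"
        by (simp add: k_def star_scaleR star_scaleC star_diff star_star neg)
      also have "\<dots> = k"
        unfolding k_def negR[symmetric] by (simp add: scaleR_right_diff_distrib)
      finally show ?thesis .
    qed
    have ii: "\<i> *\<^sub>C \<i> *\<^sub>C z = - z" for z :: 'a
      using scaleR_scaleC[of "- 1" z] by (simp add: scaleC_scaleC)
    \<comment> \<open>With \<open>h\<close> and \<open>k\<close> the real and imaginary parts of \<open>c\<close>: \<open>c\<^sup>* c + c c\<^sup>* = 2 (h\<^sup>2 + k\<^sup>2)\<close>.\<close>
    have "h * h = (1/4) *\<^sub>R ((c + star c) * (c + star c))"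
      by (simp add: h_def)
    moreover have "k * k = - (((1/2) *\<^sub>R (star c - c)) * ((1/2) *\<^sub>R (star c - c)))"
      unfolding k_def mult_scaleC_left mult_scaleC_right ii ..
    ultimately have "h * h + k * k = (1/4) *\<^sub>R (2 *\<^sub>R (star c * c + q))"
      by (simp add: q_def algebra_simps scaleR_2)
    then have "2 *\<^sub>R (h * h + k * k) = star c * c + q"
      by simp
    then have "q = 2 *\<^sub>R (h * h + k * k) + p"
      by (simp add: cc)
    then show ?thesis
      using h k p by (auto intro!: positive_add positive_scaleR positive_square)
  qed
  have q1: "star c * q = - p * star c"
    by (simp add: q_def cc flip: mult.assoc)
  then have q2: "star c * (q * q) = (p * p) * star c"
    by (metis minus_mult_minus mult.assoc)
  define t where "t = (norm q)\<^sup>2 + (norm p)\<^sup>2 + 1"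
  have sq: "star q = q" "star p = p"
    using p q by (auto simp: positive_star)
  have t: "0 < t" "norm (t *\<^sub>R 1 - q * q) \<le> t" "norm (t *\<^sub>R 1 - p * p) \<le> t"
    unfolding t_def by (auto intro!: norm_minus_square_le sq add_nonneg_pos)
  \<comment> \<open>A common parameter \<open>t\<close>, so that both roots come from the same power series.\<close>
  have root: "root_at t (z * z) = z" if "positive z" "norm (t *\<^sub>R 1 - z * z) \<le> t" for z
  proof -
    note T = t(1) that(2)
    have "star (z * z) = z * z"
      using that(1) by (simp add: star_mult positive_star)
    moreover have "root_at t (z * z) * z = z * root_at t (z * z)"
      by (rule root_at_commute[OF T, symmetric]) (simp add: mult.assoc)
    ultimately show ?thesis
      using positive_square_unique[OF positive_root_at[OF T] that(1)] root_at_squared[OF T] by metis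
  qed
  have "star c * q = p * star c"
    using root_at_intertwine[OF t(1,2,3) q2] root p q t by metis
  with q1 have "p * star c = - (p * star c)"
    by simp
  then have "2 *\<^sub>R (p * star c) = 0"
    unfolding scaleR_2 by (simp add: eq_neg_iff_add_eq_0)
  then have "p * star c = 0"
    by simp
  then have "p * (star c * c) = 0"
    by (simp flip: mult.assoc)
  then have "p * p = 0"
    by (simp add: cc)
  then have "p = 0"
    by (rule square_eq_0_self_adjoint[OF sq(2)])
  then have "c = 0"
    using cc cstar_identity[of c] by simp
  then have yv: "y * v = 0"
    by (simp add: y_def c_def mult.assoc)
  have "w * v = 0"
  proof -
    have "v * (y + w) = 0"
      by (simp add: v_def algebra_simps w)
    then show ?thesis
      using yv v by (simp add: distrib_left)
  qed
  then have "v * v = 0"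
    using yv by (simp add: v_def left_diff_distrib)
  then have "v = 0"
    by (rule square_eq_0_self_adjoint[OF v(1)])
  then show ?thesis
    using w(3) by (simp add: v_def y_def)
qed

section \<open>Self-adjoint parts as order unit spaces\<close>

lemma sa_ous_simps [simp]:
  "carrier (sa_ous B) = sa B" "add (sa_ous B) = (+)" "zero (sa_ous B) = 0"
  "scale (sa_ous B) = (*\<^sub>R)" "unit (sa_ous B) = 1"
  by (simp_all add: sa_ous_def)

lemma positive_has_root_in_subalgebra:
  assumes "cstar_subalgebra B" "positive y" "y \<in> B"
  shows "\<exists>h\<in>B. star h = h \<and> h * h = y"
proof -
  obtain s where s: "0 < s" "norm (s *\<^sub>R 1 - y) \<le> s"
    using assms(2) by (auto simp: positive_def)
  then show ?thesis
    using root_at_in_subalgebra[OF s assms(1,3)] root_at_squared[OF s]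
      star_root_at[OF s positive_star[OF assms(2)]] by blast
qed

text \<open>
  Roots are limits of polynomials and stay in the closed subalgebra, so the order of \<open>B\<close> is the restriction of the
  order of the whole algebra.
\<close>

lemma le_sa_ous_iff:
  assumes "cstar_subalgebra B" "x \<in> B" "y \<in> B"
  shows "le (sa_ous B) x y \<longleftrightarrow> positive (y - x)"
proof
  assume "le (sa_ous B) x y"
  then show "positive (y - x)"
    by (auto simp: sa_ous_def positive_star_mult_self)
next
  assume "positive (y - x)"
  then obtain h where "h \<in> B" "star h = h" "h * h = y - x"
    using positive_has_root_in_subalgebra assms cstar_subalgebraD(10) by metis
  then show "le (sa_ous B) x y"
    by (auto simp: sa_ous_def intro!: bexI[of _ h])
qed

lemma saD: "x \<in> sa B \<Longrightarrow> x \<in> B" "x \<in> sa B \<Longrightarrow> star x = x"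
  by (auto simp: sa_def)

lemma sa_closed:
  assumes "cstar_subalgebra B"
  shows "0 \<in> sa B" "1 \<in> sa B" "x \<in> sa B \<Longrightarrow> y \<in> sa B \<Longrightarrow> x + y \<in> sa B"
    "x \<in> sa B \<Longrightarrow> r *\<^sub>R x \<in> sa B" "x \<in> sa B \<Longrightarrow> y \<in> sa B \<Longrightarrow> x - y \<in> sa B"
    "x \<in> sa B \<Longrightarrow> - x \<in> sa B"
  using cstar_subalgebraD[OF assms]
  by (auto simp: sa_def star_add star_diff star_scaleR star_minus)

lemma closed_sa:
  assumes "cstar_subalgebra B"
  shows "closed (sa B)"
proof -
  have "sa B = B \<inter> {x. star x = x}"
    by (auto simp: sa_def)
  moreover have "closed {x::'a. star x = x}"
    by (intro closed_Collect_eq continuous_on_id linear_continuous_on bounded_linear_star)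
  ultimately show ?thesis
    using cstar_subalgebraD(3)[OF assms] by (auto intro: closed_Int)
qed

lemma order_unit_bounds_sa_iff:
  assumes B: "cstar_subalgebra B" "x \<in> sa B" and t: "0 \<le> t"
  shows "le (sa_ous B) (scale (sa_ous B) (- t) (unit (sa_ous B))) x \<and>
      le (sa_ous B) x (scale (sa_ous B) t (unit (sa_ous B))) \<longleftrightarrow> norm x \<le> t"
proof -
  have "le (sa_ous B) (scale (sa_ous B) (- t) (unit (sa_ous B))) x \<and>
      le (sa_ous B) x (scale (sa_ous B) t (unit (sa_ous B))) \<longleftrightarrow>
      positive (t *\<^sub>R 1 + x) \<and> positive (t *\<^sub>R 1 - x)"
    using cstar_subalgebraD[OF B(1)] saD[OF B(2)]
    by (simp add: le_sa_ous_iff[OF B(1)] add.commute)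
  also have "\<dots> \<longleftrightarrow> norm x \<le> t"
    using norm_le_of_positive_bounds[OF t] positive_norm_minus_self[of x t]
      positive_norm_minus_self[of "- x" t] saD[OF B(2)] by (auto simp: star_minus)
  finally show ?thesis .
qed

lemma order_unit_space_sa:
  assumes B: "cstar_subalgebra (B :: 'a::unital_cstar_algebra set)"
  shows "order_unit_space (sa_ous B)"
proof
  note le_iff = le_sa_ous_iff[OF B saD(1) saD(1)]
  show "\<And>x y z. x \<in> carrier (sa_ous B) \<Longrightarrow> y \<in> carrier (sa_ous B) \<Longrightarrow> z \<in> carrier (sa_ous B) \<Longrightarrow>
      le (sa_ous B) x y \<Longrightarrow> le (sa_ous B) y z \<Longrightarrow> le (sa_ous B) x z"
    using positive_add by (fastforce simp: le_iff)
  show "x = y" if "x \<in> carrier (sa_ous B)" "y \<in> carrier (sa_ous B)"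
    "le (sa_ous B) x y" "le (sa_ous B) y x" for x y
    using that positive_antisym[of "x - y"] by (simp add: le_iff)
  show "le (sa_ous B) (scale (sa_ous B) c x) (scale (sa_ous B) c y)"
    if "x \<in> carrier (sa_ous B)" "y \<in> carrier (sa_ous B)" "0 \<le> c" "le (sa_ous B) x y" for x y c
    using that positive_scaleR[of "y - x" c]
    by (simp add: le_iff sa_closed[OF B] scaleR_right_diff_distrib)
  show "\<exists>t>0. le (sa_ous B) (scale (sa_ous B) (- t) (unit (sa_ous B))) x \<and>
      le (sa_ous B) x (scale (sa_ous B) t (unit (sa_ous B)))" if "x \<in> carrier (sa_ous B)" for x
    using that
    by (intro exI[of _ "norm x + 1"], subst order_unit_bounds_sa_iff[OF B])
      (simp_all add: add_nonneg_pos)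
  show "le (sa_ous B) x (zero (sa_ous B))" if x: "x \<in> carrier (sa_ous B)"
    and le: "\<And>t. 0 < t \<Longrightarrow> le (sa_ous B) x (scale (sa_ous B) t (unit (sa_ous B)))" for x
  proof -
    have "positive ((1 / real (Suc n)) *\<^sub>R 1 - x)" for n
      using le[of "1 / real (Suc n)"] x by (simp add: le_iff sa_closed[OF B])
    moreover have "(\<lambda>n. (1 / real (Suc n)) *\<^sub>R 1 - x) \<longlonglongrightarrow> 0 *\<^sub>R 1 - x"
      by (intro tendsto_intros LIMSEQ_Suc[OF lim_1_over_n])
    ultimately have "positive (0 *\<^sub>R 1 - x)"
      by (rule positive_lim[rotated])
    then show ?thesis
      using x by (simp add: le_iff sa_closed[OF B])
  qed
qed (use sa_closed[OF B] in \<open>auto simp: le_sa_ous_iff[OF B saD(1) saD(1)] algebra_simps positive_0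
    intro: exI[of _ "- x" for x] intro!: bexI[of _ "- x" for x]\<close>)

lemma Inf_pos_ge:
  fixes r :: real
  assumes "0 \<le> r"
  shows "Inf {t. 0 < t \<and> r \<le> t} = r"
proof (rule cInf_eq_non_empty)
  show "{t. 0 < t \<and> r \<le> t} \<noteq> {}"
  proof -
    have "r + 1 \<in> {t. 0 < t \<and> r \<le> t}"
      using assms by simp
    then show ?thesis
      by blast
  qed
  show "y \<le> r" if lb: "\<And>t. t \<in> {t. 0 < t \<and> r \<le> t} \<Longrightarrow> y \<le> t" for y
  proof (rule field_le_epsilon)
    fix e :: real assume "0 < e"
    with assms show "y \<le> r + e"
      by (intro lb) simp
  qed
qed simp

lemma ous_norm_sa:
  assumes B: "cstar_subalgebra B" "x \<in> sa B"
  shows "ous_norm (sa_ous B) x = norm x"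
proof -
  have "ous_norm (sa_ous B) x = Inf {t. 0 < t \<and> norm x \<le> t}"
    unfolding ous_norm_def
    by (rule arg_cong[where f = Inf], rule Collect_cong, rule conj_cong[OF refl])
      (rule order_unit_bounds_sa_iff[OF B less_imp_le])
  also have "\<dots> = norm x"
    by (rule Inf_pos_ge) simp
  finally show ?thesis .
qed

section \<open>The Hahn-Banach theorem\<close>

definition sublinear :: "('v::real_vector \<Rightarrow> real) \<Rightarrow> bool" where
  "sublinear p \<longleftrightarrow> (\<forall>x y. p (x + y) \<le> p x + p y) \<and> (\<forall>c\<ge>0. \<forall>x. p (c *\<^sub>R x) = c * p x)"

lemma sublinearD:
  assumes "sublinear p"
  shows "p (x + y) \<le> p x + p y" "0 \<le> c \<Longrightarrow> p (c *\<^sub>R x) = c * p x" "p 0 = 0" "- p (- x) \<le> p x"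
proof -
  have *: "\<And>x y. p (x + y) \<le> p x + p y" "\<And>c x. 0 \<le> c \<Longrightarrow> p (c *\<^sub>R x) = c * p x"
    using assms by (auto simp: sublinear_def)
  show 0: "p 0 = 0"
    using *(2)[of 0 0] by simp
  show "p (x + y) \<le> p x + p y" "0 \<le> c \<Longrightarrow> p (c *\<^sub>R x) = c * p x"
    by (fact *)+
  show "- p (- x) \<le> p x"
    using *(1)[of x "- x"] 0 by simp
qed

lemma sublinearI:
  assumes add: "\<And>x y. p (x + y) \<le> p x + p y" and zero: "p 0 = 0"
    and scale: "\<And>c x. 0 < c \<Longrightarrow> p (c *\<^sub>R x) \<le> c * p x"
  shows "sublinear p"
  unfolding sublinear_def
proof (intro conjI allI impI add)
  fix c :: real and x
  assume c: "0 \<le> c"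
  show "p (c *\<^sub>R x) = c * p x"
  proof (cases "c = 0")
    case False
    with c have "0 < c" by simp
    then have "p ((1/c) *\<^sub>R (c *\<^sub>R x)) \<le> (1/c) * p (c *\<^sub>R x)"
      by (intro scale) simp
    with \<open>0 < c\<close> have "c * p x \<le> p (c *\<^sub>R x)"
      by (simp add: field_simps)
    with scale[OF \<open>0 < c\<close>, of x] show ?thesis
      by simp
  qed (simp add: zero)
qed

lemma sublinear_INF:
  fixes F :: "'i \<Rightarrow> 'v::real_vector \<Rightarrow> real"
  assumes ne: "I \<noteq> {}" and bdd: "\<And>x. bdd_below ((\<lambda>i. F i x) ` I)"
    and add: "\<And>i j x y. i \<in> I \<Longrightarrow> j \<in> I \<Longrightarrow> \<exists>k\<in>I. F k (x + y) \<le> F i x + F j y"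
    and zero: "(INF i\<in>I. F i 0) = 0"
    and scale: "\<And>c x i. 0 < c \<Longrightarrow> i \<in> I \<Longrightarrow> \<exists>k\<in>I. F k (c *\<^sub>R x) \<le> c * F i x"
  shows "sublinear (\<lambda>x. INF i\<in>I. F i x)"
proof (rule sublinearI)
  have lower: "(INF i\<in>I. F i x) \<le> F k x" if "k \<in> I" for k x
    by (rule cINF_lower[OF bdd that])
  fix x y :: 'v
  have "(INF i\<in>I. F i (x + y)) \<le> F j y + F i x" if "i \<in> I" "j \<in> I" for i j
    using add[OF that, of x y] lower order_trans by (metis add.commute)
  then have "(INF i\<in>I. F i (x + y)) - F i x \<le> (INF j\<in>I. F j y)" if "i \<in> I" for i
    using that by (intro cINF_greatest[OF ne]) (simp add: diff_le_eq)
  then have "(INF i\<in>I. F i (x + y)) - (INF j\<in>I. F j y) \<le> (INF i\<in>I. F i x)"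
    by (intro cINF_greatest[OF ne]) (simp add: algebra_simps)
  then show "(INF i\<in>I. F i (x + y)) \<le> (INF i\<in>I. F i x) + (INF i\<in>I. F i y)"
    by simp
next
  have lower: "(INF i\<in>I. F i x) \<le> F k x" if "k \<in> I" for k x
    by (rule cINF_lower[OF bdd that])
  fix c :: real and x :: 'v
  assume c: "0 < c"
  have "(INF i\<in>I. F i (c *\<^sub>R x)) \<le> c * F i x" if "i \<in> I" for i
    using scale[OF c that, of x] lower order_trans by blast
  then have "(INF i\<in>I. F i (c *\<^sub>R x)) / c \<le> (INF i\<in>I. F i x)"
    using c by (intro cINF_greatest[OF ne]) (simp add: field_simps)
  then show "(INF i\<in>I. F i (c *\<^sub>R x)) \<le> c * (INF i\<in>I. F i x)"
    using c by (simp add: field_simps)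
qed (fact zero)

text \<open>
  The witness is the infimum over \<open>t \<ge> 0\<close> of \<open>p (x + t y) - t p y\<close>. Its two
  bounds serve twice. For a minimal \<open>p\<close> they force additivity, and for any \<open>p\<close> a linear functional
  below the new one takes the value \<open>p y\<close> at \<open>y\<close>.
\<close>

lemma sublinear_directional:
  assumes p: "sublinear (p :: 'v::real_vector \<Rightarrow> real)"
  shows "\<exists>r. sublinear r \<and> (\<forall>x. r x \<le> p x) \<and> (\<forall>x. r x \<le> p (x + y) - p y)"
proof (intro exI conjI allI)
  let ?F = "\<lambda>t x. p (x + t *\<^sub>R y) - t * p y"
  let ?r = "\<lambda>x. INF t\<in>{0..}. ?F t x"
  note pD = sublinearD[OF p]
  have bound: "- p (- x) \<le> ?F t x" if "t \<in> {0..}" for t x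
    using pD(1)[of "x + t *\<^sub>R y" "- x"] pD(2)[of t y] that by simp
  have bdd: "bdd_below ((\<lambda>t. ?F t x) ` {0..})" for x
    using bound by (intro bdd_belowI2)
  have lower: "?r x \<le> ?F t x" if "0 \<le> t" for t x
    using that by (intro cINF_lower bdd) auto
  show "?r x \<le> p x" "?r x \<le> p (x + y) - p y" for x
    using lower[of 0 x] lower[of 1 x] by simp_all
  show "sublinear ?r"
  proof (rule sublinear_INF)
    show "\<exists>k\<in>{0..}. ?F k (x + z) \<le> ?F i x + ?F j z" if "i \<in> {0..}" "j \<in> {0..}" for i j x z
      using that pD(1)[of "x + i *\<^sub>R y" "z + j *\<^sub>R y"]
      by (intro bexI[of _ "i + j"]) (auto simp: algebra_simps)
    show "\<exists>k\<in>{0..}. ?F k (c *\<^sub>R x) \<le> c * ?F i x" if "0 < c" "i \<in> {0..}" for c x i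
      using that pD(2)[of c "x + i *\<^sub>R y"]
      by (intro bexI[of _ "c * i"]) (auto simp: algebra_simps)
    show "?r 0 = 0"
    proof (rule antisym)
      show "0 \<le> ?r 0"
        using bound[of _ 0] pD(3) by (intro cINF_greatest) auto
    qed (use lower[of 0 0] pD(3) in simp)
  qed (use bdd in auto)
qed

text \<open>
  Zorn's lemma for the pointwise order. The infimum of a chain of sublinear functionals is finite because all of them
  lie above \<open>x \<mapsto> - p (- x)\<close>.
\<close>

lemma minimal_sublinear_exists:
  assumes p: "sublinear (p :: 'v::real_vector \<Rightarrow> real)"
  shows "\<exists>q. sublinear q \<and> (\<forall>x. q x \<le> p x) \<and> (\<forall>r. sublinear r \<longrightarrow> (\<forall>x. r x \<le> q x) \<longrightarrow> r = q)"
proof -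
  define A where "A = {q. sublinear q \<and> (\<forall>x. q x \<le> p x)}"
  define ge where "ge = (\<lambda>q r :: 'v \<Rightarrow> real. \<forall>x. r x \<le> q x)"
  have "\<exists>m\<in>A. \<forall>r\<in>A. ge m r \<longrightarrow> r = m"
  proof (rule predicate_Zorn)
    show "partial_order_on A (relation_of ge A)"
    proof (rule partial_order_on_relation_ofI)
      show "a = b" if "ge a b" "ge b a" for a b
        using that by (intro ext order.antisym) (auto simp: ge_def)
      show "ge a c" if "ge a b" "ge b c" for a b c
        using that unfolding ge_def by (blast intro: order_trans)
    qed (simp add: ge_def)
    fix C assume C: "C \<in> Chains (relation_of ge A)"
    show "\<exists>u\<in>A. \<forall>a\<in>C. ge a u"
    proof (cases "C = {}")
      case True
      then show ?thesis
        using p by (auto simp: A_def)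
    next
      case False
      have CA: "C \<subseteq> A"
        using C by (auto simp: Chains_def relation_of_def)
      have total: "ge q r \<or> ge r q" if "q \<in> C" "r \<in> C" for q r
        using C that by (auto simp: Chains_def relation_of_def)
      let ?u = "\<lambda>x. INF q\<in>C. q x"
      have sub: "sublinear q" "q x \<le> p x" if "q \<in> C" for q x
        using that CA by (auto simp: A_def)
      have bdd: "bdd_below ((\<lambda>q. q x) ` C)" for x
      proof (rule bdd_belowI2)
        fix q assume "q \<in> C"
        then show "- p (- x) \<le> q x"
          using sub(2)[of q "- x"] sublinearD(4)[OF sub(1), of q x] by simp
      qed
      have lower: "?u x \<le> q x" if "q \<in> C" for q x
        by (rule cINF_lower[OF bdd that])
      have "sublinear ?u"
      proof (rule sublinear_INF[OF False bdd])
        show "\<exists>k\<in>C. k (x + y) \<le> i x + j y" if "i \<in> C" "j \<in> C" for i j x y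
          using total[OF that]
        proof
          assume "ge i j"
          then have "j (x + y) \<le> i x + j y"
            using sublinearD(1)[OF sub(1)[OF that(2)], of x y] unfolding ge_def
            by (meson add_right_mono order_trans)
          then show ?thesis
            using that by blast
        next
          assume "ge j i"
          then have "i (x + y) \<le> i x + j y"
            using sublinearD(1)[OF sub(1)[OF that(1)], of x y] unfolding ge_def
            by (meson add_left_mono order_trans)
          then show ?thesis
            using that by blast
        qed
        show "\<exists>k\<in>C. k (c *\<^sub>R x) \<le> c * i x" if "0 < c" "i \<in> C" for c x i
          using sublinearD(2)[OF sub(1), of i c x] that by (intro bexI[of _ i]) auto
        have "(\<lambda>q. q 0) ` C = {0}"
          using False sublinearD(3)[OF sub(1)] by force
        then show "?u 0 = 0" by simp
      qed
      moreover have "?u x \<le> p x" for x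
        using False lower sub(2) by (meson ex_in_conv order_trans)
      ultimately show ?thesis
        using lower by (intro bexI[of _ ?u]) (auto simp: A_def ge_def)
    qed
  qed
  then obtain q where q: "q \<in> A" and min: "\<And>r. r \<in> A \<Longrightarrow> ge q r \<Longrightarrow> r = q"
    by blast
  have "r \<in> A" if "sublinear r" "\<forall>x. r x \<le> q x" for r
    using q that unfolding A_def by (blast intro: order_trans)
  with q min show ?thesis
    unfolding A_def ge_def by blast
qed

lemma linear_below_sublinear:
  assumes p: "sublinear (p :: 'v::real_vector \<Rightarrow> real)"
  shows "\<exists>g. linear g \<and> (\<forall>x. g x \<le> p x)"
proof -
  obtain q where q: "sublinear q" "\<And>x. q x \<le> p x"
    and min: "\<And>r. sublinear r \<Longrightarrow> (\<And>x. r x \<le> q x) \<Longrightarrow> r = q"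
    using minimal_sublinear_exists[OF p] by blast
  note qD = sublinearD[OF q(1)]
  have add: "q (x + y) = q x + q y" for x y
  proof -
    obtain r where "sublinear r" "\<And>x. r x \<le> q x" "\<And>x. r x \<le> q (x + y) - q y"
      using sublinear_directional[OF q(1), of y] by blast
    with min have "q x \<le> q (x + y) - q y"
      by metis
    with qD(1)[of x y] show ?thesis
      by simp
  qed
  have neg: "q (- x) = - q x" for x
    using add[of x "- x"] qD(3) by simp
  have "q (c *\<^sub>R x) = c * q x" for c x
  proof (cases "0 \<le> c")
    case False
    then show ?thesis
      using qD(2)[of "- c" x] neg[of "c *\<^sub>R x"] by simp
  qed (simp add: qD(2))
  then have "linear q"
    by (intro linearI) (auto simp: add)
  with q(2) show ?thesis
    by blast
qed

text \<open>
  Minimal sublinear functionals are linear, so the extension problem reduces to finding a sublinear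
  functional below \<open>p\<close> that is dominated by \<open>f\<close> on \<open>M\<close>: the infimum over \<open>m \<in> M\<close> of \<open>f m + p (x - m)\<close>.
\<close>

theorem Hahn_Banach:
  fixes p :: "'v::real_vector \<Rightarrow> real"
  assumes p: "sublinear p" and M: "subspace M"
    and f_add: "\<And>x y. x \<in> M \<Longrightarrow> y \<in> M \<Longrightarrow> f (x + y) = f x + f y"
    and f_scale: "\<And>c x. x \<in> M \<Longrightarrow> f (c *\<^sub>R x) = c * f x"
    and f_le: "\<And>x. x \<in> M \<Longrightarrow> f x \<le> p x"
  shows "\<exists>g. linear g \<and> (\<forall>x. g x \<le> p x) \<and> (\<forall>x\<in>M. g x = f x)"
proof -
  let ?F = "\<lambda>m x. f m + p (x - m)"
  let ?q = "\<lambda>x. INF m\<in>M. ?F m x"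
  note pD = sublinearD[OF p] and MD = subspace_0[OF M] subspace_add[OF M] subspace_scale[OF M]
  have f_neg: "f (- m) = - f m" if "m \<in> M" for m
    using f_scale[OF that, of "- 1"] by simp
  have neg: "- m \<in> M" if "m \<in> M" for m
    using MD(3)[OF that, of "- 1"] by simp
  have f0: "f 0 = 0"
    using f_scale[OF MD(1), of 0] by simp
  have bound: "- p (- x) \<le> ?F m x" if "m \<in> M" for m x
    using pD(1)[of "x - m" "- x"] f_le[OF neg[OF that]] f_neg[OF that] by simp
  have bdd: "bdd_below ((\<lambda>m. ?F m x) ` M)" for x
    using bound by (intro bdd_belowI2)
  have lower: "?q x \<le> ?F m x" if "m \<in> M" for m x
    by (rule cINF_lower[OF bdd that])
  have "sublinear ?q"
  proof (rule sublinear_INF[OF _ bdd])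
    show "\<exists>k\<in>M. ?F k (x + y) \<le> ?F i x + ?F j y" if "i \<in> M" "j \<in> M" for i j x y
      using that pD(1)[of "x - i" "y - j"]
      by (intro bexI[of _ "i + j"]) (auto simp: algebra_simps f_add MD)
    show "\<exists>k\<in>M. ?F k (c *\<^sub>R x) \<le> c * ?F i x" if "0 < c" "i \<in> M" for c x i
      using that pD(2)[of c "x - i"]
      by (intro bexI[of _ "c *\<^sub>R i"]) (auto simp: algebra_simps f_scale MD)
    show "?q 0 = 0"
    proof (rule antisym)
      show "0 \<le> ?q 0"
        using bound[of _ 0] pD(3) MD(1) by (intro cINF_greatest) auto
    qed (use lower[OF MD(1), of 0] pD(3) f0 in simp)
  qed (use MD in auto)
  then obtain g where g: "linear g" "\<And>x. g x \<le> ?q x"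
    using linear_below_sublinear by blast
  have "g x \<le> p x" for x
    using order_trans[OF g(2) lower[OF MD(1), of x]] f0 by simp
  moreover have le: "g x \<le> f x" if "x \<in> M" for x
    using order_trans[OF g(2) lower[OF that, of x]] pD(3) by simp
  moreover have "f x \<le> g x" if "x \<in> M" for x
    using le[OF neg[OF that]] f_neg[OF that] linear_neg[OF g(1), of x] by simp
  ultimately show ?thesis
    using g(1) by (intro exI[of _ g]) (auto intro: antisym)
qed

section \<open>States extend and determine the norm\<close>

abbreviation real_part :: "'a::unital_cstar_algebra \<Rightarrow> 'a" where
  "real_part x \<equiv> (1/2) *\<^sub>R (x + star x)"

text \<open>
  The real-linear functionals below this sublinear functional are exactly the maps \<open>x \<mapsto> \<phi> (real_part x)\<close> with \<open>\<phi>\<close> a state. Taking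
  real parts makes it meaningful on the whole algebra, so that Hahn-Banach applies on the type itself.
\<close>

definition upper_bound :: "'a::unital_cstar_algebra \<Rightarrow> real" where
  "upper_bound x = Inf {s. positive (s *\<^sub>R 1 - real_part x)}"

lemma positive_scaleR_one_iff:
  assumes "(1::'a::unital_cstar_algebra) \<noteq> 0"
  shows "positive (t *\<^sub>R (1::'a)) \<longleftrightarrow> 0 \<le> t"
proof
  assume *: "positive (t *\<^sub>R (1::'a))"
  show "0 \<le> t"
  proof (rule ccontr)
    assume "\<not> 0 \<le> t"
    then have "positive (- (t *\<^sub>R (1::'a)))"
      using positive_scaleR_one[of "- t"] by simp
    from positive_antisym[OF * this] show False
      using assms \<open>\<not> 0 \<le> t\<close> by simp
  qed
qed (rule positive_scaleR_one)

context
  assumes nontrivial: "(1::'a::unital_cstar_algebra) \<noteq> 0"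
begin

lemma upper_bound_set:
  fixes x :: 'a
  shows "{s. positive (s *\<^sub>R 1 - real_part x)} \<noteq> {}"
    "bdd_below {s. positive (s *\<^sub>R 1 - real_part x)}"
proof -
  define y where "y = real_part x"
  have "star y = y"
    by (simp add: y_def star_scaleR star_add star_star add.commute)
  then have y: "star y = y" "star (- y) = - y"
    by (simp_all add: star_minus)
  show "{s. positive (s *\<^sub>R 1 - real_part x)} \<noteq> {}"
    unfolding y_def[symmetric] using positive_norm_minus_self[OF y(1) order.refl] by blast
  have "- norm y \<le> s" if "positive (s *\<^sub>R 1 - y)" for s
  proof -
    have "positive ((s *\<^sub>R 1 - y) + (norm y *\<^sub>R 1 - (- y)))"
      by (intro positive_add that positive_norm_minus_self y) simp
    moreover have "(s *\<^sub>R 1 - y) + (norm y *\<^sub>R 1 - (- y)) = (s + norm y) *\<^sub>R 1"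
      by (simp add: scaleR_left_distrib)
    ultimately have "positive ((s + norm y) *\<^sub>R (1::'a))"
      by (simp only:)
    then have "0 \<le> s + norm y"
      by (simp only: positive_scaleR_one_iff[OF nontrivial])
    then show ?thesis
      by linarith
  qed
  then show "bdd_below {s. positive (s *\<^sub>R 1 - real_part x)}"
    unfolding y_def[symmetric]
    by (rule bdd_belowI[where m = "- norm y"]) simp
qed

lemma upper_bound_le: "positive (s *\<^sub>R 1 - real_part x) \<Longrightarrow> upper_bound (x::'a) \<le> s"
  unfolding upper_bound_def by (rule cInf_lower) (use upper_bound_set in auto)

lemma upper_bound_le_self_adjoint: "star x = x \<Longrightarrow> positive (s *\<^sub>R 1 - x) \<Longrightarrow> upper_bound (x::'a) \<le> s"
  by (rule upper_bound_le) (simp flip: scaleR_2)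

lemma sublinear_upper_bound: "sublinear (upper_bound :: 'a \<Rightarrow> real)"
proof (rule sublinearI)
  let ?S = "\<lambda>x::'a. {s. positive (s *\<^sub>R 1 - real_part x)}"
  note ne = upper_bound_set(1)
  fix x y :: 'a
  have "upper_bound (x + y) \<le> t + s" if "s \<in> ?S x" "t \<in> ?S y" for s t
  proof (rule upper_bound_le)
    have "(t + s) *\<^sub>R 1 - real_part (x + y)
        = (s *\<^sub>R 1 - real_part x) + (t *\<^sub>R 1 - real_part y)"
      by (simp add: star_add algebra_simps)
    then show "positive ((t + s) *\<^sub>R 1 - real_part (x + y))"
      using that by (simp only: positive_add mem_Collect_eq)
  qed
  then have "upper_bound (x + y) - s \<le> upper_bound y" if "s \<in> ?S x" for s
    unfolding upper_bound_def[of y]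
    by (intro cInf_greatest ne) (use that in \<open>simp only: diff_le_eq\<close>)
  then have "upper_bound (x + y) - upper_bound y \<le> upper_bound x"
    unfolding upper_bound_def[of x]
    by (intro cInf_greatest ne) (simp add: algebra_simps)
  then show "upper_bound (x + y) \<le> upper_bound x + upper_bound y"
    by simp
next
  show "upper_bound (0::'a) = 0"
  proof -
    have "{s. positive (s *\<^sub>R 1 - real_part (0::'a))} = {0..}"
      by (auto simp: positive_scaleR_one_iff[OF nontrivial])
    then show ?thesis
      by (simp only: upper_bound_def cInf_atLeast)
  qed
next
  let ?S = "\<lambda>x::'a. {s. positive (s *\<^sub>R 1 - real_part x)}"
  fix c :: real and x :: 'a
  assume c: "0 < c"
  have "upper_bound (c *\<^sub>R x) \<le> c * s" if "s \<in> ?S x" for s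
  proof (rule upper_bound_le)
    have "(c * s) *\<^sub>R 1 - real_part (c *\<^sub>R x) = c *\<^sub>R (s *\<^sub>R 1 - real_part x)"
      by (simp add: star_scaleR algebra_simps)
    then show "positive ((c * s) *\<^sub>R 1 - real_part (c *\<^sub>R x))"
      using that c by (simp only: positive_scaleR mem_Collect_eq less_imp_le)
  qed
  then have "upper_bound (c *\<^sub>R x) / c \<le> upper_bound x"
    unfolding upper_bound_def[of x] using c
    by (intro cInf_greatest upper_bound_set) (simp add: field_simps)
  then show "upper_bound (c *\<^sub>R x) \<le> c * upper_bound x"
    using c by (simp add: field_simps)
qed

lemma state_of_linear_functional:
  assumes C: "cstar_subalgebra (C::'a set)" and g: "linear g" and le: "\<And>x. g x \<le> upper_bound x"
  shows "restrict g (sa C) \<in> states (sa_ous C)"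
proof -
  have "0 \<le> g y" if "positive y" for y
  proof -
    have "g (- y) \<le> upper_bound (- y)"
      by (rule le)
    also have "\<dots> \<le> 0"
      using that by (intro upper_bound_le_self_adjoint) (auto simp: star_minus positive_star)
    finally show ?thesis
      by (simp add: linear_neg[OF g])
  qed
  moreover have "g 1 \<le> 1"
    using le[of 1] upper_bound_le_self_adjoint[of 1 1] by (simp add: positive_0)
  moreover have "g (- 1) \<le> - 1"
    using le[of "- 1"] upper_bound_le_self_adjoint[of "- 1" "- 1"] by (simp add: positive_0 star_minus)
  ultimately show ?thesis
    using sa_closed[OF C] saD[of _ C] cstar_subalgebraD[OF C] linear_neg[OF g, of 1]
    by (auto simp: states_def le_sa_ous_iff[OF C] linear_add[OF g] linear_scale[OF g])
qed

end

lemma (in order_unit_space) diff_closed: "x \<in> carrier V \<Longrightarrow> y \<in> carrier V \<Longrightarrow> diff V x y \<in> carrier V"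
  by (simp add: diff_def add_closed scale_closed)

lemma statesD:
  assumes "\<phi> \<in> states V"
  shows "\<phi> \<in> extensional (carrier V)"
    "x \<in> carrier V \<Longrightarrow> y \<in> carrier V \<Longrightarrow> \<phi> (add V x y) = \<phi> x + \<phi> y"
    "x \<in> carrier V \<Longrightarrow> \<phi> (scale V c x) = c * \<phi> x"
    "x \<in> carrier V \<Longrightarrow> le V (zero V) x \<Longrightarrow> 0 \<le> \<phi> x" "\<phi> (unit V) = 1"
  using assms by (auto simp: states_def)

lemma (in order_unit_space) scale_zero: "x \<in> carrier V \<Longrightarrow> scale V 0 x = zero V"
proof -
  assume x: "x \<in> carrier V"
  obtain y where y: "y \<in> carrier V" "add V (scale V 0 x) y = zero V"
    using add_inverse[OF scale_closed[OF x]] by blast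
  have "add V (scale V 0 x) (scale V 0 x) = scale V 0 x"
    using scale_add_left[OF x, of 0 0] by simp
  then have "zero V = add V (scale V 0 x) (zero V)"
    using y add_assoc[of "scale V 0 x" "scale V 0 x" y] scale_closed[OF x] by metis
  then show ?thesis
    using add_zero scale_closed[OF x] by simp
qed

lemma (in order_unit_space) diff_self: "x \<in> carrier V \<Longrightarrow> diff V x x = zero V"
  using scale_add_left[of x 1 "- 1"] by (simp add: diff_def scale_one scale_zero)

lemma (in order_unit_space) state_mono:
  assumes \<phi>: "\<phi> \<in> states V" and xy: "x \<in> carrier V" "y \<in> carrier V" "le V x y"
  shows "\<phi> x \<le> \<phi> y"
proof -
  have "le V (zero V) (diff V y x)"
    using le_add[of x y "scale V (- 1) x"] xy diff_self[of x] scale_closed[of x "- 1"]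
    by (simp add: diff_def)
  then have "0 \<le> \<phi> (diff V y x)"
    using statesD(4)[OF \<phi>] diff_closed xy by blast
  then show ?thesis
    using xy by (simp add: diff_def statesD(2,3)[OF \<phi>] scale_closed)
qed

lemma (in order_unit_space) state_abs_le_norm:
  assumes \<phi>: "\<phi> \<in> states V" and x: "x \<in> carrier V"
  shows "\<bar>\<phi> x\<bar> \<le> ous_norm V x"
  unfolding ous_norm_def
proof (rule cInf_greatest)
  show "{t. 0 < t \<and> le V (scale V (- t) (unit V)) x \<and> le V x (scale V t (unit V))} \<noteq> {}"
    using order_unit[OF x] by auto
  fix t assume "t \<in> {t. 0 < t \<and> le V (scale V (- t) (unit V)) x \<and> le V x (scale V t (unit V))}"
  then have "\<phi> (scale V (- t) (unit V)) \<le> \<phi> x" "\<phi> x \<le> \<phi> (scale V t (unit V))"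
    using state_mono[OF \<phi>] x scale_closed[OF unit_closed] by auto
  then show "\<bar>\<phi> x\<bar> \<le> t"
    using statesD(5)[OF \<phi>] by (simp add: statesD(3)[OF \<phi> unit_closed])
qed

lemma states_nontrivial:
  assumes "cstar_subalgebra (B::'a::unital_cstar_algebra set)" "\<phi> \<in> states (sa_ous B)"
  shows "(1::'a) \<noteq> 0"
proof
  assume "(1::'a) = 0"
  then show False
    using statesD(3)[OF assms(2), of 1 0] statesD(5)[OF assms(2)] sa_closed[OF assms(1)] by simp
qed

text \<open>
  A state of \<open>B\<close> is dominated on \<open>B\<close> by the upper bound computed in the larger algebra, because both algebras
  induce the same order.
\<close>

lemma state_extension:
  assumes B: "cstar_subalgebra (B::'a::unital_cstar_algebra set)" and C: "cstar_subalgebra C" and BC: "B \<subseteq> C"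
    and \<phi>: "\<phi> \<in> states (sa_ous B)"
  shows "\<exists>\<psi>\<in>states (sa_ous C). \<forall>x\<in>sa B. \<psi> x = \<phi> x"
proof -
  note nontrivial = states_nontrivial[OF B \<phi>]
  interpret order_unit_space "sa_ous B"
    by (rule order_unit_space_sa[OF B])
  have "\<exists>g. linear g \<and> (\<forall>x. g x \<le> upper_bound x) \<and> (\<forall>x\<in>sa B. g x = \<phi> x)"
  proof (rule Hahn_Banach[OF sublinear_upper_bound[OF nontrivial]])
    show "subspace (sa B)"
      using sa_closed[OF B] by (simp add: subspace_def)
    fix x assume x: "x \<in> sa B"
    show "\<phi> x \<le> upper_bound x"
      unfolding upper_bound_def
    proof (rule cInf_greatest[OF upper_bound_set(1)[OF nontrivial]])
      fix s assume "s \<in> {s. positive (s *\<^sub>R 1 - real_part x)}"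
      then have "le (sa_ous B) x (s *\<^sub>R 1)"
        using x saD[OF x] cstar_subalgebraD[OF B] by (simp add: le_sa_ous_iff[OF B] flip: scaleR_2)
      then show "\<phi> x \<le> s"
        using state_mono[OF \<phi>, of x "s *\<^sub>R 1"] x statesD(3)[OF \<phi>, of 1 s] statesD(5)[OF \<phi>]
          sa_closed[OF B] by simp
    qed
  qed (use statesD[OF \<phi>] in auto)
  then obtain g where "linear g" "\<And>x. g x \<le> upper_bound x" and gx: "\<And>x. x \<in> sa B \<Longrightarrow> g x = \<phi> x"
    by blast
  then have "restrict g (sa C) \<in> states (sa_ous C)"
    by (intro state_of_linear_functional nontrivial C)
  moreover have "sa B \<subseteq> sa C"
    using BC by (auto simp: sa_def)
  ultimately show ?thesis
    using gx by (intro bexI[of _ "restrict g (sa C)"]) auto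
qed

text \<open>
  The norm of \<open>x\<close> is the larger of the least upper bounds of \<open>x\<close> and \<open>- x\<close>, and each of the two is attained at a
  state by the directional form of Hahn-Banach.
\<close>

lemma norming_state:
  assumes nontrivial: "(1::'a::unital_cstar_algebra) \<noteq> 0"
    and B: "cstar_subalgebra (B::'a set)" and x: "x \<in> sa B"
  shows "\<exists>\<phi>\<in>states (sa_ous B). norm x \<le> \<bar>\<phi> x\<bar>"
proof -
  let ?u = "upper_bound :: 'a \<Rightarrow> real"
  note sub = sublinear_upper_bound[OF nontrivial]
  have attain: "\<exists>\<phi>\<in>states (sa_ous B). ?u y \<le> \<phi> y" if y: "y \<in> sa B" for y
  proof -
    obtain r where r: "sublinear r" "\<And>x. r x \<le> ?u x" "\<And>x. r x \<le> ?u (x + y) - ?u y"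
      using sublinear_directional[OF sub, of y] by blast
    obtain g where g: "linear g" "\<And>x. g x \<le> r x"
      using linear_below_sublinear[OF r(1)] by blast
    have "g (- y) \<le> - ?u y"
      using g(2)[of "- y"] r(3)[of "- y"] sublinearD(3)[OF sub] by simp
    then have "?u y \<le> g y"
      by (simp add: linear_neg[OF g(1)])
    moreover have "restrict g (sa B) \<in> states (sa_ous B)"
      by (rule state_of_linear_functional[OF nontrivial B g(1)]) (rule order_trans[OF g(2) r(2)])
    ultimately show ?thesis
      using y by (intro bexI[of _ "restrict g (sa B)"]) auto
  qed
  have below: "positive (T *\<^sub>R 1 - y)" if lt: "?u y < T" and sa: "star y = y" for y T
  proof -
    obtain s where s: "s < T" "positive (s *\<^sub>R 1 - real_part y)"
      using cInf_lessD[OF upper_bound_set(1)[OF nontrivial] lt[unfolded upper_bound_def]] by blast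
    then have "positive ((T - s) *\<^sub>R 1 + (s *\<^sub>R 1 - y))"
      using sa by (intro positive_add positive_scaleR_one) (auto simp flip: scaleR_2)
    then show ?thesis
      by (simp add: algebra_simps)
  qed
  have sx: "star x = x" "star (- x) = - x"
    using saD[OF x] by (auto simp: star_minus)
  have above: "norm x \<le> T" if T: "?u x < T" "?u (- x) < T" for T
  proof -
    have p: "positive (T *\<^sub>R 1 - x)" "positive (T *\<^sub>R 1 + x)"
      using below[OF T(1) sx(1)] below[OF T(2) sx(2)] by simp_all
    have "(T + T) *\<^sub>R (1::'a) = (T *\<^sub>R 1 - x) + (T *\<^sub>R 1 + x)"
      unfolding scaleR_left_distrib by simp
    then have "positive ((T + T) *\<^sub>R (1::'a))"
      using positive_add[OF p] by (simp only:)
    then have "0 \<le> T + T"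
      by (simp only: positive_scaleR_one_iff[OF nontrivial])
    then have "0 \<le> T"
      by linarith
    then show ?thesis
      using p(2,1) by (rule norm_le_of_positive_bounds)
  qed
  have "norm x \<le> max (?u x) (?u (- x))"
    by (rule dense_ge) (rule above, auto)
  then consider "norm x \<le> ?u x" | "norm x \<le> ?u (- x)"
    unfolding le_max_iff_disj by blast
  then show ?thesis
  proof cases
    case 1
    obtain \<phi> where \<phi>: "\<phi> \<in> states (sa_ous B)" "?u x \<le> \<phi> x"
      using attain[OF x] by blast
    with 1 have "norm x \<le> \<bar>\<phi> x\<bar>"
      by linarith
    with \<phi>(1) show ?thesis
      by blast
  next
    case 2
    obtain \<phi> where \<phi>: "\<phi> \<in> states (sa_ous B)" "?u (- x) \<le> \<phi> (- x)"
      using attain[OF sa_closed(6)[OF B x]] by blast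
    have "\<phi> (- x) = - \<phi> x"
      using statesD(3)[OF \<phi>(1), of x "- 1"] x by simp
    with 2 \<phi>(2) have "norm x \<le> \<bar>\<phi> x\<bar>"
      by linarith
    with \<phi>(1) show ?thesis
      by blast
  qed
qed

section \<open>Order unit spaces inside a normed space\<close>

text \<open>
  Order unit spaces carried by a complete subspace of a normed space whose norm is
  equivalent to the order unit norm. The constant \<open>2\<close> accommodates direct sums, where the norm of the
  product type is Euclidean and the order unit norm is the maximum.
\<close>

locale normed_order_unit_space = order_unit_space V
  for V :: "'v::real_normed_vector ous" +
  assumes add_eq [simp]: "add V = (+)"
    and zero_eq [simp]: "zero V = 0"
    and scale_eq [simp]: "scale V = (*\<^sub>R)"
    and complete_carrier: "complete (carrier V)"
    and ous_norm_add: "x \<in> carrier V \<Longrightarrow> y \<in> carrier V \<Longrightarrow> ous_norm V (x + y) \<le> ous_norm V x + ous_norm V y"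
    and ous_norm_minus: "x \<in> carrier V \<Longrightarrow> ous_norm V (- x) = ous_norm V x"
    and ous_norm_le: "x \<in> carrier V \<Longrightarrow> ous_norm V x \<le> norm x"
    and norm_le_ous_norm: "x \<in> carrier V \<Longrightarrow> norm x \<le> 2 * ous_norm V x"
begin

lemma in_carrier:
  "x \<in> carrier V \<Longrightarrow> y \<in> carrier V \<Longrightarrow> x + y \<in> carrier V"
  "x \<in> carrier V \<Longrightarrow> c *\<^sub>R x \<in> carrier V"
  "x \<in> carrier V \<Longrightarrow> - x \<in> carrier V"
  "x \<in> carrier V \<Longrightarrow> y \<in> carrier V \<Longrightarrow> x - y \<in> carrier V"
  "0 \<in> carrier V"
proof -
  have add: "x + y \<in> carrier V" if "x \<in> carrier V" "y \<in> carrier V" for x y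
    using add_closed[OF that] by simp
  have scale: "c *\<^sub>R x \<in> carrier V" if "x \<in> carrier V" for c x
    using scale_closed[OF that] by simp
  have neg: "- x \<in> carrier V" if "x \<in> carrier V" for x
    using scale[OF that, of "- 1"] by simp
  show "x \<in> carrier V \<Longrightarrow> y \<in> carrier V \<Longrightarrow> x + y \<in> carrier V"
    "x \<in> carrier V \<Longrightarrow> c *\<^sub>R x \<in> carrier V" "x \<in> carrier V \<Longrightarrow> - x \<in> carrier V"
    by (fact add scale neg)+
  show "x - y \<in> carrier V" if "x \<in> carrier V" "y \<in> carrier V"
    using add[OF that(1) neg[OF that(2)]] by simp
  show "0 \<in> carrier V"
    using zero_closed by simp
qed

lemma ous_dist_eq: "x \<in> carrier V \<Longrightarrow> y \<in> carrier V \<Longrightarrow> ous_dist V x y = ous_norm V (x - y)"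
  by (simp add: ous_dist_def diff_def)

lemma ous_dist_le: "x \<in> carrier V \<Longrightarrow> y \<in> carrier V \<Longrightarrow> ous_dist V x y \<le> dist x y"
  using ous_norm_le[OF in_carrier(4)] by (simp add: ous_dist_eq dist_norm)

lemma dist_le_ous_dist: "x \<in> carrier V \<Longrightarrow> y \<in> carrier V \<Longrightarrow> dist x y \<le> 2 * ous_dist V x y"
  using norm_le_ous_norm[OF in_carrier(4)] by (simp add: ous_dist_eq dist_norm)

sublocale metric: Metric_space "carrier V" "ous_dist V"
proof
  show "0 \<le> ous_dist V x y" for x y
  proof (cases "x \<in> carrier V \<and> y \<in> carrier V")
    case True
    then show ?thesis
      using dist_le_ous_dist[of x y] zero_le_dist[of x y] by linarith
  qed (auto simp: ous_dist_def)
  show "ous_dist V x y = ous_dist V y x" for x y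
  proof (cases "x \<in> carrier V \<and> y \<in> carrier V")
    case True
    then show ?thesis
      using ous_norm_minus[OF in_carrier(4), of x y] by (simp add: ous_dist_eq)
  qed (auto simp: ous_dist_def)
  show "ous_dist V x y = 0 \<longleftrightarrow> x = y" if xy: "x \<in> carrier V" "y \<in> carrier V" for x y
  proof
    assume "ous_dist V x y = 0"
    then have "dist x y \<le> 0"
      using dist_le_ous_dist[OF xy] by simp
    then show "x = y"
      by simp
  next
    assume "x = y"
    then show "ous_dist V x y = 0"
      using dist_le_ous_dist[OF xy] ous_dist_le[OF xy] by simp
  qed
  show "ous_dist V x z \<le> ous_dist V x y + ous_dist V y z"
    if "x \<in> carrier V" "y \<in> carrier V" "z \<in> carrier V" for x y z
    using that ous_norm_add[OF in_carrier(4)[of x y] in_carrier(4)[of y z]] by (simp add: ous_dist_eq)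
qed

lemma mtopology_eq: "metric.mtopology = top_of_set (carrier V)"
proof (rule topology_eq[THEN iffD2], intro allI iffI)
  fix U
  assume U: "openin metric.mtopology U"
  show "openin (top_of_set (carrier V)) U"
    unfolding openin_euclidean_subtopology_iff
  proof (intro conjI ballI)
    show "U \<subseteq> carrier V"
      using U by (simp add: metric.openin_mtopology)
    fix x assume x: "x \<in> U"
    then obtain r where r: "0 < r" "metric.mball x r \<subseteq> U" "x \<in> carrier V"
      using U unfolding metric.openin_mtopology by blast
    show "\<exists>e>0. \<forall>x'\<in>carrier V. dist x' x < e \<longrightarrow> x' \<in> U"
    proof (intro exI conjI ballI impI)
      fix x' assume x': "x' \<in> carrier V" "dist x' x < r"
      then have "ous_dist V x x' < r"
        using ous_dist_le[OF r(3) x'(1)] by (simp add: dist_commute)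
      then show "x' \<in> U"
        using r x' by auto
    qed (rule r)
  qed
next
  fix U
  assume U: "openin (top_of_set (carrier V)) U"
  show "openin metric.mtopology U"
    unfolding metric.openin_mtopology
  proof (intro conjI allI impI)
    show sub: "U \<subseteq> carrier V"
      using U by (simp add: openin_euclidean_subtopology_iff)
    fix x assume x: "x \<in> U"
    then obtain e where e: "0 < e" "\<forall>x'\<in>carrier V. dist x' x < e \<longrightarrow> x' \<in> U"
      using U unfolding openin_euclidean_subtopology_iff by blast
    have "metric.mball x (e / 2) \<subseteq> U"
    proof
      fix x' assume "x' \<in> metric.mball x (e / 2)"
      then have x': "x' \<in> carrier V" "ous_dist V x x' < e / 2"
        by auto
      have "x \<in> carrier V"
        using x sub by blast
      then have "dist x x' < e"
        using dist_le_ous_dist[of x x'] x' by linarith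
      then show "x' \<in> U"
        using e x' by (simp add: dist_commute)
    qed
    with e(1) show "\<exists>r>0. metric.mball x r \<subseteq> U"
      by (intro exI[of _ "e / 2"]) simp
  qed
qed

lemma mcomplete: "metric.mcomplete"
  unfolding metric.mcomplete_def
proof (intro allI impI)
  fix \<sigma> assume \<sigma>: "metric.MCauchy \<sigma>"
  then have in_V: "\<sigma> n \<in> carrier V" for n
    by (auto simp: metric.MCauchy_def)
  have "Cauchy \<sigma>"
    unfolding Cauchy_def
  proof (intro allI impI)
    fix e :: real assume "0 < e"
    then obtain N where N: "\<And>n n'. N \<le> n \<Longrightarrow> N \<le> n' \<Longrightarrow> ous_dist V (\<sigma> n) (\<sigma> n') < e / 2"
      using \<sigma> unfolding metric.MCauchy_def by (meson half_gt_zero)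
    have "dist (\<sigma> m) (\<sigma> n) < e" if "N \<le> m" "N \<le> n" for m n
      using N[OF that] dist_le_ous_dist[OF in_V in_V, of m n] by linarith
    then show "\<exists>M. \<forall>m\<ge>M. \<forall>n\<ge>M. dist (\<sigma> m) (\<sigma> n) < e"
      by blast
  qed
  then obtain l where "l \<in> carrier V" "\<sigma> \<longlonglongrightarrow> l"
    using complete_carrier in_V unfolding complete_def by blast
  then show "\<exists>x. limitin metric.mtopology \<sigma> x sequentially"
    unfolding mtopology_eq using in_V by (auto simp: limitin_subtopology)
qed

lemma state_abs_le: "\<phi> \<in> states V \<Longrightarrow> x \<in> carrier V \<Longrightarrow> \<bar>\<phi> x\<bar> \<le> norm x"
  using state_abs_le_norm ous_norm_le order_trans by blast

lemma state_linear:
  assumes "\<phi> \<in> states V" "x \<in> carrier V"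
  shows "y \<in> carrier V \<Longrightarrow> \<phi> (x + y) = \<phi> x + \<phi> y" "\<phi> (c *\<^sub>R x) = c * \<phi> x"
    "y \<in> carrier V \<Longrightarrow> \<phi> (x - y) = \<phi> x - \<phi> y"
proof -
  show add: "\<phi> (x + y) = \<phi> x + \<phi> y" if "y \<in> carrier V" for y
    using statesD(2)[OF assms that] by simp
  show "\<phi> (c *\<^sub>R x) = c * \<phi> x"
    using statesD(3)[OF assms] by simp
  show "\<phi> (x - y) = \<phi> x - \<phi> y" if "y \<in> carrier V"
    using add[of "- y"] statesD(3)[OF assms(1) that, of "- 1"] that by (simp add: in_carrier)
qed

lemma state_unit: "\<phi> \<in> states V \<Longrightarrow> \<phi> (c *\<^sub>R unit V) = c"
  by (simp add: state_linear(2)[OF _ unit_closed] statesD(5))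

text \<open>
  Banach-Alaoglu: the states form a closed subset of a product of compact intervals.
\<close>

lemma compact_space_weak_star: "compact_space (weak_star_topology V)"
  unfolding weak_star_topology_def
proof (rule compact_space_subtopology)
  let ?X = "product_topology (\<lambda>_. euclideanreal) (carrier V)"
  let ?K = "Pi\<^sub>E (carrier V) (\<lambda>x. {- norm x..norm x})"
  have "compactin ?X ?K"
    by (simp add: compactin_PiE)
  moreover have "states V \<subseteq> ?K"
  proof
    fix \<phi> assume \<phi>: "\<phi> \<in> states V"
    show "\<phi> \<in> ?K"
      using state_abs_le[OF \<phi>] statesD(1)[OF \<phi>] by (simp add: PiE_iff abs_le_iff minus_le_iff)
  qed
  moreover have "closedin ?X (states V)"
  proof -
    have ev: "continuous_map ?X euclideanreal (\<lambda>\<phi>. \<phi> x)" if "x \<in> carrier V" for x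
      using that by (rule continuous_map_product_projection)
    have eq0: "closedin ?X {\<phi> \<in> topspace ?X. f \<phi> = g \<phi>}"
      if "continuous_map ?X euclideanreal f" "continuous_map ?X euclideanreal g" for f g
      using that by (rule closedin_continuous_maps_eq[OF Hausdorff_space_euclidean])
    have ge0: "closedin ?X {\<phi> \<in> topspace ?X. 0 \<le> \<phi> x}" if "x \<in> carrier V" for x
      using closedin_continuous_map_preimage[OF ev[OF that], of "{0..}"] by simp
    have ball: "closedin ?X {\<phi> \<in> topspace ?X. \<forall>x\<in>I. P x \<phi>}"
      if "\<And>x. x \<in> I \<Longrightarrow> closedin ?X {\<phi> \<in> topspace ?X. P x \<phi>}" for I :: "'i set" and P
    proof (cases "I = {}")
      case False
      then have "{\<phi> \<in> topspace ?X. \<forall>x\<in>I. P x \<phi>} = (\<Inter>x\<in>I. {\<phi> \<in> topspace ?X. P x \<phi>})"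
        by auto
      moreover have "closedin ?X (\<Inter>x\<in>I. {\<phi> \<in> topspace ?X. P x \<phi>})"
        using False that by (intro closedin_INT) auto
      ultimately show ?thesis
        by (simp only:)
    qed (use closedin_topspace[of ?X] in simp)
    have add: "closedin ?X
        {\<phi> \<in> topspace ?X. \<forall>p\<in>carrier V \<times> carrier V. \<phi> (fst p + snd p) = \<phi> (fst p) + \<phi> (snd p)}"
    proof (rule ball)
      fix p assume "p \<in> carrier V \<times> carrier V"
      then have "fst p \<in> carrier V" "snd p \<in> carrier V"
        by auto
      then show "closedin ?X {\<phi> \<in> topspace ?X. \<phi> (fst p + snd p) = \<phi> (fst p) + \<phi> (snd p)}"
        by (intro eq0 continuous_map_add ev in_carrier)
    qed
    have scale: "closedin ?X
        {\<phi> \<in> topspace ?X. \<forall>p\<in>UNIV \<times> carrier V. \<phi> (fst p *\<^sub>R snd p) = fst p * \<phi> (snd p)}"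
    proof (rule ball)
      fix p :: "real \<times> 'v" assume "p \<in> UNIV \<times> carrier V"
      then have "snd p \<in> carrier V"
        by auto
      then show "closedin ?X {\<phi> \<in> topspace ?X. \<phi> (fst p *\<^sub>R snd p) = fst p * \<phi> (snd p)}"
        by (intro eq0 continuous_map_real_mult_left ev in_carrier)
    qed
    have pos: "closedin ?X {\<phi> \<in> topspace ?X. \<forall>x\<in>{x \<in> carrier V. le V 0 x}. 0 \<le> \<phi> x}"
      by (rule ball) (simp only: ge0 mem_Collect_eq)
    have unit: "closedin ?X {\<phi> \<in> topspace ?X. \<phi> (unit V) = 1}"
      by (intro eq0 ev unit_closed) simp
    have "states V =
        {\<phi> \<in> topspace ?X. \<forall>p\<in>carrier V \<times> carrier V. \<phi> (fst p + snd p) = \<phi> (fst p) + \<phi> (snd p)} \<inter>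
        {\<phi> \<in> topspace ?X. \<forall>p\<in>UNIV \<times> carrier V. \<phi> (fst p *\<^sub>R snd p) = fst p * \<phi> (snd p)} \<inter>
        {\<phi> \<in> topspace ?X. \<forall>x\<in>{x \<in> carrier V. le V 0 x}. 0 \<le> \<phi> x} \<inter>
        {\<phi> \<in> topspace ?X. \<phi> (unit V) = 1}"
      by (auto simp: states_def PiE_def)
    also have "closedin ?X \<dots>"
      by (intro closedin_Int add scale pos unit)
    finally show ?thesis .
  qed
  ultimately show "compactin ?X (states V)"
    by (rule closed_compactin)
qed

section \<open>Lip-norms and compactness of their balls\<close>

text \<open>
  One half of Rieffel's criterion: a seminorm whose ball is compact modulo scalars is a
  Lip-norm. Weak* neighbourhoods contain metric balls since the domain is dense. Conversely a finite net of the compact part of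
  the ball controls all its elements, as states are contractions, and subtracting scalars does not change
  differences of states.
\<close>

theorem quantum_metric_ous_of_compact:
  assumes L_add: "\<And>x y. x \<in> carrier V \<Longrightarrow> y \<in> carrier V \<Longrightarrow> L (x + y) \<le> L x + L y"
    and L_scale: "\<And>c x. x \<in> carrier V \<Longrightarrow> L (c *\<^sub>R x) = ennreal \<bar>c\<bar> * L x"
    and dense: "carrier V \<subseteq> closure (dom_of V L)"
    and kernel: "{x \<in> carrier V. L x = 0} = range (\<lambda>c. c *\<^sub>R unit V)"
    and cpt: "\<And>R. compact {x \<in> lip_ball V L. norm x \<le> R}"
    and bounded: "\<And>x. x \<in> lip_ball V L \<Longrightarrow> \<exists>c. norm (x - c *\<^sub>R unit V) \<le> R\<^sub>0"
  shows "quantum_metric_ous V L"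
proof -
  let ?d = "\<lambda>\<phi> \<psi>. enn2real (mk V L \<phi> \<psi>)"
  have ballD: "x \<in> carrier V" "L x \<le> 1" if "x \<in> lip_ball V L" for x
    using that by (auto simp: lip_ball_def)
  have L_const: "L (c *\<^sub>R unit V) = 0" for c
    using kernel by blast
  have zero_in_ball: "0 \<in> lip_ball V L"
    using L_const[of 0] by (simp add: lip_ball_def in_carrier)
  have shift: "x - c *\<^sub>R unit V \<in> lip_ball V L" if x: "x \<in> lip_ball V L" for x c
  proof -
    have "L (x + (- c) *\<^sub>R unit V) \<le> L x + L ((- c) *\<^sub>R unit V)"
      using L_add ballD(1)[OF x] in_carrier(2)[OF unit_closed] by blast
    then have "L (x - c *\<^sub>R unit V) \<le> 1"
      using ballD(2)[OF x] L_const[of "- c"] by simp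
    then show ?thesis
      using ballD(1)[OF x] by (simp add: lip_ball_def in_carrier unit_closed)
  qed
  have state_diff: "\<bar>\<phi> x - \<psi> x\<bar> = \<bar>\<phi> (x - c *\<^sub>R unit V) - \<psi> (x - c *\<^sub>R unit V)\<bar>"
    if "\<phi> \<in> states V" "\<psi> \<in> states V" "x \<in> carrier V" for \<phi> \<psi> x c
    using that by (simp add: state_linear in_carrier unit_closed statesD(5))
  have mk_le: "mk V L \<phi> \<psi> \<le> ennreal (2 * R\<^sub>0)" if \<phi>\<psi>: "\<phi> \<in> states V" "\<psi> \<in> states V" for \<phi> \<psi>
    unfolding mk_def
  proof (rule SUP_least, rule ennreal_leI)
    fix x assume x: "x \<in> lip_ball V L"
    obtain c where c: "norm (x - c *\<^sub>R unit V) \<le> R\<^sub>0"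
      using bounded[OF x] by blast
    have "x - c *\<^sub>R unit V \<in> carrier V"
      using ballD(1)[OF shift[OF x]] .
    then have "\<bar>\<phi> (x - c *\<^sub>R unit V)\<bar> \<le> R\<^sub>0" "\<bar>\<psi> (x - c *\<^sub>R unit V)\<bar> \<le> R\<^sub>0"
      using state_abs_le[OF \<phi>\<psi>(1)] state_abs_le[OF \<phi>\<psi>(2)] c by fastforce+
    then show "\<bar>\<phi> x - \<psi> x\<bar> \<le> 2 * R\<^sub>0"
      unfolding state_diff[OF \<phi>\<psi> ballD(1)[OF x], of c] by linarith
  qed
  have fin: "mk V L \<phi> \<psi> < \<infinity>" if "\<phi> \<in> states V" "\<psi> \<in> states V" for \<phi> \<psi>
    using mk_le[OF that] by (auto simp: less_top[symmetric] top_unique)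
  have diff_le: "\<bar>\<phi> x - \<psi> x\<bar> \<le> ?d \<phi> \<psi>"
    if "\<phi> \<in> states V" "\<psi> \<in> states V" "x \<in> lip_ball V L" for \<phi> \<psi> x
  proof -
    have "ennreal \<bar>\<phi> x - \<psi> x\<bar> \<le> mk V L \<phi> \<psi>"
      unfolding mk_def by (rule SUP_upper) (rule that)
    then have "enn2real (ennreal \<bar>\<phi> x - \<psi> x\<bar>) \<le> ?d \<phi> \<psi>"
      using fin[OF that(1,2)] by (intro enn2real_mono) auto
    then show ?thesis by simp
  qed
  have d_le: "?d \<phi> \<psi> \<le> r" if "0 \<le> r" "\<And>x. x \<in> lip_ball V L \<Longrightarrow> \<bar>\<phi> x - \<psi> x\<bar> \<le> r" for \<phi> \<psi> r
    unfolding mk_def using that by (intro enn2real_leI SUP_least ennreal_leI) auto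
  have scaled: "\<exists>s>0. s *\<^sub>R x \<in> lip_ball V L" if "x \<in> dom_of V L" for x
  proof -
    have x: "x \<in> carrier V" "L x < \<infinity>"
      using that by (auto simp: dom_of_def)
    then obtain l where l: "0 \<le> l" "L x = ennreal l"
      by (cases "L x") auto
    have "L ((1 / (l + 1)) *\<^sub>R x) = ennreal (1 / (l + 1) * l)"
      using l by (simp add: L_scale[OF x(1)] ennreal_mult'' flip: ennreal_mult)
    also have "\<dots> \<le> 1"
      using l by (simp add: divide_le_eq)
    finally show ?thesis
      using x l by (intro exI[of _ "1 / (l + 1)"]) (auto simp: lip_ball_def in_carrier)
  qed
  have approx: "\<exists>y\<in>dom_of V L. norm (x - y) < e" if "x \<in> carrier V" "0 < e" for x e
    using that dense closure_approachable[of x "dom_of V L"]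
    by (auto simp: dist_norm norm_minus_commute)
  have eval: "\<exists>r>0. \<forall>\<phi>\<in>states V. \<forall>\<psi>\<in>states V. ?d \<phi> \<psi> < r \<longrightarrow> \<bar>\<phi> x - \<psi> x\<bar> < e"
    if x: "x \<in> carrier V" and e: "0 < e" for x e
  proof -
    obtain y where y: "y \<in> dom_of V L" "norm (x - y) < e / 3"
      using approx[OF x, of "e / 3"] e by auto
    then have yV: "y \<in> carrier V"
      by (simp add: dom_of_def)
    obtain s where s: "0 < s" "s *\<^sub>R y \<in> lip_ball V L"
      using scaled[OF y(1)] by blast
    show ?thesis
    proof (intro exI[of _ "s * (e / 3)"] conjI ballI impI)
      show "0 < s * (e / 3)"
        using s e by simp
      fix \<phi> \<psi> assume \<phi>: "\<phi> \<in> states V" and \<psi>: "\<psi> \<in> states V" and d: "?d \<phi> \<psi> < s * (e / 3)"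
      have "\<bar>s * \<phi> y - s * \<psi> y\<bar> < s * (e / 3)"
        using diff_le[OF \<phi> \<psi> s(2)] d by (simp add: state_linear \<phi> \<psi> yV)
      then have "s * \<bar>\<phi> y - \<psi> y\<bar> < s * (e / 3)"
        using s(1) by (simp add: abs_mult flip: right_diff_distrib)
      then have "\<bar>\<phi> y - \<psi> y\<bar> < e / 3"
        using s(1) mult_less_cancel_left_pos by blast
      moreover have "\<bar>\<phi> x - \<phi> y\<bar> < e / 3" "\<bar>\<psi> x - \<psi> y\<bar> < e / 3"
        using state_abs_le[OF \<phi> in_carrier(4)[OF x yV]] state_abs_le[OF \<psi> in_carrier(4)[OF x yV]] y(2)
        by (simp_all add: state_linear \<phi> \<psi> x yV)
      ultimately show "\<bar>\<phi> x - \<psi> x\<bar> < e"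
        by linarith
    qed
  qed
  interpret S: Metric_space "states V" ?d
  proof
    show "?d \<phi> \<psi> = ?d \<psi> \<phi>" for \<phi> \<psi>
      by (simp add: mk_def abs_minus_commute)
    show "?d \<phi> \<psi> = 0 \<longleftrightarrow> \<phi> = \<psi>" if \<phi>\<psi>: "\<phi> \<in> states V" "\<psi> \<in> states V" for \<phi> \<psi>
    proof
      assume 0: "?d \<phi> \<psi> = 0"
      show "\<phi> = \<psi>"
      proof (rule extensionalityI[OF statesD(1)[OF \<phi>\<psi>(1)] statesD(1)[OF \<phi>\<psi>(2)]])
        fix x assume x: "x \<in> carrier V"
        show "\<phi> x = \<psi> x"
        proof (rule ccontr)
          assume "\<phi> x \<noteq> \<psi> x"
          then have "0 < \<bar>\<phi> x - \<psi> x\<bar>"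
            by simp
          then obtain r where "0 < r" "?d \<phi> \<psi> < r \<Longrightarrow> \<bar>\<phi> x - \<psi> x\<bar> < \<bar>\<phi> x - \<psi> x\<bar>"
            using eval[OF x] \<phi>\<psi> by blast
          with 0 show False
            by simp
        qed
      qed
    next
      assume "\<phi> = \<psi>"
      moreover have "?d \<psi> \<psi> \<le> 0"
        by (rule d_le) auto
      ultimately show "?d \<phi> \<psi> = 0"
        by (simp add: order.antisym)
    qed
    show "?d \<phi> \<rho> \<le> ?d \<phi> \<psi> + ?d \<psi> \<rho>"
      if "\<phi> \<in> states V" "\<psi> \<in> states V" "\<rho> \<in> states V" for \<phi> \<psi> \<rho>
    proof (rule d_le)
      fix x assume "x \<in> lip_ball V L"
      then show "\<bar>\<phi> x - \<rho> x\<bar> \<le> ?d \<phi> \<psi> + ?d \<psi> \<rho>"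
        using diff_le[of \<phi> \<psi> x] diff_le[of \<psi> \<rho> x] that by linarith
    qed simp
  qed simp
  let ?X = "product_topology (\<lambda>_. euclideanreal) (carrier V)"
  have "S.mtopology = weak_star_topology V"
  proof (rule topology_eq[THEN iffD2], intro allI iffI)
    fix U assume U: "openin (weak_star_topology V) U"
    have "continuous_map S.mtopology ?X id"
      unfolding continuous_map_componentwise
    proof (intro conjI ballI)
      show "id ` topspace S.mtopology \<subseteq> extensional (carrier V)"
        using statesD(1) by auto
      fix x assume x: "x \<in> carrier V"
      show "continuous_map S.mtopology euclideanreal (\<lambda>\<phi>. id \<phi> x)"
        unfolding continuous_map_def
      proof (intro conjI allI impI)
        fix T assume T: "openin euclideanreal T"
        show "openin S.mtopology {\<phi> \<in> topspace S.mtopology. id \<phi> x \<in> T}"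
          unfolding S.openin_mtopology
        proof (intro conjI allI impI)
          fix \<phi> assume "\<phi> \<in> {\<phi> \<in> topspace S.mtopology. id \<phi> x \<in> T}"
          then have \<phi>: "\<phi> \<in> states V" "\<phi> x \<in> T"
            by auto
          then obtain e where e: "0 < e" "\<And>t. \<bar>t - \<phi> x\<bar> < e \<Longrightarrow> t \<in> T"
            using T by (auto simp: open_real)
          obtain r where r: "0 < r" "\<And>\<psi>. \<psi> \<in> states V \<Longrightarrow> ?d \<phi> \<psi> < r \<Longrightarrow> \<bar>\<phi> x - \<psi> x\<bar> < e"
            using eval[OF x e(1)] \<phi>(1) by blast
          have "S.mball \<phi> r \<subseteq> {\<phi> \<in> topspace S.mtopology. id \<phi> x \<in> T}"
            using r(2) e(2) by (auto simp: abs_minus_commute)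
          with r(1) show "\<exists>r>0. S.mball \<phi> r \<subseteq> {\<phi> \<in> topspace S.mtopology. id \<phi> x \<in> T}"
            by blast
        qed auto
      qed auto
    qed
    then have "continuous_map S.mtopology (weak_star_topology V) id"
      unfolding weak_star_topology_def by (simp add: continuous_map_in_subtopology)
    then have "openin S.mtopology {\<phi> \<in> topspace S.mtopology. id \<phi> \<in> U}"
      using U by (rule openin_continuous_map_preimage)
    moreover have "U \<subseteq> states V"
      using openin_subset[OF U] by (auto simp: weak_star_topology_def)
    then have "{\<phi> \<in> topspace S.mtopology. id \<phi> \<in> U} = U"
      by auto
    ultimately show "openin S.mtopology U"
      by simp
  next
    fix U assume U: "openin S.mtopology U"
    show "openin (weak_star_topology V) U"
    proof (subst openin_subopen, intro ballI)
      fix \<phi> assume "\<phi> \<in> U"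
      then obtain r where r: "0 < r" "S.mball \<phi> r \<subseteq> U" and \<phi>: "\<phi> \<in> states V"
        using U unfolding S.openin_mtopology by blast
      \<comment> \<open>Modulo scalars, \<open>?K\<close> is the whole ball.\<close>
      let ?K = "{x \<in> lip_ball V L. norm x \<le> R\<^sub>0}"
      have "?K \<subseteq> (\<Union>x\<in>?K. ball x (r / 4))"
        using r(1) by force
      then obtain C where C: "C \<subseteq> ?K" "finite C" "?K \<subseteq> (\<Union>x\<in>C. ball x (r / 4))"
        using compactE_image[OF cpt, of ?K "\<lambda>x. ball x (r / 4)"] by auto
      have CV: "y \<in> carrier V" if "y \<in> C" for y
        using that C(1) ballD(1) by blast
      let ?T = "states V \<inter> Pi\<^sub>E (carrier V) (\<lambda>y. if y \<in> C then ball (\<phi> y) (r / 4) else UNIV)"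
      have "openin ?X (Pi\<^sub>E (carrier V) (\<lambda>y. if y \<in> C then ball (\<phi> y) (r / 4) else UNIV))"
        unfolding openin_PiE_gen
        by (rule disjI2) (auto intro: finite_subset[OF _ C(2)])
      then have "openin (weak_star_topology V) ?T"
        unfolding weak_star_topology_def openin_subtopology by blast
      moreover have "\<phi> \<in> ?T"
        using \<phi> statesD(1)[OF \<phi>] r(1) by (auto simp: PiE_def)
      moreover have "?T \<subseteq> U"
      proof
        fix \<psi> assume \<psi>T: "\<psi> \<in> ?T"
        then have \<psi>: "\<psi> \<in> states V" by simp
        have near: "\<bar>\<phi> y - \<psi> y\<bar> < r / 4" if "y \<in> C" for y
          using PiE_mem[OF IntD2[OF \<psi>T] CV[OF that]] that by (simp add: dist_real_def)
        have "?d \<phi> \<psi> \<le> 3 * (r / 4)"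
        proof (rule d_le)
          fix x assume x: "x \<in> lip_ball V L"
          obtain c where c: "norm (x - c *\<^sub>R unit V) \<le> R\<^sub>0"
            using bounded[OF x] by blast
          define z where "z = x - c *\<^sub>R unit V"
          have z: "z \<in> ?K" "z \<in> carrier V"
            using shift[OF x] c ballD(1) by (auto simp: z_def)
          then obtain y where y: "y \<in> C" "norm (y - z) < r / 4"
            using C(3) by (auto simp: dist_norm)
          have "\<bar>\<phi> y - \<phi> z\<bar> < r / 4" "\<bar>\<psi> y - \<psi> z\<bar> < r / 4"
            using state_abs_le[OF \<phi> in_carrier(4)[OF CV[OF y(1)] z(2)]]
              state_abs_le[OF \<psi> in_carrier(4)[OF CV[OF y(1)] z(2)]] y(2)
            by (simp_all add: state_linear \<phi> \<psi> z(2) CV[OF y(1)])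
          then have "\<bar>\<phi> z - \<psi> z\<bar> \<le> 3 * (r / 4)"
            using near[OF y(1)] by linarith
          then show "\<bar>\<phi> x - \<psi> x\<bar> \<le> 3 * (r / 4)"
            unfolding z_def state_diff[OF \<phi> \<psi> ballD(1)[OF x], of c] .
        qed (use r(1) in simp)
        also have "\<dots> < r"
          using r(1) by simp
        finally show "\<psi> \<in> U"
          using r(2) \<phi> \<psi> by auto
      qed
      ultimately show "\<exists>T. openin (weak_star_topology V) T \<and> \<phi> \<in> T \<and> T \<subseteq> U"
        by blast
    qed
  qed
  moreover have "closedin metric.mtopology (lip_ball V L)"
  proof -
    have "closed (lip_ball V L)"
      unfolding closed_sequential_limits
    proof (intro allI impI, elim conjE)
      fix f l assume f: "\<forall>n. f n \<in> lip_ball V L" and l: "f \<longlonglongrightarrow> l"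
      obtain R where "\<And>n. norm (f n) \<le> R"
        using convergent_imp_Bseq[OF convergentI[OF l]] by (auto simp: Bseq_def)
      with f have "\<forall>n. f n \<in> {x \<in> lip_ball V L. norm x \<le> R}"
        by blast
      then have "l \<in> {x \<in> lip_ball V L. norm x \<le> R}"
        using closed_sequentially[OF compact_imp_closed[OF cpt] _ l] by blast
      then show "l \<in> lip_ball V L"
        by blast
    qed
    then show ?thesis
      unfolding mtopology_eq by (intro closed_subset) (auto simp: lip_ball_def)
  qed
  moreover have "metric.mtopology closure_of dom_of V L = carrier V"
  proof -
    have "dom_of V L \<subseteq> carrier V"
      by (auto simp: dom_of_def)
    then show ?thesis
      using dense unfolding mtopology_eq closure_of_subtopology by (auto simp: inf.absorb2)
  qed
  ultimately show ?thesis
    unfolding quantum_metric_ous_def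
    using order_unit_space_axioms mcomplete L_add L_scale kernel fin S.Metric_space_axioms by simp
qed

end

lemma quantum_metric_ousD:
  assumes "quantum_metric_ous V L"
  shows "order_unit_space V" "x \<in> carrier V \<Longrightarrow> y \<in> carrier V \<Longrightarrow> L (add V x y) \<le> L x + L y"
    "x \<in> carrier V \<Longrightarrow> L (scale V c x) = ennreal \<bar>c\<bar> * L x"
    "norm_topology V closure_of dom_of V L = carrier V"
    "{x \<in> carrier V. L x = 0} = range (\<lambda>c. scale V c (unit V))"
    "\<phi> \<in> states V \<Longrightarrow> \<psi> \<in> states V \<Longrightarrow> mk V L \<phi> \<psi> < \<infinity>"
    "Metric_space (states V) (\<lambda>\<phi> \<psi>. enn2real (mk V L \<phi> \<psi>))"
    "Metric_space.mtopology (states V) (\<lambda>\<phi> \<psi>. enn2real (mk V L \<phi> \<psi>)) = weak_star_topology V"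
    "closedin (norm_topology V) (lip_ball V L)"
  using assms by (simp_all add: quantum_metric_ous_def)

text \<open>
  Two points in the same cell of the grid of mesh \<open>e\<close> are close for all functionals in \<open>F\<close>, and boundedness leaves
  finitely many cells.
\<close>

lemma finite_net_for_functionals:
  fixes K :: "'v set" and F :: "('v \<Rightarrow> real) set"
  assumes F: "finite F" and bdd: "\<And>\<phi> x. \<phi> \<in> F \<Longrightarrow> x \<in> K \<Longrightarrow> \<bar>\<phi> x\<bar> \<le> R" and e: "0 < e"
  shows "\<exists>N. finite N \<and> N \<subseteq> K \<and> (\<forall>x\<in>K. \<exists>y\<in>N. \<forall>\<phi>\<in>F. \<bar>\<phi> x - \<phi> y\<bar> < e)"
proof -
  let ?g = "\<lambda>x. restrict (\<lambda>\<phi>. \<lfloor>\<phi> x / e\<rfloor>) F"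
  have "?g ` K \<subseteq> Pi\<^sub>E F (\<lambda>_. {\<lfloor>- R / e\<rfloor>..\<lfloor>R / e\<rfloor>})"
  proof (rule image_subsetI, rule PiE_I)
    fix x \<phi> assume x: "x \<in> K" and \<phi>: "\<phi> \<in> F"
    have "- R \<le> \<phi> x" "\<phi> x \<le> R"
      using bdd[OF \<phi> x] by linarith+
    then have "- R / e \<le> \<phi> x / e" "\<phi> x / e \<le> R / e"
      using e by (simp_all only: divide_right_mono less_imp_le)
    then show "?g x \<phi> \<in> {\<lfloor>- R / e\<rfloor>..\<lfloor>R / e\<rfloor>}"
      using \<phi> by (simp add: floor_mono)
  qed simp
  then have fin: "finite (?g ` K)"
    by (rule finite_subset) (intro finite_PiE F finite_atLeastAtMost_int)
  let ?N = "inv_into K ?g ` (?g ` K)"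
  show ?thesis
  proof (intro exI[of _ ?N] conjI ballI)
    show "finite ?N"
      using fin by (rule finite_imageI)
    show "?N \<subseteq> K"
      by (auto intro: inv_into_into)
    fix x assume x: "x \<in> K"
    let ?y = "inv_into K ?g (?g x)"
    have "?g ?y = ?g x"
      using x by (intro f_inv_into_f) auto
    then have eq: "\<lfloor>\<phi> ?y / e\<rfloor> = \<lfloor>\<phi> x / e\<rfloor>" if "\<phi> \<in> F" for \<phi>
      using that by (metis (no_types, lifting) restrict_apply')
    have "\<bar>\<phi> x - \<phi> ?y\<bar> < e" if "\<phi> \<in> F" for \<phi>
    proof -
      have "\<bar>\<phi> x / e - \<phi> ?y / e\<bar> < 1"
        using eq[OF that] floor_correct[of "\<phi> x / e"] floor_correct[of "\<phi> ?y / e"] by linarith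
      then have "\<bar>(\<phi> x - \<phi> ?y) / e\<bar> < 1"
        by (simp only: diff_divide_distrib)
      then show ?thesis
        using e by (simp add: abs_divide divide_less_eq)
    qed
    with x show "\<exists>y\<in>?N. \<forall>\<phi>\<in>F. \<bar>\<phi> x - \<phi> y\<bar> < e"
      by (intro bexI[of _ ?y]) auto
  qed
qed

context normed_order_unit_space
begin

lemma mk_eval_le:
  assumes "mk V L \<phi> \<psi> < \<infinity>" "x \<in> lip_ball V L"
  shows "\<bar>\<phi> x - \<psi> x\<bar> \<le> enn2real (mk V L \<phi> \<psi>)"
proof -
  have "ennreal \<bar>\<phi> x - \<psi> x\<bar> \<le> mk V L \<phi> \<psi>"
    unfolding mk_def by (rule SUP_upper) (rule assms)
  then have "enn2real (ennreal \<bar>\<phi> x - \<psi> x\<bar>) \<le> enn2real (mk V L \<phi> \<psi>)"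
    using assms(1) by (intro enn2real_mono) auto
  then show ?thesis by simp
qed

text \<open>
  The other half of Rieffel's criterion. The state space is compact for the metric of a Lip-norm, hence has a finite
  \<open>e\<close>-net; on the ball, where evaluation is \<open>1\<close>-Lipschitz in the state, closeness at the net gives
  closeness at all states, that is in norm. The diameter of the state space bounds the ball modulo
  scalars. This is the argument of the Arzela-Ascoli theorem.
\<close>

theorem lip_ball_compact_mod_scalars:
  assumes qm: "quantum_metric_ous V L"
    and norming: "\<And>x t. x \<in> carrier V \<Longrightarrow> 0 \<le> t \<Longrightarrow> (\<And>\<phi>. \<phi> \<in> states V \<Longrightarrow> \<bar>\<phi> x\<bar> \<le> t) \<Longrightarrow> norm x \<le> t"
  shows "compact {x \<in> lip_ball V L. norm x \<le> R}"
    and "\<exists>R\<^sub>0. \<forall>x\<in>lip_ball V L. \<exists>c. norm (x - c *\<^sub>R unit V) \<le> R\<^sub>0"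
proof -
  let ?d = "\<lambda>\<phi> \<psi>. enn2real (mk V L \<phi> \<psi>)"
  note qmD = quantum_metric_ousD[OF qm]
  interpret S: Metric_space "states V" ?d
    by (rule qmD)
  have ballD: "x \<in> carrier V" "L x \<le> 1" if "x \<in> lip_ball V L" for x
    using that by (auto simp: lip_ball_def)
  have diff_le: "\<bar>\<phi> x - \<psi> x\<bar> \<le> ?d \<phi> \<psi>"
    if "\<phi> \<in> states V" "\<psi> \<in> states V" "x \<in> lip_ball V L" for \<phi> \<psi> x
    by (rule mk_eval_le[OF qmD(6)[OF that(1,2)] that(3)])
  have "compactin S.mtopology (states V)"
    using compact_space_weak_star unfolding qmD(8)[symmetric] compact_space_def S.topspace_mtopology .
  then have tb: "S.mtotally_bounded (states V)"
    by (rule S.compactin_imp_mtotally_bounded)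
  show "compact {x \<in> lip_ball V L. norm x \<le> R}"
    unfolding compact_eq_totally_bounded
  proof (intro conjI allI impI)
    let ?K = "{x \<in> lip_ball V L. norm x \<le> R}"
    have "closedin (top_of_set (carrier V)) (lip_ball V L)"
      using qmD(9) unfolding mtopology_eq .
    then have "closed (lip_ball V L)"
      using complete_imp_closed[OF complete_carrier] closedin_closed_trans by blast
    then have "complete (carrier V \<inter> (lip_ball V L \<inter> cball 0 R))"
      by (intro complete_Int_closed complete_carrier closed_Int closed_cball)
    moreover have "carrier V \<inter> (lip_ball V L \<inter> cball 0 R) = ?K"
      using ballD by auto
    ultimately show "complete ?K" by simp
    fix e :: real assume e: "0 < e"
    obtain F where F: "finite F" "F \<subseteq> states V" "states V \<subseteq> (\<Union>\<phi>\<in>F. S.mball \<phi> (e / 4))"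
      using tb e unfolding S.mtotally_bounded_def by (meson divide_pos_pos zero_less_numeral)
    have "\<bar>\<phi> x\<bar> \<le> R" if "\<phi> \<in> F" "x \<in> ?K" for \<phi> x
      using state_abs_le[of \<phi> x] that F(2) ballD(1)[of x] by auto
    then obtain N where N: "finite N" "N \<subseteq> ?K" "\<And>x. x \<in> ?K \<Longrightarrow> \<exists>y\<in>N. \<forall>\<phi>\<in>F. \<bar>\<phi> x - \<phi> y\<bar> < e / 4"
      using finite_net_for_functionals[OF F(1), of ?K R "e / 4"] e by auto
    have "?K \<subseteq> (\<Union>y\<in>N. ball y e)"
    proof
      fix x assume x: "x \<in> ?K"
      obtain y where y: "y \<in> N" "\<And>\<phi>. \<phi> \<in> F \<Longrightarrow> \<bar>\<phi> x - \<phi> y\<bar> < e / 4"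
        using N(3)[OF x] by blast
      have xy: "x \<in> lip_ball V L" "y \<in> lip_ball V L"
        using x y(1) N(2) by auto
      have "norm (x - y) \<le> 3 * (e / 4)"
      proof (rule norming)
        fix \<psi> assume \<psi>: "\<psi> \<in> states V"
        then obtain \<phi> where \<phi>: "\<phi> \<in> F" "\<phi> \<in> states V" "?d \<phi> \<psi> < e / 4"
          using F(3) by auto
        have "\<bar>\<psi> x - \<psi> y\<bar> \<le> 3 * (e / 4)"
          using diff_le[OF \<phi>(2) \<psi> xy(1)] diff_le[OF \<phi>(2) \<psi> xy(2)] y(2)[OF \<phi>(1)] \<phi>(3) by linarith
        then show "\<bar>\<psi> (x - y)\<bar> \<le> 3 * (e / 4)"
          by (simp add: state_linear(3)[OF \<psi>] ballD xy)
      qed (use e ballD xy in \<open>auto intro: in_carrier\<close>)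
      also have "\<dots> < e"
        using e by simp
      finally show "x \<in> (\<Union>y\<in>N. ball y e)"
        using y(1) by (auto simp: dist_norm norm_minus_commute)
    qed
    with N(1) show "\<exists>k. finite k \<and> ?K \<subseteq> (\<Union>x\<in>k. ball x e)"
      by blast
  qed
  show "\<exists>R\<^sub>0. \<forall>x\<in>lip_ball V L. \<exists>c. norm (x - c *\<^sub>R unit V) \<le> R\<^sub>0"
  proof (cases "states V = {}")
    case True
    have "norm x \<le> 0" if "x \<in> carrier V" for x
      by (rule norming) (use that True in auto)
    then have "\<forall>x\<in>lip_ball V L. \<exists>c. norm (x - c *\<^sub>R unit V) \<le> 0"
      using ballD(1) by (metis diff_zero scale_zero_left)
    then show ?thesis ..
  next
    case False
    then obtain \<phi>\<^sub>0 where \<phi>\<^sub>0: "\<phi>\<^sub>0 \<in> states V"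
      by blast
    obtain \<rho> B where B: "states V \<subseteq> S.mcball \<rho> B"
      using S.mtotally_bounded_imp_mbounded[OF tb] by (auto simp: S.mbounded_def)
    have diam: "?d \<phi> \<psi> \<le> 2 * B" if "\<phi> \<in> states V" "\<psi> \<in> states V" for \<phi> \<psi>
    proof -
      have "\<rho> \<in> states V" "?d \<rho> \<phi> \<le> B" "?d \<rho> \<psi> \<le> B"
        using B that by (auto simp: subset_iff)
      then show ?thesis
        using S.triangle[of \<phi> \<rho> \<psi>] S.commute[of \<phi> \<rho>] that by linarith
    qed
    have "norm (x - \<phi>\<^sub>0 x *\<^sub>R unit V) \<le> 2 * B" if x: "x \<in> lip_ball V L" for x
    proof (rule norming)
      show "x - \<phi>\<^sub>0 x *\<^sub>R unit V \<in> carrier V"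
        using ballD[OF x] by (intro in_carrier unit_closed)
      show "0 \<le> 2 * B"
        using diam[OF \<phi>\<^sub>0 \<phi>\<^sub>0] S.nonneg[of \<phi>\<^sub>0 \<phi>\<^sub>0] by linarith
      fix \<psi> assume \<psi>: "\<psi> \<in> states V"
      have "\<psi> (x - \<phi>\<^sub>0 x *\<^sub>R unit V) = \<psi> x - \<phi>\<^sub>0 x"
        using ballD[OF x] \<psi> by (simp add: state_linear(3) in_carrier unit_closed state_unit)
      then show "\<bar>\<psi> (x - \<phi>\<^sub>0 x *\<^sub>R unit V)\<bar> \<le> 2 * B"
        using diff_le[OF \<psi> \<phi>\<^sub>0 x] diam[OF \<psi> \<phi>\<^sub>0] by linarith
    qed
    then show ?thesis
      by blast
  qed
qed

end

lemma norming_sa: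
  assumes B: "cstar_subalgebra (B::'a::unital_cstar_algebra set)" and x: "x \<in> sa B" and t: "0 \<le> t"
    and le: "\<And>\<phi>. \<phi> \<in> states (sa_ous B) \<Longrightarrow> \<bar>\<phi> x\<bar> \<le> t"
  shows "norm x \<le> t"
proof (cases "(1::'a) = 0")
  case True
  then have "x = 0"
    using mult_1_right[of x] by simp
  then show ?thesis
    using t by simp
next
  case False
  then show ?thesis
    using norming_state[OF False B x] le by (meson order_trans)
qed

lemma normed_order_unit_space_sa:
  assumes B: "cstar_subalgebra (B::'a::unital_cstar_algebra set)"
  shows "normed_order_unit_space (sa_ous B)"
proof -
  interpret order_unit_space "sa_ous B"
    by (rule order_unit_space_sa[OF B])
  show ?thesis
    by unfold_locales
      (simp_all add: complete_eq_closed closed_sa[OF B] ous_norm_sa[OF B] sa_closed[OF B] norm_triangle_ineq)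
qed

section \<open>Direct sums of order unit spaces\<close>

lemma (in order_unit_space) unit_nonneg: "le V (zero V) (unit V)"
proof -
  have scale_zero_right: "scale V c (zero V) = zero V" for c
    using scale_scale[OF zero_closed, of c 0] by (simp add: scale_zero zero_closed)
  obtain t where t: "0 < t" "le V (scale V (- t) (unit V)) (unit V)"
    using order_unit[OF unit_closed] by blast
  let ?u = "\<lambda>c. scale V c (unit V)"
  have u: "?u c \<in> carrier V" for c
    by (rule scale_closed[OF unit_closed])
  have "le V (add V (?u (- t)) (?u t)) (add V (?u 1) (?u t))"
    using le_add[OF u unit_closed u t(2)] by (simp add: scale_one unit_closed)
  then have "le V (zero V) (?u (1 + t))"
    using scale_add_left[OF unit_closed, of "- t" t] scale_add_left[OF unit_closed, of 1 t]
      scale_zero[OF unit_closed] by simp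
  then have "le V (scale V (1 / (1 + t)) (zero V)) (scale V (1 / (1 + t)) (?u (1 + t)))"
    using t(1) by (intro le_scale zero_closed u) auto
  then show ?thesis
    using t(1) by (simp add: scale_zero_right scale_scale unit_closed scale_one)
qed

lemma (in order_unit_space) scale_unit_mono:
  assumes "s \<le> t"
  shows "le V (scale V s (unit V)) (scale V t (unit V))"
proof -
  let ?u = "\<lambda>c. scale V c (unit V)"
  have u: "?u c \<in> carrier V" for c
    by (rule scale_closed[OF unit_closed])
  have "le V (scale V (t - s) (zero V)) (?u (t - s))"
    using assms by (intro le_scale zero_closed unit_closed unit_nonneg) auto
  moreover have "scale V (t - s) (zero V) = zero V"
    using scale_scale[OF zero_closed, of "t - s" 0] by (simp add: scale_zero zero_closed)
  ultimately have "le V (add V (zero V) (?u s)) (add V (?u (t - s)) (?u s))"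
    using le_add[OF zero_closed u u] by simp
  then show ?thesis
    using scale_add_left[OF unit_closed, of "t - s" s] add_zero[OF u] add_commute[OF zero_closed u] by simp
qed

lemma ous_sum_simps [simp]:
  "carrier (ous_sum V W) = carrier V \<times> carrier W"
  "add (ous_sum V W) x y = (add V (fst x) (fst y), add W (snd x) (snd y))"
  "zero (ous_sum V W) = (zero V, zero W)"
  "scale (ous_sum V W) c x = (scale V c (fst x), scale W c (snd x))"
  "le (ous_sum V W) x y \<longleftrightarrow> le V (fst x) (fst y) \<and> le W (snd x) (snd y)"
  "unit (ous_sum V W) = (unit V, unit W)"
  by (simp_all add: ous_sum_def)

lemma order_unit_space_sum:
  assumes "order_unit_space V" "order_unit_space W"
  shows "order_unit_space (ous_sum V W)"
proof -
  interpret V: order_unit_space V by fact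
  interpret W: order_unit_space W by fact
  show ?thesis
  proof
    show "\<exists>t>0. le (ous_sum V W) (scale (ous_sum V W) (- t) (unit (ous_sum V W))) x \<and>
        le (ous_sum V W) x (scale (ous_sum V W) t (unit (ous_sum V W)))"
      if x: "x \<in> carrier (ous_sum V W)" for x
    proof -
      have xs: "fst x \<in> carrier V" "snd x \<in> carrier W"
        using x by auto
      obtain s where s: "0 < s" "le V (scale V (- s) (unit V)) (fst x)" "le V (fst x) (scale V s (unit V))"
        using V.order_unit[OF xs(1)] by blast
      obtain t where t: "0 < t" "le W (scale W (- t) (unit W)) (snd x)" "le W (snd x) (scale W t (unit W))"
        using W.order_unit[OF xs(2)] by blast
      let ?m = "max s t"
      have "le V (scale V (- ?m) (unit V)) (fst x)" "le V (fst x) (scale V ?m (unit V))"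
        using V.le_trans[OF _ _ _ V.scale_unit_mono[of "- ?m" "- s"] s(2)]
          V.le_trans[OF _ _ _ s(3) V.scale_unit_mono[of s ?m]]
        by (simp_all add: V.scale_closed V.unit_closed xs)
      moreover have "le W (scale W (- ?m) (unit W)) (snd x)" "le W (snd x) (scale W ?m (unit W))"
        using W.le_trans[OF _ _ _ W.scale_unit_mono[of "- ?m" "- t"] t(2)]
          W.le_trans[OF _ _ _ t(3) W.scale_unit_mono[of t ?m]]
        by (simp_all add: W.scale_closed W.unit_closed xs)
      ultimately show ?thesis
        using s(1) by (intro exI[of _ ?m]) (simp add: less_max_iff_disj)
    qed
    show "\<exists>y\<in>carrier (ous_sum V W). add (ous_sum V W) x y = zero (ous_sum V W)"
      if x: "x \<in> carrier (ous_sum V W)" for x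
    proof -
      obtain y z where "y \<in> carrier V" "add V (fst x) y = zero V" "z \<in> carrier W" "add W (snd x) z = zero W"
        using x V.add_inverse[of "fst x"] W.add_inverse[of "snd x"] by fastforce
      then show ?thesis
        by (intro bexI[of _ "(y, z)"]) auto
    qed
    show "le (ous_sum V W) x z"
      if "x \<in> carrier (ous_sum V W)" "y \<in> carrier (ous_sum V W)" "z \<in> carrier (ous_sum V W)"
        "le (ous_sum V W) x y" "le (ous_sum V W) y z" for x y z
      using that V.le_trans[of "fst x" "fst y" "fst z"] W.le_trans[of "snd x" "snd y" "snd z"]
      by auto
    show "le (ous_sum V W) x (zero (ous_sum V W))" if x: "x \<in> carrier (ous_sum V W)"
      and le: "\<And>t. 0 < t \<Longrightarrow> le (ous_sum V W) x (scale (ous_sum V W) t (unit (ous_sum V W)))" for x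
      using x le V.archimedean[of "fst x"] W.archimedean[of "snd x"] by auto
    show "x = y" if "x \<in> carrier (ous_sum V W)" "y \<in> carrier (ous_sum V W)"
      "le (ous_sum V W) x y" "le (ous_sum V W) y x" for x y
      using that V.le_antisym[of "fst x" "fst y"] W.le_antisym[of "snd x" "snd y"] by auto
    show "add (ous_sum V W) x y = add (ous_sum V W) y x"
      if "x \<in> carrier (ous_sum V W)" "y \<in> carrier (ous_sum V W)" for x y
      using that V.add_commute[of "fst x" "fst y"] W.add_commute[of "snd x" "snd y"] by auto
  qed (auto simp: V.add_closed W.add_closed V.zero_closed W.zero_closed V.scale_closed W.scale_closed
      V.add_assoc W.add_assoc V.add_zero W.add_zero V.scale_add_right W.scale_add_right
      V.scale_add_left W.scale_add_left V.scale_scale W.scale_scale V.scale_one W.scale_one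
      V.le_refl W.le_refl V.le_add W.le_add V.le_scale W.le_scale V.unit_closed W.unit_closed)
qed

lemma ous_norm_sum_sa:
  assumes B: "cstar_subalgebra B" and C: "cstar_subalgebra C" and x: "x \<in> sa B" and y: "y \<in> sa C"
  shows "ous_norm (ous_sum (sa_ous B) (sa_ous C)) (x, y) = max (norm x) (norm y)"
proof -
  let ?V = "ous_sum (sa_ous B) (sa_ous C)"
  have "ous_norm ?V (x, y) = Inf {t. 0 < t \<and> max (norm x) (norm y) \<le> t}"
    unfolding ous_norm_def
  proof (rule arg_cong[where f = Inf], rule Collect_cong, rule conj_cong[OF refl])
    fix t :: real assume "0 < t"
    then show "le ?V
          (scale ?V (- t) (unit ?V)) (x, y) \<and>
        le ?V (x, y)
          (scale ?V t (unit ?V)) \<longleftrightarrow>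
        max (norm x) (norm y) \<le> t"
      unfolding ous_sum_simps fst_conv snd_conv max.bounded_iff
      using order_unit_bounds_sa_iff[OF B x, of t] order_unit_bounds_sa_iff[OF C y, of t] by fastforce
  qed
  also have "\<dots> = max (norm x) (norm y)"
    by (rule Inf_pos_ge) (simp add: le_max_iff_disj)
  finally show ?thesis .
qed

lemma normed_order_unit_space_sum_sa:
  assumes B: "cstar_subalgebra (B::'a::unital_cstar_algebra set)" and C: "cstar_subalgebra (C::'a set)"
  shows "normed_order_unit_space (ous_sum (sa_ous B) (sa_ous C))"
proof -
  let ?V = "ous_sum (sa_ous B) (sa_ous C)"
  interpret order_unit_space ?V
    by (intro order_unit_space_sum order_unit_space_sa B C)
  show ?thesis
  proof
    show "complete (carrier ?V)"
      by (simp add: complete_eq_closed closed_Times closed_sa B C)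
    show "ous_norm ?V p \<le> norm p"
      if "p \<in> carrier ?V" for p
      using that norm_fst_le[of "fst p" "snd p"] norm_snd_le[of "snd p" "fst p"]
      by (auto simp: ous_norm_sum_sa[OF B C])
    show "norm p \<le> 2 * ous_norm ?V p"
      if "p \<in> carrier ?V" for p
      using that norm_Pair_le[of "fst p" "snd p"] by (auto simp: ous_norm_sum_sa[OF B C])
    show "ous_norm ?V (p + q)
        \<le> ous_norm ?V p + ous_norm ?V q"
      if pq: "p \<in> carrier ?V" "q \<in> carrier ?V" for p q
    proof -
      obtain a b c d where "p = (a, b)" "q = (c, d)"
        by (metis surj_pair)
      moreover from this pq have "a \<in> sa B" "b \<in> sa C" "c \<in> sa B" "d \<in> sa C"
        by auto
      moreover have "max (norm (a + c)) (norm (b + d)) \<le> max (norm a) (norm b) + max (norm c) (norm d)"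
        using norm_triangle_ineq[of a c] norm_triangle_ineq[of b d] by linarith
      ultimately show ?thesis
        by (simp only: add_Pair ous_norm_sum_sa[OF B C] sa_closed(3)[OF B] sa_closed(3)[OF C])
    qed
  qed (auto simp: ous_norm_sum_sa[OF B C] sa_closed[OF B] sa_closed[OF C] fun_eq_iff zero_prod_def)
qed

section \<open>Lipschitz selections of a tower\<close>

locale lip_tower =
  fixes A :: "nat \<Rightarrow> 'a::unital_cstar_algebra set"
    and L :: "nat \<Rightarrow> 'a \<Rightarrow> ennreal"
    and \<beta> :: "nat \<Rightarrow> real"
  assumes subalg: "\<And>n. cstar_subalgebra (A n)"
    and incr: "\<And>n. A n \<subseteq> A (Suc n)"
    and dense: "closure (\<Union>n. A n) = UNIV"
    and lip: "\<And>n. quantum_metric_ous (sa_ous (A n)) (L n)"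
    and lip_decr: "\<And>n a. a \<in> sa (A n) \<Longrightarrow> L (Suc n) a \<le> L n a"
    and beta_pos: "\<And>n. 0 < \<beta> n"
    and beta_summable: "summable \<beta>"
    and bridge: "\<And>n. evident_bridge_length (A n) (L n) (A (Suc n)) (L (Suc n)) \<le> ennreal (\<beta> n)"
begin

abbreviation level_ball :: "nat \<Rightarrow> 'a set" where
  "level_ball n \<equiv> lip_ball (sa_ous (A n)) (L n)"

abbreviation E :: "(nat \<Rightarrow> 'a \<times> 'a) set" where
  "E \<equiv> E_set A L \<beta>"

abbreviation J :: "(nat \<Rightarrow> 'a \<times> 'a) set" where
  "J \<equiv> J_set A L \<beta>"

abbreviation E_sp :: "(nat \<Rightarrow> 'a \<times> 'a) ous" where
  "E_sp \<equiv> E_space A L \<beta>"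

abbreviation F_sp :: "(nat \<Rightarrow> 'a \<times> 'a) set ous" where
  "F_sp \<equiv> F_space A L \<beta>"

abbreviation cls :: "(nat \<Rightarrow> 'a \<times> 'a) \<Rightarrow> (nat \<Rightarrow> 'a \<times> 'a) set" where
  "cls \<equiv> coset E_sp J"

lemmas in_sa = sa_closed[OF subalg]
lemmas in_sa_UNIV = sa_closed[OF cstar_subalgebra_UNIV]

lemma sa_mono: "m \<le> n \<Longrightarrow> sa (A m) \<subseteq> sa (A n)"
  using lift_Suc_mono_le[of A m n] incr by (auto simp: sa_def)

lemma sa_UNIV: "x \<in> sa (A n) \<Longrightarrow> x \<in> sa UNIV"
  by (auto simp: sa_def)

lemma L_add: "x \<in> sa (A n) \<Longrightarrow> y \<in> sa (A n) \<Longrightarrow> L n (x + y) \<le> L n x + L n y"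
  using quantum_metric_ousD(2)[OF lip] by simp

lemma L_scale: "x \<in> sa (A n) \<Longrightarrow> L n (c *\<^sub>R x) = ennreal \<bar>c\<bar> * L n x"
  using quantum_metric_ousD(3)[OF lip] by simp

lemma L_eq_0_iff: "x \<in> sa (A n) \<Longrightarrow> L n x = 0 \<longleftrightarrow> x \<in> range (\<lambda>c. c *\<^sub>R 1)"
  using quantum_metric_ousD(5)[OF lip, of n] by (auto simp: set_eq_iff)

lemma L_scalar: "L n (c *\<^sub>R 1) = 0"
  using L_eq_0_iff[of "c *\<^sub>R 1" n] in_sa by blast

lemma L_zero: "L n 0 = 0"
  using L_scalar[of n 0] by simp

lemma L_antimono: "m \<le> n \<Longrightarrow> a \<in> sa (A m) \<Longrightarrow> L n a \<le> L m a"
proof (induction n rule: dec_induct)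
  case (step k)
  then have "a \<in> sa (A k)"
    using sa_mono by blast
  with step show ?case
    using lip_decr order_trans by blast
qed simp

lemma L_scale_le:
  assumes "x \<in> sa (A n)" "L n x \<le> ennreal c"
  shows "L n (s *\<^sub>R x) \<le> ennreal (\<bar>s\<bar> * c)"
proof -
  have "L n (s *\<^sub>R x) \<le> ennreal \<bar>s\<bar> * ennreal c"
    unfolding L_scale[OF assms(1)] by (rule mult_left_mono[OF assms(2)]) simp
  then show ?thesis
    by (simp add: ennreal_mult')
qed

lemma closed_lip_ball: "closed (level_ball n)"
proof -
  interpret V: normed_order_unit_space "sa_ous (A n)"
    by (rule normed_order_unit_space_sa[OF subalg])
  show ?thesis
    using quantum_metric_ousD(9)[OF lip, of n] complete_imp_closed[OF V.complete_carrier]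
    unfolding V.mtopology_eq by (rule closedin_closed_trans)
qed

lemma dom_dense:
  assumes "x \<in> sa (A n)" "0 < e"
  shows "\<exists>y\<in>sa (A n). L n y < \<infinity> \<and> norm (y - x) < e"
proof -
  interpret V: normed_order_unit_space "sa_ous (A n)"
    by (rule normed_order_unit_space_sa[OF subalg])
  have "sa (A n) \<subseteq> closure (dom_of (sa_ous (A n)) (L n))"
    using quantum_metric_ousD(4)[OF lip, of n] closure_mono[of "sa (A n) \<inter> dom_of (sa_ous (A n)) (L n)" "dom_of (sa_ous (A n)) (L n)"]
    unfolding V.mtopology_eq closure_of_subtopology by auto
  with assms have "\<exists>y\<in>dom_of (sa_ous (A n)) (L n). dist y x < e"
    by (auto simp: closure_approachable)
  then show ?thesis
    by (auto simp: dom_of_def dist_norm)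
qed

lemma lip_ball_level:
  shows compact_lip_ball: "compact {x \<in> level_ball n. norm x \<le> R}"
    and bounded_lip_ball: "\<exists>R\<^sub>0. \<forall>x\<in>level_ball n. \<exists>c. norm (x - c *\<^sub>R 1) \<le> R\<^sub>0"
proof -
  interpret V: normed_order_unit_space "sa_ous (A n)"
    by (rule normed_order_unit_space_sa[OF subalg])
  have "norm x \<le> t" if "x \<in> carrier (sa_ous (A n))" "0 \<le> t" "\<And>\<phi>. \<phi> \<in> states (sa_ous (A n)) \<Longrightarrow> \<bar>\<phi> x\<bar> \<le> t" for x t
    by (rule norming_sa[OF subalg that(1)[unfolded sa_ous_simps] that(2)]) (rule that(3))
  note compact = V.lip_ball_compact_mod_scalars[OF lip this]
  show "compact {x \<in> level_ball n. norm x \<le> R}"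
    by (rule compact(1))
  show "\<exists>R\<^sub>0. \<forall>x\<in>level_ball n. \<exists>c. norm (x - c *\<^sub>R 1) \<le> R\<^sub>0"
    using compact(2) unfolding sa_ous_simps .
qed

text \<open>
  An element of \<open>\<KK>\<close> is determined by one sequence \<open>x\<close> with \<open>x n\<close> in the \<open>n\<close>-th algebra, its \<open>n\<close>-th entry being the
  pair of \<open>x n\<close> and \<open>x (n + 1)\<close>. All arguments are carried out on the level of these selections.
\<close>

definition selection :: "(nat \<Rightarrow> 'a) \<Rightarrow> bool" where
  "selection x \<longleftrightarrow> (\<forall>n. x n \<in> sa (A n))"

definition pairs :: "(nat \<Rightarrow> 'a) \<Rightarrow> nat \<Rightarrow> 'a \<times> 'a" where
  "pairs x n = (x n, x (Suc n))"

text \<open>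
  The class in the quotient that corresponds to \<open>a\<close>: all representatives of sequences converging to \<open>a\<close>.
\<close>

definition fiber :: "'a \<Rightarrow> (nat \<Rightarrow> 'a \<times> 'a) set" where
  "fiber a = pairs ` {x. selection x \<and> x \<longlonglongrightarrow> a}"

text \<open>
  The condition \<open>S\<^sub>0 \<le> c\<close>, written for selections.
\<close>

definition lip_path :: "real \<Rightarrow> (nat \<Rightarrow> 'a) \<Rightarrow> bool" where
  "lip_path c x \<longleftrightarrow> selection x \<and> (\<forall>n. L n (x n) \<le> ennreal c \<and> norm (x n - x (Suc n)) \<le> c * (2 * \<beta> n))"

text \<open>
  A bound for the length that remains for a path of constant \<open>1\<close> from time \<open>n\<close> on.
\<close>

definition tail :: "nat \<Rightarrow> real" where
  "tail n = 2 * (\<Sum>j. \<beta> (n + j))"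

lemma summable_beta_shift: "summable (\<lambda>j. \<beta> (n + j))"
  using beta_summable summable_iff_shift[of \<beta> n] by (simp add: add.commute)

lemma tail_Suc: "tail n = 2 * \<beta> n + tail (Suc n)"
  using suminf_split_head[OF summable_beta_shift[of n]] by (simp add: tail_def)

lemma tail_pos: "0 < tail n"
  unfolding tail_def using suminf_pos[OF summable_beta_shift[of n]] beta_pos by simp

lemma tail_tendsto_0: "tail \<longlonglongrightarrow> 0"
proof -
  have "(\<Sum>j. \<beta> (n + j)) = suminf \<beta> - sum \<beta> {..<n}" for n
    using suminf_minus_initial_segment[OF beta_summable, of n] by (simp add: add.commute)
  then have "tail = (\<lambda>n. 2 * (suminf \<beta> - sum \<beta> {..<n}))"
    by (simp add: tail_def fun_eq_iff)
  moreover have "(\<lambda>n. 2 * (suminf \<beta> - sum \<beta> {..<n})) \<longlonglongrightarrow> 2 * (suminf \<beta> - suminf \<beta>)"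
    by (intro tendsto_intros summable_LIMSEQ beta_summable)
  ultimately show ?thesis
    by simp
qed

lemma lip_pathD:
  assumes "lip_path c x"
  shows "selection x" "x n \<in> sa (A n)" "L n (x n) \<le> ennreal c" "norm (x n - x (Suc n)) \<le> c * (2 * \<beta> n)"
  using assms by (auto simp: lip_path_def selection_def)

lemma lip_path_nonneg: "lip_path c x \<Longrightarrow> 0 \<le> c"
  using lip_pathD(4)[of c x 0] beta_pos[of 0] norm_ge_zero[of "x 0 - x (Suc 0)"]
  by (metis mult_pos_pos order_trans zero_le_mult_iff zero_less_numeral not_less)

lemma lip_path_dist_le:
  assumes x: "lip_path c x"
  shows "norm (x n - x (n + k)) \<le> c * (tail n - tail (n + k))"
proof (induction k)
  case (Suc k)
  have "norm (x n - x (n + Suc k)) \<le> norm (x n - x (n + k)) + norm (x (n + k) - x (Suc (n + k)))"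
    using norm_triangle_ineq[of "x n - x (n + k)" "x (n + k) - x (Suc (n + k))"] by simp
  also have "\<dots> \<le> c * (tail n - tail (n + k)) + c * (2 * \<beta> (n + k))"
    by (intro add_mono Suc lip_pathD(4)[OF x])
  also have "\<dots> = c * (tail n - tail (n + Suc k))"
    using tail_Suc[of "n + k"] by (simp add: algebra_simps)
  finally show ?case .
qed simp

lemma lip_path_dist_tail:
  assumes x: "lip_path c x"
  shows "norm (x n - x (n + k)) \<le> c * tail n"
proof -
  have "c * (tail n - tail (n + k)) \<le> c * tail n"
    using lip_path_nonneg[OF x] tail_pos[of "n + k"] by (intro mult_left_mono) auto
  with lip_path_dist_le[OF x, of n k] show ?thesis
    by (rule order_trans)
qed

lemma lip_path_convergent:
  assumes x: "lip_path c x"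
  shows "convergent x"
proof -
  have "Cauchy x"
  proof (rule CauchyI')
    fix e :: real assume e: "0 < e"
    have "(\<lambda>n. c * tail n) \<longlonglongrightarrow> c * 0"
      by (intro tendsto_intros tail_tendsto_0)
    then have "\<forall>\<^sub>F n in sequentially. c * tail n < e"
      using e by (intro order_tendstoD) auto
    then obtain N where N: "\<And>n. N \<le> n \<Longrightarrow> c * tail n < e"
      by (auto simp: eventually_sequentially)
    have "dist (x m) (x n) < e" if "N \<le> m" "m < n" for m n
      using lip_path_dist_tail[OF x, of m "n - m"] N[OF that(1)] that(2) by (simp add: dist_norm)
    then show "\<exists>M. \<forall>m\<ge>M. \<forall>n>m. dist (x m) (x n) < e"
      by blast
  qed
  then show ?thesis
    by (simp add: Cauchy_convergent_iff)
qed

lemma lip_path_limit_dist: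
  assumes x: "lip_path c x" and a: "x \<longlonglongrightarrow> a"
  shows "norm (x n - a) \<le> c * tail n"
proof (rule tendsto_upperbound)
  show "(\<lambda>k. norm (x n - x (n + k))) \<longlonglongrightarrow> norm (x n - a)"
    using LIMSEQ_ignore_initial_segment[OF a, of n] by (intro tendsto_intros) (simp add: add.commute)
  show "\<forall>\<^sub>F k in sequentially. norm (x n - x (n + k)) \<le> c * tail n"
    using lip_path_dist_tail[OF x] by simp
qed simp

lemma selection_limit_sa: "selection x \<Longrightarrow> x \<longlonglongrightarrow> a \<Longrightarrow> a \<in> sa UNIV"
  using closed_sequentially[OF closed_sa[OF cstar_subalgebra_UNIV], of x a]
  by (auto simp: selection_def intro: sa_UNIV)

lemma lip_path_scale:
  assumes x: "lip_path c x"
  shows "lip_path (\<bar>s\<bar> * c) (\<lambda>n. s *\<^sub>R x n)"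
  unfolding lip_path_def selection_def
proof (intro conjI allI)
  fix n
  show "s *\<^sub>R x n \<in> sa (A n)"
    by (intro in_sa lip_pathD[OF x])
  show "L n (s *\<^sub>R x n) \<le> ennreal (\<bar>s\<bar> * c)"
    by (intro L_scale_le lip_pathD[OF x])
  have "norm (s *\<^sub>R x n - s *\<^sub>R x (Suc n)) = \<bar>s\<bar> * norm (x n - x (Suc n))"
    by (simp flip: scaleR_right_diff_distrib)
  also have "\<dots> \<le> \<bar>s\<bar> * (c * (2 * \<beta> n))"
    by (intro mult_left_mono lip_pathD[OF x]) simp
  finally show "norm (s *\<^sub>R x n - s *\<^sub>R x (Suc n)) \<le> \<bar>s\<bar> * c * (2 * \<beta> n)"
    by (simp add: mult.assoc)
qed

lemma lip_path_add:
  assumes x: "lip_path c x" and y: "lip_path d y"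
  shows "lip_path (c + d) (\<lambda>n. x n + y n)"
  unfolding lip_path_def selection_def
proof (intro conjI allI)
  fix n
  show "x n + y n \<in> sa (A n)"
    by (intro in_sa lip_pathD[OF x] lip_pathD[OF y])
  have "L n (x n + y n) \<le> ennreal c + ennreal d"
    using L_add[of "x n" n "y n"] add_mono[OF lip_pathD(3)[OF x] lip_pathD(3)[OF y]]
      lip_pathD(2)[OF x] lip_pathD(2)[OF y] order_trans by blast
  then show "L n (x n + y n) \<le> ennreal (c + d)"
    using lip_path_nonneg[OF x] lip_path_nonneg[OF y] by simp
  have "norm ((x n - x (Suc n)) + (y n - y (Suc n))) \<le> c * (2 * \<beta> n) + d * (2 * \<beta> n)"
    by (rule norm_triangle_mono) (rule lip_pathD[OF x] lip_pathD[OF y])+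
  then show "norm (x n + y n - (x (Suc n) + y (Suc n))) \<le> (c + d) * (2 * \<beta> n)"
    by (simp add: algebra_simps)
qed

text \<open>
  Such a path has only finitely many jumps, and the Lip-norms do not increase along its constant part. These paths
  are plentiful enough to approximate all convergent selections uniformly.
\<close>

lemma eventually_constant_lip_path:
  assumes y: "selection y" and const: "\<And>m. N \<le> m \<Longrightarrow> y m = y N" and fin: "\<And>m. m \<le> N \<Longrightarrow> L m (y m) < \<infinity>"
  shows "\<exists>c. lip_path c y"
proof -
  define c where "c = (\<Sum>m\<le>N. enn2real (L m (y m))) + (\<Sum>m<N. norm (y m - y (Suc m)) / (2 * \<beta> m))"
  have nonneg: "0 \<le> norm (y m - y (Suc m)) / (2 * \<beta> m)" for m
    using beta_pos[of m] by simp
  have L_le: "enn2real (L m (y m)) \<le> c" if "m \<le> N" for m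
  proof -
    have "enn2real (L m (y m)) \<le> (\<Sum>m\<le>N. enn2real (L m (y m)))"
      using that by (intro member_le_sum) auto
    moreover have "0 \<le> (\<Sum>m<N. norm (y m - y (Suc m)) / (2 * \<beta> m))"
      by (intro sum_nonneg nonneg)
    ultimately show ?thesis
      unfolding c_def by linarith
  qed
  have jump_le: "norm (y m - y (Suc m)) / (2 * \<beta> m) \<le> c" if "m < N" for m
  proof -
    have "norm (y m - y (Suc m)) / (2 * \<beta> m) \<le> (\<Sum>m<N. norm (y m - y (Suc m)) / (2 * \<beta> m))"
      using that nonneg by (intro member_le_sum) auto
    moreover have "0 \<le> (\<Sum>m\<le>N. enn2real (L m (y m)))"
      by (intro sum_nonneg enn2real_nonneg)
    ultimately show ?thesis
      unfolding c_def by linarith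
  qed
  have c: "0 \<le> c"
    by (rule order_trans[OF enn2real_nonneg L_le[of 0]]) simp
  have L_bound: "L m (y m) \<le> ennreal c" if "m \<le> N" for m
  proof -
    have "L m (y m) = ennreal (enn2real (L m (y m)))"
      using fin[OF that] by simp
    also have "\<dots> \<le> ennreal c"
      by (rule ennreal_leI[OF L_le[OF that]])
    finally show ?thesis .
  qed
  have "L m (y m) \<le> ennreal c" for m
  proof (cases "m \<le> N")
    case False
    then have "L m (y N) \<le> L N (y N)"
      using y by (intro L_antimono) (auto simp: selection_def)
    also have "\<dots> \<le> ennreal c"
      by (rule L_bound) simp
    finally show ?thesis
      using const[of m] False by simp
  qed (rule L_bound)
  moreover have "norm (y m - y (Suc m)) \<le> c * (2 * \<beta> m)" for m
  proof (cases "m < N")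
    case True
    then show ?thesis
      using jump_le[OF True] beta_pos[of m] by (simp add: divide_le_eq)
  next
    case False
    then show ?thesis
      using const[of m] const[of "Suc m"] c beta_pos[of m] by simp
  qed
  ultimately show ?thesis
    using y by (auto simp: lip_path_def)
qed

lemma selection_exists:
  assumes a: "a \<in> sa UNIV"
  shows "\<exists>x. selection x \<and> x \<longlonglongrightarrow> a"
proof -
  have "\<exists>x. x \<in> sa (A n) \<and> dist a x < infdist a (sa (A n)) + 1 / real (Suc n)" for n
  proof (rule ccontr)
    assume no: "\<not> ?thesis"
    have ne: "sa (A n) \<noteq> {}"
      using in_sa(1) by blast
    have "infdist a (sa (A n)) + 1 / real (Suc n) \<le> (INF x\<in>sa (A n). dist a x)"
      using no by (intro cINF_greatest ne) (meson not_less)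
    then show False
      unfolding infdist_notempty[OF ne] by simp
  qed
  then obtain x where x: "\<And>n. x n \<in> sa (A n)" "\<And>n. dist a (x n) < infdist a (sa (A n)) + 1 / real (Suc n)"
    by metis
  have "(\<lambda>n. infdist a (sa (A n))) \<longlonglongrightarrow> 0"
  proof (rule LIMSEQ_I)
    fix e :: real assume e: "0 < e"
    have "a \<in> closure (\<Union>n. A n)"
      using dense by simp
    then have "\<exists>b\<in>(\<Union>n. A n). norm (b - a) < e"
      using e by (simp only: closure_approachable dist_norm)
    then obtain b N where b: "b \<in> A N" "norm (b - a) < e"
      by blast
    let ?b = "(1/2) *\<^sub>R (b + star b)"
    have "?b \<in> sa (A N)"
      using b(1) cstar_subalgebraD(4,7,8)[OF subalg, of _ N]
      by (simp add: sa_def star_scaleR star_add star_star add.commute)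
    have "?b - a = (1/2) *\<^sub>R (b - a) + (1/2) *\<^sub>R star (b - a)"
    proof -
      have half: "(1/2) *\<^sub>R a + (1/2) *\<^sub>R a = a"
        by (simp flip: scaleR_add_left)
      have "?b - ((1/2) *\<^sub>R a + (1/2) *\<^sub>R a) = (1/2) *\<^sub>R (b - a) + (1/2) *\<^sub>R star (b - a)"
        by (simp add: star_diff saD(2)[OF a] scaleR_right_distrib scaleR_right_diff_distrib)
      then show ?thesis
        unfolding half .
    qed
    then have "norm (?b - a) \<le> (1/2) * norm (b - a) + (1/2) * norm (star (b - a))"
      using norm_triangle_ineq[of "(1/2) *\<^sub>R (b - a)" "(1/2) *\<^sub>R star (b - a)"] by simp
    then have "norm (?b - a) < e"
      using b(2) unfolding norm_star by linarith
    then have lt: "dist a ?b < e"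
      unfolding dist_norm norm_minus_commute[of a] .
    have "infdist a (sa (A n)) \<le> dist a ?b" if "N \<le> n" for n
      by (rule infdist_le) (use sa_mono[OF that] \<open>?b \<in> sa (A N)\<close> in blast)
    from le_less_trans[OF this lt] have "infdist a (sa (A n)) < e" if "N \<le> n" for n
      using that .
    then have "norm (infdist a (sa (A n)) - 0) < e" if "N \<le> n" for n
      using that by (simp add: infdist_nonneg)
    then show "\<exists>no. \<forall>n\<ge>no. norm (infdist a (sa (A n)) - 0) < e"
      by blast
  qed
  then have lim: "(\<lambda>n. infdist a (sa (A n)) + 1 / real (Suc n)) \<longlonglongrightarrow> 0 + 0"
    by (intro tendsto_add LIMSEQ_Suc[OF lim_1_over_n])
  have "(\<lambda>n. dist (x n) a) \<longlonglongrightarrow> 0"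
  proof (rule tendsto_sandwich[OF _ _ tendsto_const])
    show "\<forall>\<^sub>F n in sequentially. dist (x n) a \<le> infdist a (sa (A n)) + 1 / real (Suc n)"
      using x(2) by (intro always_eventually allI less_imp_le) (simp only: dist_commute[of _ a])
    show "(\<lambda>n. infdist a (sa (A n)) + 1 / real (Suc n)) \<longlonglongrightarrow> 0"
      using lim by simp
  qed simp
  then have "x \<longlonglongrightarrow> a"
    unfolding tendsto_dist_iff[of x a] .
  with x(1) show ?thesis
    by (auto simp: selection_def)
qed


section \<open>The limit space as the space of limits of selections\<close>

lemma pairs_eq_iff: "pairs x = pairs y \<longleftrightarrow> x = y"
  by (metis ext fst_conv pairs_def)

lemma carrier_D_space: "p \<in> carrier (D_space A n) \<longleftrightarrow> fst p \<in> sa (A n) \<and> snd p \<in> sa (A (Suc n))"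
  by (cases p) (simp add: D_space_def)

lemma max_norm_triangle: "max_norm (p - q) \<le> max_norm p + max_norm (q :: 'a \<times> 'a)"
  using norm_triangle_ineq4[of "fst p" "fst q"] norm_triangle_ineq4[of "snd p" "snd q"]
  unfolding max_norm_def fst_diff snd_diff by linarith

lemma bdd_above_diff:
  assumes "d \<in> B_set A" "e \<in> B_set A"
  shows "bdd_above (range (\<lambda>n. max_norm (d n - e n)))"
proof -
  obtain M N where M: "\<And>n. max_norm (d n) \<le> M" and N: "\<And>n. max_norm (e n) \<le> N"
    using assms by (auto simp: B_set_def bdd_above_def)
  have "max_norm (d n - e n) \<le> M + N" for n
    using max_norm_triangle[of "d n" "e n"] M[of n] N[of n] by linarith
  then show ?thesis
    by (intro bdd_aboveI2)
qed

lemma pairs_in_B_set: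
  assumes x: "selection x" "convergent x"
  shows "pairs x \<in> B_set A"
proof -
  obtain M where M: "\<And>n. norm (x n) \<le> M"
    using convergent_imp_Bseq[OF x(2)] by (auto simp: Bseq_def)
  have "max_norm (pairs x n) \<le> M" for n
    using M[of n] M[of "Suc n"] by (simp add: pairs_def max_norm_def)
  then have "bdd_above (range (\<lambda>n. max_norm (pairs x n)))"
    by (intro bdd_aboveI2)
  then show ?thesis
    using x(1) by (simp add: B_set_def carrier_D_space pairs_def selection_def)
qed

lemma pairs_in_K_set: "selection x \<Longrightarrow> convergent x \<Longrightarrow> pairs x \<in> K_set A"
  using pairs_in_B_set by (simp add: K_set_def pairs_def)

lemma K_setE:
  assumes "d \<in> K_set A"
  obtains x where "selection x" "d = pairs x"
proof
  let ?x = "\<lambda>n. fst (d n)"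
  show "selection ?x"
    using assms by (simp add: K_set_def B_set_def carrier_D_space selection_def)
  show "d = pairs ?x"
    using assms by (auto simp: K_set_def pairs_def fun_eq_iff prod_eq_iff)
qed

lemma S0_le_iff:
  assumes x: "selection x" and c: "0 \<le> c"
  shows "S0 L \<beta> (pairs x) \<le> ennreal c \<longleftrightarrow> lip_path c x"
proof -
  have "norm (x n - x (Suc n)) / (2 * \<beta> n) \<le> c \<longleftrightarrow> norm (x n - x (Suc n)) \<le> c * (2 * \<beta> n)" for n
    using beta_pos[of n] by (simp add: divide_le_eq)
  then have "S0 L \<beta> (pairs x) \<le> ennreal c \<longleftrightarrow>
      (\<forall>n. (L n (x n) \<le> ennreal c \<and> L (Suc n) (x (Suc n)) \<le> ennreal c) \<and>
        norm (x n - x (Suc n)) \<le> c * (2 * \<beta> n))"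
    using c by (simp add: S0_def SUP_le_iff D_lip_def pairs_def ennreal_le_iff)
  also have "\<dots> \<longleftrightarrow> lip_path c x"
    using x by (auto simp: lip_path_def)
  finally show ?thesis .
qed

lemma S0_finite_iff:
  assumes "selection x"
  shows "S0 L \<beta> (pairs x) < \<infinity> \<longleftrightarrow> (\<exists>c. lip_path c x)"
proof
  assume "S0 L \<beta> (pairs x) < \<infinity>"
  then obtain c where "0 \<le> c" "S0 L \<beta> (pairs x) = ennreal c"
    by (cases "S0 L \<beta> (pairs x)") auto
  then show "\<exists>c. lip_path c x"
    using S0_le_iff[OF assms, of c] by auto
next
  assume "\<exists>c. lip_path c x"
  then obtain c where "lip_path c x"
    by blast
  then have "S0 L \<beta> (pairs x) \<le> ennreal c"
    using S0_le_iff[OF assms lip_path_nonneg] by blast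
  then show "S0 L \<beta> (pairs x) < \<infinity>"
    by (rule order.strict_trans1) simp
qed

lemma L_set_eq: "L_set A L \<beta> = pairs ` {x. \<exists>c. lip_path c x}"
proof (intro set_eqI iffI)
  fix d assume d: "d \<in> L_set A L \<beta>"
  then obtain x where "selection x" "d = pairs x"
    using K_setE by (auto simp: L_set_def)
  then show "d \<in> pairs ` {x. \<exists>c. lip_path c x}"
    using d S0_finite_iff by (auto simp: L_set_def)
next
  fix d assume "d \<in> pairs ` {x. \<exists>c. lip_path c x}"
  then obtain x c where x: "lip_path c x" "d = pairs x"
    by auto
  then show "d \<in> L_set A L \<beta>"
    using pairs_in_K_set[OF lip_pathD(1) lip_path_convergent] S0_finite_iff[OF lip_pathD(1)[OF x(1)]]
    by (auto simp: L_set_def)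
qed

text \<open>
  A uniform limit of sequences of consecutive pairs of Cauchy selections is again of this kind.
\<close>

lemma E_set_subset: "E \<subseteq> pairs ` {x. selection x \<and> convergent x}"
proof
  fix d assume d: "d \<in> E"
  then have dB: "d \<in> B_set A"
    by (simp add: E_set_def)
  have near: "\<exists>y c. lip_path c y \<and> (\<forall>n. norm (fst (d n) - y n) < e \<and> norm (snd (d n) - y (Suc n)) < e)"
    if e: "0 < e" for e
  proof -
    obtain l where l: "l \<in> L_set A L \<beta>" "B_norm (\<lambda>n. d n - l n) < e"
      using d e by (auto simp: E_set_def)
    then obtain y c where y: "lip_path c y" "l = pairs y"
      by (auto simp: L_set_eq)
    have lB: "l \<in> B_set A"
      using l(1) by (simp add: L_set_def K_set_def)
    have "max_norm (d n - l n) < e" for n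
      using cSUP_upper[OF _ bdd_above_diff[OF dB lB], of n] l(2) by (simp add: B_norm_def)
    then have "norm (fst (d n) - y n) < e \<and> norm (snd (d n) - y (Suc n)) < e" for n
      unfolding y(2) by (simp add: max_norm_def pairs_def)
    with y(1) show ?thesis
      by blast
  qed
  define x where "x = (\<lambda>n. fst (d n))"
  have glue: "snd (d n) = x (Suc n)" for n
  proof (rule ccontr)
    assume "snd (d n) \<noteq> x (Suc n)"
    then have "0 < norm (snd (d n) - x (Suc n)) / 2"
      by simp
    from near[OF this] obtain y where
      "norm (x (Suc n) - y (Suc n)) < norm (snd (d n) - x (Suc n)) / 2"
      "norm (snd (d n) - y (Suc n)) < norm (snd (d n) - x (Suc n)) / 2"
      unfolding x_def by blast
    then show False
      using norm_triangle_ineq4[of "snd (d n) - y (Suc n)" "x (Suc n) - y (Suc n)"] by simp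
  qed
  then have dx: "d = pairs x"
    by (auto simp: x_def pairs_def fun_eq_iff prod_eq_iff)
  have sel: "selection x"
    using dB by (simp add: B_set_def carrier_D_space selection_def x_def)
  have "Cauchy x"
  proof (rule metric_CauchyI)
    fix e :: real assume e: "0 < e"
    then obtain y c where y: "lip_path c y" "\<And>n. norm (x n - y n) < e / 3"
      using near[of "e / 3"] unfolding x_def by auto
    have "Cauchy y"
      using lip_path_convergent[OF y(1)] by (simp add: Cauchy_convergent_iff)
    then obtain M where M: "\<And>m n. M \<le> m \<Longrightarrow> M \<le> n \<Longrightarrow> dist (y m) (y n) < e / 3"
      using e by (meson metric_CauchyD divide_pos_pos zero_less_numeral)
    have "dist (x m) (x n) < e" if "M \<le> m" "M \<le> n" for m n
    proof -
      have "dist (x m) (x n) \<le> dist (x m) (y m) + dist (y m) (y n) + dist (x n) (y n)"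
        using dist_triangle[of "x m" "x n" "y m"] dist_triangle2[of "y m" "x n" "y n"] by linarith
      then show ?thesis
        using M[OF that] y(2)[of m] y(2)[of n] by (simp add: dist_norm)
    qed
    then show "\<exists>M. \<forall>m\<ge>M. \<forall>n\<ge>M. dist (x m) (x n) < e"
      by blast
  qed
  then have "convergent x"
    by (simp add: Cauchy_convergent_iff)
  with sel dx show "d \<in> pairs ` {x. selection x \<and> convergent x}"
    by blast
qed

text \<open>
  A convergent selection is nearly constant from some \<open>N\<close> on. Moving its first entries into the dense domains of the
  Lip-norms and freezing it at time \<open>N\<close> gives a path of finite constant nearby.
\<close>

lemma pairs_in_E_set:
  assumes x: "selection x" "convergent x"
  shows "pairs x \<in> E"
  unfolding E_set_def
proof (intro CollectI conjI allI impI)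
  show xB: "pairs x \<in> B_set A"
    by (rule pairs_in_B_set[OF x])
  fix e :: real assume e: "0 < e"
  obtain N where N: "\<And>m. N \<le> m \<Longrightarrow> dist (x m) (x N) < e / 3"
    using x(2) e by (meson Cauchy_convergent_iff metric_CauchyD divide_pos_pos order.refl zero_less_numeral)
  have "\<exists>b. b \<in> sa (A m) \<and> L m b < \<infinity> \<and> norm (b - x m) < e / 3" for m
    using dom_dense[of "x m" m "e / 3"] x(1) e by (auto simp: selection_def)
  then obtain b where b: "\<And>m. b m \<in> sa (A m)" "\<And>m. L m (b m) < \<infinity>" "\<And>m. norm (b m - x m) < e / 3"
    by metis
  \<comment> \<open>Frozen at time \<open>N\<close>; the Lip-norms of the frozen entry do not increase.\<close>
  define y where "y = (\<lambda>m. b (min m N))"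
  have "selection y"
    using b(1) sa_mono[OF min.cobounded1] by (auto simp: selection_def y_def)
  then obtain c where c: "lip_path c y"
    using eventually_constant_lip_path[of y N] b(2) by (auto simp: y_def min_absorb1 min_absorb2)
  have close: "norm (x m - y m) \<le> 2 * (e / 3)" for m
  proof (cases "m \<le> N")
    case True
    then show ?thesis
      using b(3)[of m] e by (simp add: y_def min_absorb1 norm_minus_commute)
  next
    case False
    then have "norm (x m - y m) \<le> norm (x m - x N) + norm (x N - b N)"
      using norm_triangle_ineq[of "x m - x N" "x N - b N"] by (simp add: y_def min_absorb2)
    then show ?thesis
      using b(3)[of N] N[of m] False by (simp add: dist_norm norm_minus_commute)
  qed
  have "B_norm (\<lambda>n. pairs x n - pairs y n) \<le> 2 * (e / 3)"
    unfolding B_norm_def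
  proof (rule cSUP_least)
    show "max_norm (pairs x n - pairs y n) \<le> 2 * (e / 3)" for n
      using close[of n] close[of "Suc n"] by (simp add: max_norm_def pairs_def)
  qed simp
  also have "\<dots> < e"
    using e by simp
  finally show "\<exists>l\<in>L_set A L \<beta>. B_norm (\<lambda>n. pairs x n - l n) < e"
    using c by (intro bexI[of _ "pairs y"]) (auto simp: L_set_eq)
qed

lemma E_set_eq: "E = pairs ` {x. selection x \<and> convergent x}"
  using E_set_subset pairs_in_E_set by blast

lemma J_set_eq: "J = fiber 0"
proof -
  have null: "(\<lambda>n. max_norm (pairs x n)) \<longlonglongrightarrow> 0 \<longleftrightarrow> x \<longlonglongrightarrow> 0" for x :: "nat \<Rightarrow> 'a"
  proof
    assume l: "(\<lambda>n. max_norm (pairs x n)) \<longlonglongrightarrow> 0"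
    show "x \<longlonglongrightarrow> 0"
      by (rule Lim_null_comparison[OF _ l]) (simp add: max_norm_def pairs_def)
  next
    assume x: "x \<longlonglongrightarrow> 0"
    have "(\<lambda>n. max (norm (x n)) (norm (x (Suc n)))) \<longlonglongrightarrow> max (norm (0::'a)) (norm (0::'a))"
      by (intro tendsto_intros x LIMSEQ_Suc[OF x])
    then show "(\<lambda>n. max_norm (pairs x n)) \<longlonglongrightarrow> 0"
      by (simp add: max_norm_def pairs_def)
  qed
  show ?thesis
    unfolding J_set_def E_set_eq fiber_def using null by (auto simp: convergent_def)
qed

lemma E_space_simps:
  "carrier E_sp = E"
  "add E_sp (pairs x) (pairs y) = pairs (\<lambda>n. x n + y n)"
  "scale E_sp c (pairs x) = pairs (\<lambda>n. c *\<^sub>R x n)"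
  "zero E_sp = pairs (\<lambda>_. 0)"
  "unit E_sp = pairs (\<lambda>_. 1)"
  by (simp_all add: E_space_def D_space_def pairs_def fun_eq_iff)

lemma selection_simps:
  "selection x \<Longrightarrow> selection y \<Longrightarrow> selection (\<lambda>n. x n + y n)"
  "selection x \<Longrightarrow> selection y \<Longrightarrow> selection (\<lambda>n. x n - y n)"
  "selection x \<Longrightarrow> selection (\<lambda>n. c *\<^sub>R x n)"
  "selection (\<lambda>_. 0)" "selection (\<lambda>_. 1)"
  by (simp_all add: selection_def in_sa)

lemma E_space_le_iff:
  assumes "selection x" "selection y"
  shows "le E_sp (pairs x) (pairs y) \<longleftrightarrow> (\<forall>n. positive (y n - x n))"
  using assms saD(1)[of _ "A _"]
  by (auto simp: E_space_def D_space_def pairs_def selection_def le_sa_ous_iff[OF subalg])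

lemma fiberI: "selection x \<Longrightarrow> x \<longlonglongrightarrow> a \<Longrightarrow> pairs x \<in> fiber a"
  by (auto simp: fiber_def)

lemma coset_eq_fiber:
  assumes x: "selection x" "x \<longlonglongrightarrow> a"
  shows "cls (pairs x) = fiber a"
proof (intro set_eqI iffI)
  fix d assume "d \<in> cls (pairs x)"
  then obtain z where z: "selection z" "z \<longlonglongrightarrow> 0" "d = pairs (\<lambda>n. x n + z n)"
    by (auto simp: coset_def J_set_eq fiber_def E_space_simps)
  show "d \<in> fiber a"
    unfolding z(3) using tendsto_add[OF x(2) z(2)] by (intro fiberI selection_simps x z) simp
next
  fix d assume "d \<in> fiber a"
  then obtain y where y: "selection y" "y \<longlonglongrightarrow> a" "d = pairs y"
    by (auto simp: fiber_def)
  have "pairs (\<lambda>n. y n - x n) \<in> fiber 0"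
    using tendsto_diff[OF y(2) x(2)] by (intro fiberI selection_simps x y) simp
  moreover have "d = add E_sp (pairs x) (pairs (\<lambda>n. y n - x n))"
    by (simp add: E_space_simps y(3))
  ultimately show "d \<in> cls (pairs x)"
    by (auto simp: coset_def J_set_eq)
qed

lemma fiber_nonempty: "a \<in> sa UNIV \<Longrightarrow> \<exists>x. selection x \<and> x \<longlonglongrightarrow> a \<and> pairs x \<in> fiber a"
  using selection_exists fiberI by blast

lemma fiber_inj:
  assumes "a \<in> sa UNIV" "fiber a = fiber b"
  shows "a = b"
proof -
  obtain x where x: "x \<longlonglongrightarrow> a" "pairs x \<in> fiber b"
    using fiber_nonempty[OF assms(1)] assms(2) by blast
  then have "x \<longlonglongrightarrow> b"
    by (auto simp: fiber_def pairs_eq_iff)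
  with x(1) show ?thesis
    by (rule LIMSEQ_unique)
qed

lemma F_carrier: "carrier F_sp = fiber ` sa UNIV"
proof -
  have "carrier F_sp = cls ` E"
    by (simp add: F_space_def ous_quotient_def E_space_simps)
  also have "\<dots> = fiber ` sa UNIV"
  proof (intro set_eqI iffI)
    fix X assume "X \<in> cls ` E"
    then obtain x a where "selection x" "x \<longlonglongrightarrow> a" "X = cls (pairs x)"
      by (auto simp: E_set_eq convergent_def)
    then show "X \<in> fiber ` sa UNIV"
      using coset_eq_fiber selection_limit_sa by blast
  next
    fix X assume "X \<in> fiber ` sa UNIV"
    then obtain a x where "X = fiber a" "selection x" "x \<longlonglongrightarrow> a"
      using fiber_nonempty by blast
    then show "X \<in> cls ` E"
      using coset_eq_fiber[of x a] pairs_in_E_set[of x] by (auto simp: convergent_def)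
  qed
  finally show ?thesis .
qed

lemma quotient_add_fiber:
  assumes a: "a \<in> sa UNIV" and b: "b \<in> sa UNIV"
  shows "ous_quotient_add E_sp J (fiber a) (fiber b) = fiber (a + b)"
proof -
  have "cls (add E_sp d e) = fiber (a + b)"
    if de: "d \<in> fiber a" "e \<in> fiber b" for d e
  proof -
    obtain x y where x: "selection x" "x \<longlonglongrightarrow> a" "d = pairs x" and y: "selection y" "y \<longlonglongrightarrow> b" "e = pairs y"
      using de by (auto simp: fiber_def)
    show ?thesis
      unfolding x(3) y(3) E_space_simps
      by (intro coset_eq_fiber selection_simps x y tendsto_add)
  qed
  moreover have "fiber a \<noteq> {}" "fiber b \<noteq> {}"
    using fiber_nonempty a b by blast+
  ultimately show ?thesis
    unfolding ous_quotient_add_def by simp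
qed

lemma F_add: "a \<in> sa UNIV \<Longrightarrow> b \<in> sa UNIV \<Longrightarrow> add F_sp (fiber a) (fiber b) = fiber (a + b)"
  by (simp add: F_space_def ous_quotient_def quotient_add_fiber)

lemma F_scale:
  assumes a: "a \<in> sa UNIV"
  shows "scale F_sp c (fiber a) = fiber (c *\<^sub>R a)"
proof -
  have "cls (scale E_sp c d) = fiber (c *\<^sub>R a)"
    if d: "d \<in> fiber a" for d
  proof -
    obtain x where x: "selection x" "x \<longlonglongrightarrow> a" "d = pairs x"
      using d by (auto simp: fiber_def)
    show ?thesis
      unfolding x(3) E_space_simps
      by (intro coset_eq_fiber selection_simps x tendsto_scaleR tendsto_const)
  qed
  moreover have "fiber a \<noteq> {}"
    using fiber_nonempty a by blast
  ultimately show ?thesis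
    by (simp add: F_space_def ous_quotient_def)
qed

lemma F_zero: "zero F_sp = fiber 0"
  using coset_eq_fiber[of "\<lambda>_. 0" 0] by (simp add: F_space_def ous_quotient_def E_space_simps selection_simps)

lemma F_unit: "unit F_sp = fiber 1"
  using coset_eq_fiber[of "\<lambda>_. 1" 1] by (simp add: F_space_def ous_quotient_def E_space_simps selection_simps)

text \<open>
  Positive elements are squares, so a positive limit is the limit of squares of selections; hence a
  positive element lifts to a positive sequence.
\<close>

lemma F_nonneg_iff:
  assumes a: "a \<in> sa UNIV"
  shows "le F_sp (zero F_sp) (fiber a) \<longleftrightarrow> positive a"
proof
  assume "le F_sp (zero F_sp) (fiber a)"
  then obtain d where d: "d \<in> E" "le E_sp (zero E_sp) d"
    "fiber a = ous_quotient_add E_sp J (fiber 0)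
      (cls d)"
    unfolding F_zero by (auto simp: F_space_def ous_quotient_def E_space_simps(1))
  obtain x b where x: "selection x" "x \<longlonglongrightarrow> b" "d = pairs x"
    using d(1) by (auto simp: E_set_eq convergent_def)
  have "\<forall>n. positive (x n)"
    using d(2) E_space_le_iff[OF selection_simps(4) x(1)] by (simp add: x(3) E_space_simps)
  then have "positive b"
    using positive_lim[OF x(2)] by blast
  moreover have "b \<in> sa UNIV"
    by (rule selection_limit_sa[OF x(1,2)])
  then have "fiber a = fiber b"
    using d(3) quotient_add_fiber[OF in_sa_UNIV(1)] by (simp add: x(3) coset_eq_fiber[OF x(1,2)])
  then have "a = b"
    by (rule fiber_inj[OF a])
  ultimately show "positive a"
    by simp
next
  assume "positive a"
  then obtain h where h: "star h = h" "h * h = a"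
    using positive_has_root_in_subalgebra[OF cstar_subalgebra_UNIV] by blast
  then have "h \<in> sa UNIV"
    by (simp add: sa_def)
  then obtain y where y: "selection y" "y \<longlonglongrightarrow> h"
    using selection_exists by blast
  let ?x = "\<lambda>n. y n * y n"
  have x: "selection ?x" "?x \<longlonglongrightarrow> a"
    using y cstar_subalgebraD(5)[OF subalg] tendsto_mult[OF y(2) y(2)]
    by (auto simp: selection_def sa_def star_mult h(2))
  have "positive (?x n)" for n
    using y(1) by (intro positive_square) (auto simp: selection_def sa_def)
  then have "le E_sp (zero E_sp) (pairs ?x)"
    using E_space_le_iff[OF selection_simps(4) x(1)] by (simp add: E_space_simps)
  moreover have "pairs ?x \<in> carrier E_sp"
    using pairs_in_E_set[OF x(1)] x(2) by (auto simp: E_space_simps convergent_def)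
  moreover have "fiber a = ous_quotient_add E_sp J (fiber 0)
      (cls (pairs ?x))"
    using quotient_add_fiber[OF in_sa_UNIV(1) a] by (simp add: coset_eq_fiber[OF x])
  ultimately show "le F_sp (zero F_sp) (fiber a)"
    unfolding F_zero by (auto simp: F_space_def ous_quotient_def)
qed

theorem order_unit_iso_fiber: "order_unit_iso (sa_ous UNIV) F_sp fiber"
proof -
  have inj: "inj_on fiber (sa UNIV)"
    by (rule inj_onI) (rule fiber_inj)
  have pos: "le (sa_ous UNIV) 0 a \<longleftrightarrow> positive a" if "a \<in> sa UNIV" for a :: 'a
    using le_sa_ous_iff[OF cstar_subalgebra_UNIV, of 0 a] by simp
  show ?thesis
    unfolding order_unit_iso_def
    using inj F_nonneg_iff
    by (auto simp: bij_betw_def F_carrier F_add F_scale F_unit pos inv_into_f_f)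
qed

lemma psi_eq_fiber:
  assumes a: "a \<in> sa (A n)"
  shows "psi A L \<beta> n a = fiber a"
proof -
  let ?x = "\<lambda>k. if n \<le> k then a else 0"
  have "psi_seq n a = pairs ?x"
    by (auto simp: psi_seq_def pairs_def fun_eq_iff)
  moreover have "selection ?x"
    using a sa_mono in_sa by (auto simp: selection_def)
  moreover have "?x \<longlonglongrightarrow> a"
    by (rule tendsto_eventually) (auto simp: eventually_sequentially)
  ultimately show ?thesis
    by (simp add: psi_def F_quot_def coset_eq_fiber)
qed

section \<open>The Lip-norm of the limit\<close>

text \<open>
  The seminorm transported to the self-adjoint part along the isomorphism. Up to an arbitrarily small loss, \<open>limit_lip a \<le> c\<close>
  means that \<open>a\<close> is the limit of a path of constant \<open>c\<close>.
\<close>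

definition limit_lip :: "'a \<Rightarrow> ennreal" where
  "limit_lip = F_lip A L \<beta> \<circ> fiber"

abbreviation limit_ball :: "'a set" where
  "limit_ball \<equiv> lip_ball (sa_ous UNIV) limit_lip"

lemma limit_lip_eq:
  assumes "a \<in> sa UNIV"
  shows "limit_lip a = (INF x\<in>{x. selection x \<and> x \<longlonglongrightarrow> a}. S0 L \<beta> (pairs x))"
proof -
  have "{d \<in> E. F_quot A L \<beta> d = fiber a} = fiber a"
  proof (intro set_eqI iffI)
    fix d assume d: "d \<in> {d \<in> E. F_quot A L \<beta> d = fiber a}"
    then obtain x b where x: "selection x" "x \<longlonglongrightarrow> b" "d = pairs x"
      by (auto simp: E_set_eq convergent_def)
    with d have "fiber b = fiber a"
      by (simp add: F_quot_def coset_eq_fiber)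
    with x show "d \<in> fiber a"
      using fiberI by metis
  next
    fix d assume "d \<in> fiber a"
    then obtain x where "selection x" "x \<longlonglongrightarrow> a" "d = pairs x"
      by (auto simp: fiber_def)
    then show "d \<in> {d \<in> E. F_quot A L \<beta> d = fiber a}"
      by (auto simp: E_set_eq convergent_def F_quot_def coset_eq_fiber)
  qed
  then show ?thesis
    by (simp add: limit_lip_def F_lip_def fiber_def image_image)
qed


lemma limit_lip_le:
  assumes x: "lip_path c x" "x \<longlonglongrightarrow> a"
  shows "limit_lip a \<le> ennreal c"
proof -
  have sel: "selection x"
    by (rule lip_pathD(1)[OF x(1)])
  have "limit_lip a \<le> S0 L \<beta> (pairs x)"
    unfolding limit_lip_eq[OF selection_limit_sa[OF sel x(2)]]
    by (rule INF_lower) (use sel x(2) in simp)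
  also have "\<dots> \<le> ennreal c"
    using S0_le_iff[OF sel lip_path_nonneg[OF x(1)]] x(1) by simp
  finally show ?thesis .
qed

lemma lip_path_of_limit_lip_less:
  assumes a: "a \<in> sa UNIV" and c: "limit_lip a < ennreal c"
  shows "\<exists>x. lip_path c x \<and> x \<longlonglongrightarrow> a"
proof -
  have "0 < ennreal c"
    using c by (rule le_less_trans[rotated]) simp
  then have "0 \<le> c"
    by simp
  obtain x where "selection x" "x \<longlonglongrightarrow> a" "S0 L \<beta> (pairs x) < ennreal c"
    using c unfolding limit_lip_eq[OF a] INF_less_iff by blast
  then show ?thesis
    using S0_le_iff[of x c] \<open>0 \<le> c\<close> by auto
qed

lemma limit_lip_add:
  assumes a: "a \<in> sa UNIV" and b: "b \<in> sa UNIV"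
  shows "limit_lip (a + b) \<le> limit_lip a + limit_lip b"
proof (rule ennreal_le_epsilon)
  fix e :: real
  assume e: "0 < e" and "limit_lip a + limit_lip b < top"
  then have "limit_lip a < top" "limit_lip b < top"
    by simp_all
  then obtain s t where s: "0 \<le> s" "limit_lip a = ennreal s" and t: "0 \<le> t" "limit_lip b = ennreal t"
    by (metis ennreal_cases less_irrefl)
  obtain x where x: "lip_path (s + e / 2) x" "x \<longlonglongrightarrow> a"
    using lip_path_of_limit_lip_less[OF a, of "s + e / 2"] s e by (auto simp: ennreal_less_iff)
  obtain y where y: "lip_path (t + e / 2) y" "y \<longlonglongrightarrow> b"
    using lip_path_of_limit_lip_less[OF b, of "t + e / 2"] t e by (auto simp: ennreal_less_iff)
  have "limit_lip (a + b) \<le> ennreal ((s + e / 2) + (t + e / 2))"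
    by (rule limit_lip_le[OF lip_path_add[OF x(1) y(1)] tendsto_add[OF x(2) y(2)]])
  also have "(s + e / 2) + (t + e / 2) = s + t + e"
    by simp
  also have "ennreal (s + t + e) = limit_lip a + limit_lip b + ennreal e"
    using s t e by simp
  finally show "limit_lip (a + b) \<le> limit_lip a + limit_lip b + ennreal e" .
qed

lemma limit_lip_scalar: "limit_lip (c *\<^sub>R 1) = 0"
proof -
  have "lip_path 0 (\<lambda>_. c *\<^sub>R 1)"
    by (simp add: lip_path_def selection_def in_sa L_scalar)
  then have "limit_lip (c *\<^sub>R 1) \<le> ennreal 0"
    by (rule limit_lip_le) simp
  then show ?thesis
    by simp
qed

text \<open>
  The estimate spends a slack of \<open>e / \<bar>c\<bar>\<close>. For \<open>c = 0\<close> the convention \<open>0 * \<infinity> = 0\<close> asks for \<open>limit_lip 0 = 0\<close> instead.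
\<close>

lemma limit_lip_scale_le:
  assumes a: "a \<in> sa UNIV" and c: "c \<noteq> 0"
  shows "limit_lip (c *\<^sub>R a) \<le> ennreal \<bar>c\<bar> * limit_lip a"
proof (cases "limit_lip a")
  case (real s)
  show ?thesis
  proof (rule ennreal_le_epsilon)
    fix e :: real assume e: "0 < e"
    obtain x where x: "lip_path (s + e / \<bar>c\<bar>) x" "x \<longlonglongrightarrow> a"
      using lip_path_of_limit_lip_less[OF a, of "s + e / \<bar>c\<bar>"] real e c by (auto simp: ennreal_less_iff)
    have "limit_lip (c *\<^sub>R a) \<le> ennreal (\<bar>c\<bar> * (s + e / \<bar>c\<bar>))"
      by (rule limit_lip_le[OF lip_path_scale[OF x(1)] tendsto_scaleR[OF tendsto_const x(2)]])
    also have "\<bar>c\<bar> * (s + e / \<bar>c\<bar>) = \<bar>c\<bar> * s + e"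
      using c by (simp add: field_simps)
    also have "ennreal (\<bar>c\<bar> * s + e) = ennreal \<bar>c\<bar> * limit_lip a + ennreal e"
      using real e by (simp add: ennreal_mult)
    finally show "limit_lip (c *\<^sub>R a) \<le> ennreal \<bar>c\<bar> * limit_lip a + ennreal e" .
  qed
next
  case top
  then show ?thesis
    using c by (simp add: ennreal_mult_top)
qed

lemma limit_lip_scale:
  assumes a: "a \<in> sa UNIV"
  shows "limit_lip (c *\<^sub>R a) = ennreal \<bar>c\<bar> * limit_lip a"
proof (cases "c = 0")
  case True
  then show ?thesis
    using limit_lip_scalar[of 0] by simp
next
  case False
  show ?thesis
  proof (rule antisym)
    show "limit_lip (c *\<^sub>R a) \<le> ennreal \<bar>c\<bar> * limit_lip a"
      by (rule limit_lip_scale_le[OF a False])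
    have "limit_lip ((1 / c) *\<^sub>R c *\<^sub>R a) \<le> ennreal \<bar>1 / c\<bar> * limit_lip (c *\<^sub>R a)"
      using False by (intro limit_lip_scale_le in_sa_UNIV a) simp
    then have "ennreal \<bar>c\<bar> * limit_lip a \<le> ennreal \<bar>c\<bar> * (ennreal \<bar>1 / c\<bar> * limit_lip (c *\<^sub>R a))"
      using False by (intro mult_left_mono) simp_all
    also have "\<dots> = ennreal (\<bar>c\<bar> * \<bar>1 / c\<bar>) * limit_lip (c *\<^sub>R a)"
      by (simp only: ennreal_mult[OF abs_ge_zero abs_ge_zero] mult.assoc)
    also have "\<bar>c\<bar> * \<bar>1 / c\<bar> = 1"
      using False by simp
    finally show "ennreal \<bar>c\<bar> * limit_lip a \<le> limit_lip (c *\<^sub>R a)"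
      by simp
  qed
qed

lemma limit_lip_finite:
  assumes a: "a \<in> sa (A n)" "L n a < \<infinity>"
  shows "limit_lip a < \<infinity>"
proof -
  let ?x = "\<lambda>k. if n \<le> k then a else 0"
  have "selection ?x"
    using a(1) sa_mono in_sa by (auto simp: selection_def)
  moreover have "L m (?x m) < \<infinity>" if "m \<le> n" for m
    using that a(2) L_zero by auto
  ultimately obtain c where "lip_path c ?x"
    using eventually_constant_lip_path[of ?x n] by auto
  moreover have "?x \<longlonglongrightarrow> a"
    by (rule tendsto_eventually) (auto simp: eventually_sequentially)
  ultimately have "limit_lip a \<le> ennreal c"
    by (rule limit_lip_le)
  then show ?thesis
    by (rule order.strict_trans1) simp
qed

lemma limit_lip_dom_dense: "sa UNIV \<subseteq> closure (dom_of (sa_ous UNIV) limit_lip)"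
proof
  fix a :: 'a assume "a \<in> sa UNIV"
  then obtain x where x: "selection x" "x \<longlonglongrightarrow> a"
    using selection_exists by blast
  show "a \<in> closure (dom_of (sa_ous UNIV) limit_lip)"
    unfolding closure_approachable
  proof (intro allI impI)
    fix e :: real assume e: "0 < e"
    then obtain n where n: "dist (x n) a < e / 2"
      using x(2) by (meson LIMSEQ_iff_nz half_gt_zero lim_sequentially order.refl)
    obtain y where y: "y \<in> sa (A n)" "L n y < \<infinity>" "norm (y - x n) < e / 2"
      using dom_dense[of "x n" n "e / 2"] x(1) e by (auto simp: selection_def)
    have "dist y a < e"
      using dist_triangle[of y a "x n"] n y(3) by (simp add: dist_norm)
    moreover have "y \<in> dom_of (sa_ous UNIV) limit_lip"
      using limit_lip_finite[OF y(1,2)] sa_UNIV[OF y(1)] by (simp add: dom_of_def)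
    ultimately show "\<exists>y\<in>dom_of (sa_ous UNIV) limit_lip. dist y a < e"
      by blast
  qed
qed

text \<open>
  If \<open>limit_lip a = 0\<close> then \<open>a\<close> is approximated, with vanishing Lip-norm, already in the algebra of index \<open>0\<close>, and
  closedness of the ball there makes it a scalar.
\<close>

lemma limit_lip_kernel: "{a \<in> sa UNIV. limit_lip a = 0} = range (\<lambda>c. c *\<^sub>R 1)"
proof (intro set_eqI iffI)
  fix a assume "a \<in> range (\<lambda>c. c *\<^sub>R (1::'a))"
  then show "a \<in> {a \<in> sa UNIV. limit_lip a = 0}"
    using limit_lip_scalar in_sa_UNIV(2,4) by auto
next
  fix a assume "a \<in> {a \<in> sa UNIV. limit_lip a = 0}"
  then have a: "a \<in> sa UNIV" "limit_lip a = 0"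
    by auto
  have "\<exists>y. y \<in> sa (A 0) \<and> L 0 y \<le> ennreal (1 / real (Suc k)) \<and> norm (y - a) \<le> 1 / real (Suc k) * tail 0" for k
  proof -
    obtain x where x: "lip_path (1 / real (Suc k)) x" "x \<longlonglongrightarrow> a"
      using lip_path_of_limit_lip_less[OF a(1), of "1 / real (Suc k)"] a(2) by auto
    then show ?thesis
      using lip_pathD(2,3)[OF x(1), of 0] lip_path_limit_dist[OF x, of 0] by blast
  qed
  then obtain y where y: "\<And>k. y k \<in> sa (A 0)" "\<And>k. L 0 (y k) \<le> ennreal (1 / real (Suc k))"
    "\<And>k. norm (y k - a) \<le> 1 / real (Suc k) * tail 0"
    by metis
  have "(\<lambda>k. 1 / real (Suc k) * tail 0) \<longlonglongrightarrow> 0 * tail 0"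
    by (intro tendsto_intros LIMSEQ_Suc[OF lim_1_over_n])
  then have "(\<lambda>k. 1 / real (Suc k) * tail 0) \<longlonglongrightarrow> 0"
    by simp
  then have "(\<lambda>k. y k - a) \<longlonglongrightarrow> 0"
    by (rule Lim_null_comparison[rotated]) (intro always_eventually allI y(3))
  then have ya: "y \<longlonglongrightarrow> a"
    by (rule LIM_zero_cancel)
  have aA: "a \<in> sa (A 0)"
    by (rule closed_sequentially[OF closed_sa[OF subalg] y(1) ya])
  \<comment> \<open>All multiples of \<open>a\<close> lie in the ball of \<open>L 0\<close>, as limits of multiples of \<open>y k\<close> with \<open>k\<close> large.\<close>
  have scaled: "real s *\<^sub>R a \<in> level_ball 0" for s
  proof (rule closed_sequentially[OF closed_lip_ball])
    show "real s *\<^sub>R y (k + s) \<in> level_ball 0" for k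
    proof -
      have "L 0 (real s *\<^sub>R y (k + s)) \<le> ennreal (\<bar>real s\<bar> * (1 / real (Suc (k + s))))"
        by (rule L_scale_le[OF y(1,2)])
      also have "\<dots> \<le> 1"
        by (simp add: divide_le_eq)
      finally show ?thesis
        using y(1) by (simp add: lip_ball_def in_sa)
    qed
    show "(\<lambda>k. real s *\<^sub>R y (k + s)) \<longlonglongrightarrow> real s *\<^sub>R a"
      by (intro tendsto_scaleR tendsto_const LIMSEQ_ignore_initial_segment[OF ya])
  qed
  have le: "ennreal (real s) * L 0 a \<le> 1" for s
    using scaled[of s] L_scale[OF aA, of "real s"] by (simp add: lip_ball_def)
  then have "L 0 a \<le> 1"
    using le[of 1] by simp
  then obtain l where l: "0 \<le> l" "L 0 a = ennreal l"
    by (cases "L 0 a") (auto simp: top_unique)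
  have "real s * l \<le> 1" for s
    using le[of s] l by (simp flip: ennreal_mult)
  then have "\<not> 0 < l"
    using reals_Archimedean3[of l] by (meson not_less)
  then have "l = 0"
    using l(1) by simp
  then show "a \<in> range (\<lambda>c. c *\<^sub>R 1)"
    using L_eq_0_iff[OF aA] l by simp
qed

text \<open>
  A path of constant \<open>2\<close> stays within \<open>2 * tail 0\<close> of its starting point, and the ball of index \<open>0\<close> is
  bounded modulo scalars.
\<close>

lemma limit_lip_bounded:
  "\<exists>R. \<forall>a\<in>limit_ball. \<exists>c. norm (a - c *\<^sub>R 1) \<le> R"
proof -
  obtain R where R: "\<And>x. x \<in> level_ball 0 \<Longrightarrow> \<exists>c. norm (x - c *\<^sub>R 1) \<le> R"
    using bounded_lip_ball[of 0] by blast
  have "\<exists>c. norm (a - c *\<^sub>R 1) \<le> 2 * tail 0 + 2 * R" if a: "a \<in> limit_ball" for a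
  proof -
    have a: "a \<in> sa UNIV" "limit_lip a \<le> 1"
      using a by (simp_all add: lip_ball_def)
    have "limit_lip a < ennreal 2"
      by (rule le_less_trans[OF a(2)]) simp
    then obtain x where x: "lip_path 2 x" "x \<longlonglongrightarrow> a"
      using lip_path_of_limit_lip_less[OF a(1)] by blast
    have "L 0 ((1/2) *\<^sub>R x 0) \<le> 1"
      using L_scale_le[OF lip_pathD(2)[OF x(1), of 0] lip_pathD(3)[OF x(1)], of "1/2"] by simp
    then have "(1/2) *\<^sub>R x 0 \<in> level_ball 0"
      using lip_pathD(2)[OF x(1), of 0] by (simp add: lip_ball_def in_sa)
    then obtain c where c: "norm ((1/2) *\<^sub>R x 0 - c *\<^sub>R 1) \<le> R"
      using R by blast
    have eq: "x 0 - (2 * c) *\<^sub>R 1 = 2 *\<^sub>R ((1/2) *\<^sub>R x 0 - c *\<^sub>R 1)"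
      by (simp add: scaleR_right_diff_distrib)
    have "norm (x 0 - (2 * c) *\<^sub>R 1) = 2 * norm ((1/2) *\<^sub>R x 0 - c *\<^sub>R 1)"
      unfolding eq norm_scaleR by simp
    moreover have "norm (a - (2 * c) *\<^sub>R 1) \<le> norm (x 0 - a) + norm (x 0 - (2 * c) *\<^sub>R 1)"
      using norm_triangle_ineq[of "a - x 0" "x 0 - (2 * c) *\<^sub>R 1"] norm_minus_commute[of a "x 0"] by simp
    ultimately have "norm (a - (2 * c) *\<^sub>R 1) \<le> 2 * tail 0 + 2 * R"
      using c lip_path_limit_dist[OF x, of 0] by linarith
    then show ?thesis
      by blast
  qed
  then show ?thesis
    by blast
qed

text \<open>
  The bound on the entries holds automatically for paths of constant \<open>1\<close> with a limit of norm at most \<open>R\<close>. It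
  places each entry in a compact set.
\<close>

definition bounded_lip_paths :: "real \<Rightarrow> (nat \<Rightarrow> 'a) set" where
  "bounded_lip_paths R = {x. lip_path 1 x \<and> (\<forall>n. norm (x n) \<le> R + tail n)}"

text \<open>
  Tychonoff's theorem, the \<open>n\<close>-th factor being compact by Rieffel's criterion for the \<open>n\<close>-th Lip-norm.
\<close>

lemma compact_bounded_lip_paths: "compact (bounded_lip_paths R)"
proof -
  let ?K = "\<lambda>n. {x \<in> level_ball n. norm x \<le> R + tail n}"
  let ?J = "{x. \<forall>n. norm (x n - x (Suc n)) \<le> 2 * \<beta> n}"
  have "compact (Pi\<^sub>E UNIV ?K)"
    using compactin_PiE[of "\<lambda>_. euclidean" UNIV ?K] compact_lip_ball
    by (simp add: euclidean_product_topology)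
  moreover have "closed ?J"
    by (intro closed_Collect_all closed_Collect_le continuous_intros continuous_on_product_coordinates)
  ultimately have "compact (Pi\<^sub>E UNIV ?K \<inter> ?J)"
    by (rule compact_Int_closed)
  moreover have "bounded_lip_paths R = Pi\<^sub>E UNIV ?K \<inter> ?J"
    by (auto simp: bounded_lip_paths_def lip_path_def selection_def lip_ball_def)
  ultimately show ?thesis
    by simp
qed

text \<open>
  The estimate by \<open>tail n\<close> is the same for all paths of constant \<open>1\<close>, so the limit is a uniform limit of coordinates.
\<close>

lemma continuous_on_lim_bounded_lip_paths: "continuous_on (bounded_lip_paths R) lim"
proof (rule uniform_limit_theorem)
  show "\<forall>\<^sub>F n in sequentially. continuous_on (bounded_lip_paths R) (\<lambda>x. x n)"
    by (intro always_eventually allI continuous_on_subset[OF continuous_on_product_coordinates subset_UNIV])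
  show "uniform_limit (bounded_lip_paths R) (\<lambda>n x. x n) lim sequentially"
  proof (rule uniform_limitI)
    fix e :: real assume e: "0 < e"
    have "\<forall>\<^sub>F n in sequentially. tail n < e"
      using tail_tendsto_0 e by (rule order_tendstoD)
    then show "\<forall>\<^sub>F n in sequentially. \<forall>x\<in>bounded_lip_paths R. dist (x n) (lim x) < e"
    proof eventually_elim
      case (elim n)
      show ?case
      proof
        fix x assume "x \<in> bounded_lip_paths R"
        then have x: "lip_path 1 x"
          by (simp add: bounded_lip_paths_def)
        have "x \<longlonglongrightarrow> lim x"
          using lip_path_convergent[OF x] by (simp add: convergent_LIMSEQ_iff)
        from lip_path_limit_dist[OF x this, of n] elim show "dist (x n) (lim x) < e"
          by (simp add: dist_norm)
      qed
    qed
  qed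
qed simp

text \<open>
  Only paths of constant slightly above \<open>1\<close> are given by the infimum in \<open>limit_lip\<close>. Dividing by these constants and using
  that limits of bounded paths form a compact set shows that the infimum is attained.
\<close>

lemma limit_lip_ball_eq:
  "{a \<in> limit_ball. norm a \<le> R} = lim ` bounded_lip_paths R \<inter> cball 0 R"
proof (intro set_eqI iffI)
  fix a assume "a \<in> lim ` bounded_lip_paths R \<inter> cball 0 R"
  then obtain x where x: "lip_path 1 x" "a = lim x" "norm a \<le> R"
    by (auto simp: bounded_lip_paths_def)
  then have lim: "x \<longlonglongrightarrow> a"
    using lip_path_convergent[OF x(1)] by (simp add: convergent_LIMSEQ_iff)
  show "a \<in> {a \<in> limit_ball. norm a \<le> R}"
    using limit_lip_le[OF x(1) lim] selection_limit_sa[OF lip_pathD(1)[OF x(1)] lim] x(3)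
    by (simp add: lip_ball_def)
next
  fix a assume "a \<in> {a \<in> limit_ball. norm a \<le> R}"
  then have a: "a \<in> sa UNIV" "limit_lip a \<le> 1" "norm a \<le> R"
    by (auto simp: lip_ball_def)
  \<comment> \<open>Constants strictly above \<open>1\<close>, where a path is available, tending to \<open>1\<close>.\<close>
  define c where "c = (\<lambda>k. 1 + 1 / real (Suc k))"
  have c: "1 < c k" for k
    by (simp add: c_def)
  have "(1 / c k) *\<^sub>R a \<in> lim ` bounded_lip_paths R" for k
  proof -
    have "limit_lip a < ennreal (c k)"
      by (rule le_less_trans[OF a(2)]) (use c[of k] in simp)
    then obtain x where x: "lip_path (c k) x" "x \<longlonglongrightarrow> a"
      using lip_path_of_limit_lip_less[OF a(1)] by blast
    let ?y = "\<lambda>n. (1 / c k) *\<^sub>R x n"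
    have "lip_path 1 ?y"
      using lip_path_scale[OF x(1), of "1 / c k"] c[of k] by simp
    moreover have "norm (?y n) \<le> R + tail n" for n
    proof -
      have "norm (x n) \<le> norm a + norm (x n - a)"
        using norm_triangle_ineq[of a "x n - a"] by simp
      also have "\<dots> \<le> R + c k * tail n"
        using a(3) lip_path_limit_dist[OF x, of n] by simp
      also have "\<dots> \<le> c k * (R + tail n)"
      proof -
        have "0 \<le> R"
          using a(3) norm_ge_zero[of a] by linarith
        then have "1 * R \<le> c k * R"
          using c[of k] by (intro mult_right_mono) auto
        then show ?thesis
          by (simp add: distrib_left)
      qed
      finally show ?thesis
        using c[of k] by (simp add: divide_le_eq mult.commute)
    qed
    moreover have "lim ?y = (1 / c k) *\<^sub>R a"
      by (intro limI tendsto_scaleR tendsto_const x)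
    ultimately show ?thesis
      by (intro image_eqI[of _ _ ?y]) (auto simp: bounded_lip_paths_def)
  qed
  moreover have "closed (lim ` bounded_lip_paths R)"
    by (intro compact_imp_closed compact_continuous_image continuous_on_lim_bounded_lip_paths
        compact_bounded_lip_paths)
  moreover have "(\<lambda>k. (1 / c k) *\<^sub>R a) \<longlonglongrightarrow> (1 / (1 + 0)) *\<^sub>R a"
    unfolding c_def by (intro tendsto_intros LIMSEQ_Suc[OF lim_1_over_n]) simp
  ultimately have "(1 / (1 + 0)) *\<^sub>R a \<in> lim ` bounded_lip_paths R"
    by (meson closed_sequentially)
  then show "a \<in> lim ` bounded_lip_paths R \<inter> cball 0 R"
    using a(3) by simp
qed

lemma limit_lip_ball_compact: "compact {a \<in> limit_ball. norm a \<le> R}"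
  unfolding limit_lip_ball_eq
  by (intro compact_Int_closed closed_cball compact_continuous_image continuous_on_lim_bounded_lip_paths
      compact_bounded_lip_paths)

theorem quantum_metric_ous_limit: "quantum_metric_ous (sa_ous UNIV) limit_lip"
proof -
  interpret V: normed_order_unit_space "sa_ous (UNIV :: 'a set)"
    by (rule normed_order_unit_space_sa[OF cstar_subalgebra_UNIV])
  obtain R where "\<forall>a\<in>limit_ball. \<exists>c. norm (a - c *\<^sub>R 1) \<le> R"
    using limit_lip_bounded by blast
  then show ?thesis
    using limit_lip_add limit_lip_scale limit_lip_dom_dense limit_lip_kernel limit_lip_ball_compact
    by (intro V.quantum_metric_ous_of_compact[where R\<^sub>0 = R]) simp_all
qed


section \<open>A joint Lip-norm and the distance to the limit\<close>

lemma bridge_forward: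
  assumes x: "x \<in> level_ball n"
  shows "\<exists>y\<in>level_ball (Suc n). norm (x - y) \<le> 2 * \<beta> n"
proof -
  have "(INF b\<in>level_ball (Suc n). ennreal (norm (x - b)))
      \<le> evident_bridge_length (A n) (L n) (A (Suc n)) (L (Suc n))"
    unfolding evident_bridge_length_def using x by (intro max.coboundedI1 SUP_upper)
  also have "\<dots> \<le> ennreal (\<beta> n)"
    by (rule bridge)
  also have "\<dots> < ennreal (2 * \<beta> n)"
    using beta_pos[of n] by (intro ennreal_lessI) auto
  finally obtain y where "y \<in> level_ball (Suc n)"
    "ennreal (norm (x - y)) < ennreal (2 * \<beta> n)"
    unfolding INF_less_iff by blast
  then show ?thesis
    by (intro bexI[of _ y]) (simp_all add: ennreal_less_iff)
qed

lemma bridge_backward: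
  assumes y: "y \<in> level_ball (Suc n)"
  shows "\<exists>x\<in>level_ball n. norm (x - y) \<le> 2 * \<beta> n"
proof -
  have "(INF a\<in>level_ball n. ennreal (norm (a - y)))
      \<le> evident_bridge_length (A n) (L n) (A (Suc n)) (L (Suc n))"
    unfolding evident_bridge_length_def using y by (intro max.coboundedI2 SUP_upper)
  also have "\<dots> \<le> ennreal (\<beta> n)"
    by (rule bridge)
  also have "\<dots> < ennreal (2 * \<beta> n)"
    using beta_pos[of n] by (intro ennreal_lessI) auto
  finally obtain x where "x \<in> level_ball n"
    "ennreal (norm (x - y)) < ennreal (2 * \<beta> n)"
    unfolding INF_less_iff by blast
  then show ?thesis
    by (intro bexI[of _ x]) (simp_all add: ennreal_less_iff)
qed

lemma lip_path_1_iff: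
  "lip_path 1 x \<longleftrightarrow> (\<forall>n. x n \<in> level_ball n \<and> norm (x n - x (Suc n)) \<le> 2 * \<beta> n)"
  by (auto simp: lip_path_def selection_def lip_ball_def)

lemma forward_lip_path:
  assumes x: "x \<in> level_ball n"
  shows "\<exists>z. z 0 = x \<and> (\<forall>k. z k \<in> level_ball (n + k) \<and>
    norm (z k - z (Suc k)) \<le> 2 * \<beta> (n + k))"
proof -
  have "\<exists>z. \<forall>k. (z k \<in> level_ball (n + k) \<and> (k = 0 \<longrightarrow> z k = x)) \<and>
      norm (z k - z (Suc k)) \<le> 2 * \<beta> (n + k)"
  proof (rule dependent_nat_choice)
    show "\<exists>z. z \<in> level_ball (n + 0) \<and> (0 = 0 \<longrightarrow> z = x)"
      using x by auto
    show "\<exists>w. (w \<in> level_ball (n + Suc k) \<and> (Suc k = 0 \<longrightarrow> w = x)) \<and>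
        norm (z - w) \<le> 2 * \<beta> (n + k)"
      if "z \<in> level_ball (n + k) \<and> (k = 0 \<longrightarrow> z = x)" for z k
      using bridge_forward[of z "n + k"] that by auto
  qed
  then show ?thesis
    by blast
qed

text \<open>
  Walk forward along bridges for ever and backward finitely often. The factor \<open>2\<close> in the Lipschitz condition
  leaves room for the infimum in the bridge length not being attained.
\<close>

lemma lip_path_through:
  "x \<in> level_ball n \<Longrightarrow> \<exists>y. lip_path 1 y \<and> y n = x"
proof (induction n arbitrary: x)
  case 0
  then show ?case
    using forward_lip_path[of x 0] unfolding lip_path_1_iff by auto
next
  case (Suc n)
  obtain x' where x': "x' \<in> level_ball n" "norm (x' - x) \<le> 2 * \<beta> n"
    using bridge_backward[OF Suc.prems] by blast
  obtain y where y: "lip_path 1 y" "y n = x'"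
    using Suc.IH[OF x'(1)] by blast
  obtain z where z: "z 0 = x" "\<And>k. z k \<in> level_ball (Suc n + k)"
    "\<And>k. norm (z k - z (Suc k)) \<le> 2 * \<beta> (Suc n + k)"
    using forward_lip_path[OF Suc.prems] by blast
  define w where "w = (\<lambda>m. if m \<le> n then y m else z (m - Suc n))"
  have "w m \<in> level_ball m \<and> norm (w m - w (Suc m)) \<le> 2 * \<beta> m" for m
  proof -
    consider "m < n" | "m = n" | "n < m"
      by linarith
    then show ?thesis
    proof cases
      case 1
      then show ?thesis
        using y(1) by (simp add: w_def lip_path_1_iff)
    next
      case 2
      then show ?thesis
        using x' y(2) z(1) by (simp add: w_def)
    next
      case 3
      then obtain k where "m = Suc n + k"
        by (metis less_iff_Suc_add add_Suc)
      then show ?thesis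
        using z(2)[of k] z(3)[of k] by (simp add: w_def)
    qed
  qed
  moreover have "w (Suc n) = x"
    by (simp add: w_def z(1))
  ultimately show ?case
    unfolding lip_path_1_iff by blast
qed

text \<open>
  Together with the next lemma: the Lip-balls of the \<open>n\<close>-th algebra and of the limit are within \<open>tail n\<close> of each other, up to an
  arbitrarily small loss. These are the two quotient conditions of admissibility.
\<close>

lemma limit_near_level:
  assumes x: "x \<in> sa (A n)" and c: "0 < c" "L n x \<le> ennreal c"
  shows "\<exists>a\<in>sa UNIV. limit_lip a \<le> ennreal c \<and> norm (x - a) \<le> c * tail n"
proof -
  have "L n ((1 / c) *\<^sub>R x) \<le> ennreal (\<bar>1 / c\<bar> * c)"
    by (rule L_scale_le[OF x c(2)])
  then have "(1 / c) *\<^sub>R x \<in> level_ball n"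
    using x c(1) by (simp add: lip_ball_def in_sa)
  then obtain y where y: "lip_path 1 y" "y n = (1 / c) *\<^sub>R x"
    using lip_path_through by blast
  have z: "lip_path c (\<lambda>n. c *\<^sub>R y n)"
    using lip_path_scale[OF y(1), of c] c(1) by simp
  then obtain a where a: "(\<lambda>n. c *\<^sub>R y n) \<longlonglongrightarrow> a"
    using lip_path_convergent by (auto simp: convergent_def)
  have "norm (x - a) \<le> c * tail n"
    using lip_path_limit_dist[OF z a, of n] c(1) by (simp add: y(2))
  then show ?thesis
    using limit_lip_le[OF z a] selection_limit_sa[OF lip_pathD(1)[OF z] a] by blast
qed

lemma level_near_limit:
  assumes a: "a \<in> sa UNIV" and c: "limit_lip a < ennreal c"
  shows "\<exists>x\<in>sa (A n). L n x \<le> ennreal c \<and> norm (x - a) \<le> c * tail n"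
  using lip_path_of_limit_lip_less[OF a c] lip_pathD(2,3) lip_path_limit_dist by blast

text \<open>
  The Lip-norm on the direct sum that realises the bound on the distance: it couples the two summands by
  requiring Lipschitz pairs to be \<open>tail n\<close>-close.
\<close>

definition joint_lip :: "nat \<Rightarrow> 'a \<times> 'a \<Rightarrow> ennreal" where
  "joint_lip n p = max (max (L n (fst p)) (limit_lip (snd p))) (ennreal (norm (fst p - snd p) / tail n))"

abbreviation joint_space :: "nat \<Rightarrow> ('a \<times> 'a) ous" where
  "joint_space n \<equiv> ous_sum (sa_ous (A n)) (sa_ous UNIV)"

lemma joint_lip_le_iff:
  "0 \<le> c \<Longrightarrow> joint_lip n (x, a) \<le> ennreal c \<longleftrightarrow>
    L n x \<le> ennreal c \<and> limit_lip a \<le> ennreal c \<and> norm (x - a) \<le> c * tail n"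
  using tail_pos[of n] by (simp add: joint_lip_def ennreal_le_iff divide_le_eq)

lemma joint_lip_ball:
  "lip_ball (joint_space n) (joint_lip n) =
    {(x, a). x \<in> level_ball n \<and> a \<in> limit_ball \<and> norm (x - a) \<le> tail n}"
  using joint_lip_le_iff[of 1] by (auto simp: lip_ball_def)

lemma joint_lip_add:
  assumes "x \<in> sa (A n)" "a \<in> sa UNIV" "y \<in> sa (A n)" "b \<in> sa UNIV"
  shows "joint_lip n (x + y, a + b) \<le> joint_lip n (x, a) + joint_lip n (y, b)"
proof -
  let ?s = "joint_lip n (x, a)" and ?t = "joint_lip n (y, b)"
  have parts: "L n x \<le> ?s" "limit_lip a \<le> ?s" "ennreal (norm (x - a) / tail n) \<le> ?s"
    "L n y \<le> ?t" "limit_lip b \<le> ?t" "ennreal (norm (y - b) / tail n) \<le> ?t"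
    by (simp_all add: joint_lip_def le_max_iff_disj)
  have "L n (x + y) \<le> ?s + ?t"
    by (rule order_trans[OF L_add[OF assms(1,3)]]) (intro add_mono parts)
  moreover have "limit_lip (a + b) \<le> ?s + ?t"
    by (rule order_trans[OF limit_lip_add[OF assms(2,4)]]) (intro add_mono parts)
  moreover have "ennreal (norm (x + y - (a + b)) / tail n) \<le> ?s + ?t"
  proof -
    have "norm (x + y - (a + b)) \<le> norm (x - a) + norm (y - b)"
      using norm_triangle_ineq[of "x - a" "y - b"] by (simp add: algebra_simps)
    then have "norm (x + y - (a + b)) / tail n \<le> norm (x - a) / tail n + norm (y - b) / tail n"
      using tail_pos[of n] by (simp add: divide_right_mono flip: add_divide_distrib)
    then have "ennreal (norm (x + y - (a + b)) / tail n)
        \<le> ennreal (norm (x - a) / tail n + norm (y - b) / tail n)"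
      by (rule ennreal_leI)
    also have "\<dots> = ennreal (norm (x - a) / tail n) + ennreal (norm (y - b) / tail n)"
      using tail_pos[of n] by (intro ennreal_plus) (simp_all add: less_imp_le)
    also have "\<dots> \<le> ?s + ?t"
      by (intro add_mono parts)
    finally show ?thesis .
  qed
  ultimately show ?thesis
    by (subst joint_lip_def) (simp only: max.bounded_iff fst_conv snd_conv)
qed

lemma joint_lip_scale:
  assumes "x \<in> sa (A n)" "a \<in> sa UNIV"
  shows "joint_lip n (c *\<^sub>R x, c *\<^sub>R a) = ennreal \<bar>c\<bar> * joint_lip n (x, a)"
proof -
  have "ennreal (norm (c *\<^sub>R x - c *\<^sub>R a) / tail n) = ennreal \<bar>c\<bar> * ennreal (norm (x - a) / tail n)"
    using tail_pos[of n] by (simp add: ennreal_mult'[symmetric] flip: scaleR_right_diff_distrib)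
  moreover have "mono ((*) (ennreal \<bar>c\<bar>))"
    by (intro monoI mult_left_mono) auto
  ultimately show ?thesis
    by (simp add: joint_lip_def L_scale[OF assms(1)] limit_lip_scale[OF assms(2)] max_of_mono)
qed

lemma joint_lip_kernel:
  "{p \<in> sa (A n) \<times> sa UNIV. joint_lip n p = 0} = range (\<lambda>c. c *\<^sub>R (1, 1))"
proof (intro set_eqI iffI)
  fix p assume p: "p \<in> {p \<in> sa (A n) \<times> sa UNIV. joint_lip n p = 0}"
  obtain x a where xa: "p = (x, a)"
    by (cases p)
  then have "joint_lip n (x, a) \<le> ennreal 0" "x \<in> sa (A n)"
    using p by auto
  then have "L n x = 0" "norm (x - a) \<le> 0"
    using joint_lip_le_iff[of 0 n x a] by auto
  then obtain c where "x = c *\<^sub>R 1" "a = x"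
    using L_eq_0_iff[OF \<open>x \<in> sa (A n)\<close>] by auto
  then show "p \<in> range (\<lambda>c. c *\<^sub>R (1, 1))"
    by (auto simp: xa)
next
  fix p assume "p \<in> range (\<lambda>c. c *\<^sub>R ((1, 1) :: 'a \<times> 'a))"
  then obtain c where "p = (c *\<^sub>R 1, c *\<^sub>R 1)"
    by auto
  then show "p \<in> {p \<in> sa (A n) \<times> sa UNIV. joint_lip n p = 0}"
    by (simp add: in_sa in_sa_UNIV joint_lip_def L_scalar limit_lip_scalar)
qed

lemma joint_lip_dom_dense: "sa (A n) \<times> sa UNIV \<subseteq> closure (dom_of (joint_space n) (joint_lip n))"
proof -
  have "dom_of (joint_space n) (joint_lip n) = dom_of (sa_ous (A n)) (L n) \<times> dom_of (sa_ous UNIV) limit_lip"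
    by (auto simp: dom_of_def joint_lip_def)
  moreover have "sa (A n) \<subseteq> closure (dom_of (sa_ous (A n)) (L n))"
  proof
    fix x assume x: "x \<in> sa (A n)"
    show "x \<in> closure (dom_of (sa_ous (A n)) (L n))"
      unfolding closure_approachable dist_norm
      using dom_dense[OF x] by (auto simp: dom_of_def)
  qed
  ultimately show ?thesis
    using limit_lip_dom_dense by (simp add: closure_Times Sigma_mono)
qed

lemma joint_lip_ball_compact: "compact {p \<in> lip_ball (joint_space n) (joint_lip n). norm p \<le> R}"
proof -
  let ?K = "{x \<in> level_ball n. norm x \<le> R} \<times> {a \<in> limit_ball. norm a \<le> R}"
  let ?C = "{p :: 'a \<times> 'a. norm (fst p - snd p) \<le> tail n} \<inter> cball 0 R"
  have "compact (?K \<inter> ?C)"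
    by (intro compact_Int_closed compact_Times compact_lip_ball limit_lip_ball_compact closed_Int
        closed_cball closed_Collect_le continuous_intros)
  moreover have "{p \<in> lip_ball (joint_space n) (joint_lip n). norm p \<le> R} = ?K \<inter> ?C"
    using norm_fst_le norm_snd_le order_trans unfolding joint_lip_ball by (fastforce simp: mem_Times_iff)
  ultimately show ?thesis
    by simp
qed

lemma quantum_metric_ous_joint: "quantum_metric_ous (joint_space n) (joint_lip n)"
proof -
  interpret V: normed_order_unit_space "joint_space n"
    by (rule normed_order_unit_space_sum_sa[OF subalg cstar_subalgebra_UNIV])
  obtain R where R: "\<And>a. a \<in> limit_ball \<Longrightarrow> \<exists>c. norm (a - c *\<^sub>R 1) \<le> R"
    using limit_lip_bounded by blast
  show ?thesis
  proof (rule V.quantum_metric_ous_of_compact[where R\<^sub>0 = "2 * R + tail n"])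
    show "joint_lip n (p + q) \<le> joint_lip n p + joint_lip n q"
      if "p \<in> carrier (joint_space n)" "q \<in> carrier (joint_space n)" for p q
      using that joint_lip_add by (cases p; cases q) auto
    show "joint_lip n (c *\<^sub>R p) = ennreal \<bar>c\<bar> * joint_lip n p" if "p \<in> carrier (joint_space n)" for p c
      using that joint_lip_scale by (cases p) auto
    show "carrier (joint_space n) \<subseteq> closure (dom_of (joint_space n) (joint_lip n))"
      using joint_lip_dom_dense by simp
    show "{p \<in> carrier (joint_space n). joint_lip n p = 0} = range (\<lambda>c. c *\<^sub>R unit (joint_space n))"
      using joint_lip_kernel by simp
    show "compact {p \<in> lip_ball (joint_space n) (joint_lip n). norm p \<le> R}" for R
      by (rule joint_lip_ball_compact)
    fix p assume "p \<in> lip_ball (joint_space n) (joint_lip n)"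
    then obtain x a where p: "p = (x, a)" "a \<in> limit_ball" "norm (x - a) \<le> tail n"
      unfolding joint_lip_ball by blast
    obtain c where c: "norm (a - c *\<^sub>R 1) \<le> R"
      using R[OF p(2)] by blast
    have "norm (x - c *\<^sub>R 1) \<le> norm (x - a) + norm (a - c *\<^sub>R 1)"
      using norm_triangle_ineq[of "x - a" "a - c *\<^sub>R 1"] by simp
    then have "norm (x - c *\<^sub>R 1, a - c *\<^sub>R 1) \<le> 2 * R + tail n"
      using norm_Pair_le[of "x - c *\<^sub>R 1" "a - c *\<^sub>R 1"] c p(3) by linarith
    then show "\<exists>c. norm (p - c *\<^sub>R unit (joint_space n)) \<le> 2 * R + tail n"
      by (intro exI[of _ c]) (simp add: p(1))
  qed
qed

lemma joint_lip_admissible: "admissible (sa_ous (A n)) (L n) (sa_ous UNIV) limit_lip (joint_lip n)"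
  unfolding admissible_def sa_ous_simps
proof (intro conjI ballI quantum_metric_ous_joint)
  fix x assume x: "x \<in> sa (A n)"
  show "(INF a\<in>sa UNIV. joint_lip n (x, a)) = L n x"
  proof (rule antisym)
    show "L n x \<le> (INF a\<in>sa UNIV. joint_lip n (x, a))"
      by (intro INF_greatest) (simp add: joint_lip_def le_max_iff_disj)
    show "(INF a\<in>sa UNIV. joint_lip n (x, a)) \<le> L n x"
    proof (rule ennreal_le_epsilon)
      fix e :: real assume e: "0 < e" and "L n x < top"
      then obtain l where l: "0 \<le> l" "L n x = ennreal l"
        by (metis ennreal_cases less_irrefl)
      have le: "L n x \<le> ennreal (l + e)"
        unfolding l(2) using e by (intro ennreal_leI) simp
      obtain a where a: "a \<in> sa UNIV" "limit_lip a \<le> ennreal (l + e)" "norm (x - a) \<le> (l + e) * tail n"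
        using limit_near_level[OF x _ le] l(1) e by auto
      have "(INF a\<in>sa UNIV. joint_lip n (x, a)) \<le> joint_lip n (x, a)"
        by (rule INF_lower[OF a(1)])
      also have "\<dots> \<le> ennreal (l + e)"
        using joint_lip_le_iff[of "l + e" n x a] l(1) e a le by simp
      finally show "(INF a\<in>sa UNIV. joint_lip n (x, a)) \<le> L n x + ennreal e"
        using l e by simp
    qed
  qed
next
  fix a :: 'a assume a: "a \<in> sa UNIV"
  show "(INF x\<in>sa (A n). joint_lip n (x, a)) = limit_lip a"
  proof (rule antisym)
    show "limit_lip a \<le> (INF x\<in>sa (A n). joint_lip n (x, a))"
      by (intro INF_greatest) (simp add: joint_lip_def le_max_iff_disj)
    show "(INF x\<in>sa (A n). joint_lip n (x, a)) \<le> limit_lip a"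
    proof (rule ennreal_le_epsilon)
      fix e :: real assume e: "0 < e" and "limit_lip a < top"
      then obtain l where l: "0 \<le> l" "limit_lip a = ennreal l"
        by (metis ennreal_cases less_irrefl)
      have lt: "limit_lip a < ennreal (l + e)"
        unfolding l(2) using l(1) e by (intro ennreal_lessI) auto
      obtain x where x: "x \<in> sa (A n)" "L n x \<le> ennreal (l + e)" "norm (x - a) \<le> (l + e) * tail n"
        using level_near_limit[OF a lt] by blast
      have "(INF x\<in>sa (A n). joint_lip n (x, a)) \<le> joint_lip n (x, a)"
        by (rule INF_lower[OF x(1)])
      also have "\<dots> \<le> ennreal (l + e)"
        using joint_lip_le_iff[of "l + e" n x a] l(1) e x lt by (simp add: less_imp_le)
      finally show "(INF x\<in>sa (A n). joint_lip n (x, a)) \<le> limit_lip a + ennreal e"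
        using l e by simp
    qed
  qed
qed

lemma state_restrict:
  assumes \<psi>: "\<psi> \<in> states (sa_ous UNIV)"
  shows "restrict \<psi> (sa (A n)) \<in> states (sa_ous (A n))"
proof -
  have "le (sa_ous UNIV) 0 x" if "x \<in> sa (A n)" "le (sa_ous (A n)) 0 x" for x
    using that by (auto simp: sa_ous_def)
  then show ?thesis
    using statesD(2-5)[OF \<psi>] sa_UNIV by (auto simp: states_def in_sa)
qed

text \<open>
  A state of the \<open>n\<close>-th algebra and any extension of it to the whole algebra are \<open>tail n\<close>-close for the joint metric,
  because they can be evaluated by the same contraction.
\<close>

lemma mk_joint_le:
  assumes \<psi>: "\<psi> \<in> states (sa_ous UNIV)" and eq: "\<And>x. x \<in> sa (A n) \<Longrightarrow> \<phi> x = \<psi> x"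
  shows "mk (joint_space n) (joint_lip n) (restrict (\<phi> \<circ> fst) (carrier (joint_space n)))
      (restrict (\<psi> \<circ> snd) (carrier (joint_space n))) \<le> ennreal (tail n)"
  unfolding mk_def
proof (rule SUP_least, rule ennreal_leI)
  interpret V: normed_order_unit_space "sa_ous (UNIV :: 'a set)"
    by (rule normed_order_unit_space_sa[OF cstar_subalgebra_UNIV])
  fix p assume "p \<in> lip_ball (joint_space n) (joint_lip n)"
  then obtain x a where p: "p = (x, a)" and x: "x \<in> sa (A n)" and a: "a \<in> sa UNIV"
    and le: "norm (x - a) \<le> tail n"
    unfolding joint_lip_ball by (auto simp: lip_ball_def)
  have "\<bar>\<psi> (x - a)\<bar> \<le> norm (x - a)"
    using sa_UNIV[OF x] a by (intro V.state_abs_le[OF \<psi>]) (simp add: in_sa_UNIV)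
  then have "\<bar>\<psi> x - \<psi> a\<bar> \<le> tail n"
    using V.state_linear(3)[OF \<psi>, of x a] sa_UNIV[OF x] a le by simp
  then show "\<bar>restrict (\<phi> \<circ> fst) (carrier (joint_space n)) p - restrict (\<psi> \<circ> snd) (carrier (joint_space n)) p\<bar> \<le> tail n"
    using x a by (simp add: p eq)
qed

text \<open>
  Every state of the \<open>n\<close>-th algebra extends and every state of the whole algebra restricts, so each point of either state space has
  a partner in the other to which \<open>mk_joint_le\<close> applies.
\<close>

lemma dist_q_le_tail: "dist_q (sa_ous (A n)) (L n) (sa_ous UNIV) limit_lip \<le> ennreal (tail n)"
proof -
  let ?mk = "mk (joint_space n) (joint_lip n)"
  let ?F = "states_fst (sa_ous (A n)) (sa_ous (UNIV :: 'a set))" and ?S = "states_snd (sa_ous (A n)) (sa_ous (UNIV :: 'a set))"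
  have "dist_q (sa_ous (A n)) (L n) (sa_ous UNIV) limit_lip \<le> hausdorff_distance ?mk ?F ?S"
    unfolding dist_q_def by (rule INF_lower) (simp add: joint_lip_admissible)
  also have "\<dots> \<le> ennreal (tail n)"
    unfolding hausdorff_distance_def
  proof (intro max.boundedI SUP_least)
    fix f assume "f \<in> ?F"
    then obtain \<phi> where \<phi>: "\<phi> \<in> states (sa_ous (A n))"
      "f = restrict (\<phi> \<circ> fst) (carrier (joint_space n))"
      unfolding states_fst_def by blast
    obtain \<psi> where \<psi>: "\<psi> \<in> states (sa_ous UNIV)" "\<And>x. x \<in> sa (A n) \<Longrightarrow> \<psi> x = \<phi> x"
      using state_extension[OF subalg cstar_subalgebra_UNIV subset_UNIV \<phi>(1)] by blast
    show "(INF g\<in>?S. ?mk f g) \<le> ennreal (tail n)"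
    proof (rule INF_lower2)
      show "restrict (\<psi> \<circ> snd) (carrier (joint_space n)) \<in> ?S"
        unfolding states_snd_def using \<psi>(1) by blast
      show "?mk f (restrict (\<psi> \<circ> snd) (carrier (joint_space n))) \<le> ennreal (tail n)"
        unfolding \<phi>(2) by (rule mk_joint_le[OF \<psi>(1)]) (simp add: \<psi>(2))
    qed
  next
    fix g assume "g \<in> ?S"
    then obtain \<psi> where \<psi>: "\<psi> \<in> states (sa_ous UNIV)"
      "g = restrict (\<psi> \<circ> snd) (carrier (joint_space n))"
      unfolding states_snd_def by blast
    show "(INF f\<in>?F. ?mk f g) \<le> ennreal (tail n)"
    proof (rule INF_lower2)
      show "restrict (restrict \<psi> (sa (A n)) \<circ> fst) (carrier (joint_space n)) \<in> ?F"
        unfolding states_fst_def using state_restrict[OF \<psi>(1)] by blast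
      show "?mk (restrict (restrict \<psi> (sa (A n)) \<circ> fst) (carrier (joint_space n))) g \<le> ennreal (tail n)"
        unfolding \<psi>(2) by (rule mk_joint_le[OF \<psi>(1)]) simp
    qed
  qed
  finally show ?thesis .
qed

lemma dist_q_tendsto_0: "(\<lambda>n. dist_q (sa_ous (A n)) (L n) (sa_ous UNIV) limit_lip) \<longlonglongrightarrow> 0"
proof (rule tendsto_sandwich[OF _ _ tendsto_const])
  show "(\<lambda>n. ennreal (tail n)) \<longlonglongrightarrow> 0"
    using tendsto_ennrealI[OF tail_tendsto_0] by simp
qed (simp_all add: dist_q_le_tail)

end

theorem theorem6p13:
  fixes A :: "nat \<Rightarrow> 'a::unital_cstar_algebra set"
    and L :: "nat \<Rightarrow> 'a \<Rightarrow> ennreal"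
    and \<beta> :: "nat \<Rightarrow> real"
  assumes subalg: "\<And>n. cstar_subalgebra (A n)"
    and incr: "\<And>n. A n \<subseteq> A (Suc n)"
    and dense: "closure (\<Union>n. A n) = UNIV"
    and lip: "\<And>n. quantum_metric_ous (sa_ous (A n)) (L n)"
    and lip_decr: "\<And>n a. a \<in> sa (A n) \<Longrightarrow> L (Suc n) a \<le> L n a"
    and beta_pos: "\<And>n. 0 < \<beta> n"
    and beta_summable: "summable \<beta>"
    and bridge: "\<And>n. evident_bridge_length (A n) (L n) (A (Suc n)) (L (Suc n)) \<le> ennreal (\<beta> n)"
  shows "\<exists>\<psi>.
      order_unit_iso (sa_ous UNIV) (F_space A L \<beta>) \<psi> \<and>
      (\<forall>n. \<forall>a\<in>sa (A n). \<psi> a = psi A L \<beta> n a) \<and>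
      (let L\<^sub>A = F_lip A L \<beta> \<circ> \<psi> in
        quantum_metric_ous (sa_ous UNIV) L\<^sub>A \<and>
        (\<Union>n. dom_of (sa_ous (A n)) (L n)) \<subseteq> dom_of (sa_ous UNIV) L\<^sub>A \<and>
        (\<forall>n. dist_q (sa_ous (A n)) (L n) (sa_ous UNIV) L\<^sub>A \<le> ennreal (4 * (\<Sum>j. \<beta> (n + j)))) \<and>
        (\<lambda>n. dist_q (sa_ous (A n)) (L n) (sa_ous UNIV) L\<^sub>A) \<longlonglongrightarrow> 0)"
proof -
  interpret lip_tower A L \<beta>
    by unfold_locales (fact assms)+
  have "(\<Union>n. dom_of (sa_ous (A n)) (L n)) \<subseteq> dom_of (sa_ous UNIV) limit_lip"
    using limit_lip_finite sa_UNIV by (auto simp: dom_of_def)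
  moreover have "dist_q (sa_ous (A n)) (L n) (sa_ous UNIV) limit_lip \<le> ennreal (4 * (\<Sum>j. \<beta> (n + j)))" for n
  proof -
    have "tail n \<le> 4 * (\<Sum>j. \<beta> (n + j))"
      using tail_pos[of n] by (simp add: tail_def)
    then show ?thesis
      using dist_q_le_tail[of n] ennreal_leI order_trans by blast
  qed
  ultimately show ?thesis
    using order_unit_iso_fiber psi_eq_fiber quantum_metric_ous_limit dist_q_tendsto_0
    unfolding Let_def limit_lip_def by (intro exI[of _ fiber]) simp
qed

end
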